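(* Let $B^\alpha$ be a smooth real 4-vector field on Minkowski space, let $\zeta$ be a real constant, and let $\theta_\alpha=F_\alpha:=B^\beta e^{\zeta\mathcal J}\Theta_{\alpha\beta}$. Then $$\begin{aligned}L_V=&-384(B_\alpha B^\alpha)^2\cos4\zeta-256\,(B^\alpha B_\alpha\,\partial_\beta B^\beta-B^\alpha B_\beta\,\partial_\alpha B^\beta)\cos3\zeta\\&-32\,[2(\partial_\alpha B^\beta)(\partial^\alpha B_\beta)+(\partial_\alpha B^\alpha)^2]\cos2\zeta-32\,\epsilon_{\alpha\beta\rho\sigma}(\partial^\alpha B^\beta)(\partial^\rho B^\sigma)\sin2\zeta .\end{aligned}$$ If $\tau\ne0$ is a real constant and $\cos2\zeta\neq0$, then the field equation obtained by varying $L=L_K-\tau L_V$ with respect to $B^\alpha$ is $$\partial_\beta\partial^\beta B_\alpha+\tfrac12\partial_\alpha\partial_\beta B^\beta+\tfrac{6\cos3\zeta}{\cos2\zeta}\,(B_\beta\partial_\alpha B^\beta-B_\alpha\partial_\beta B^\beta)-\tfrac{12\cos4\zeta}{\cos2\zeta}\,(B_\beta B^\beta)B_\alpha=\tfrac{1}{128\,\tau\cos2\zeta}\,\psi^\dagger\hat\eta\gamma^\beta e^{\zeta\mathcal J}\Theta_{\beta\alpha}\psi .$$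
   Context: Minkowski space is $\mathbb R^4$ with coordinates $x^\alpha$ and constant metric $\eta=\mathrm{diag}(1,-1,-1,-1)$; indices are raised and lowered with $\eta$, and repeated indices are summed. $\epsilon_{\alpha\beta\rho\sigma}$ is the totally antisymmetric symbol with $\epsilon_{0123}=1$. The complex exterior algebra $\bigwedge_*$ of $\mathbb R^4$ has basis $\mathbf e_I=\mathbf e_{\alpha_1}\wedge\cdots\wedge\mathbf e_{\alpha_k}$, $\alpha_1<\dots<\alpha_k$, $|I|=k$ ($\mathbf e_\emptyset=1$), and $\mathbf e_I$ is defined by the same formula for any multi-index; $16\times16$ matrices are operators on it in this basis and $\dagger$ is conjugate transpose. Gamma matrices: $\gamma_\alpha\psi=\mathbf e_\alpha\wedge\psi-\iota_\alpha\psi$, where $\iota_\alpha$ is the linear operator with $\iota_\alpha\mathbf e_\emptyset=0$, $\iota_\alpha\mathbf e_\beta=\eta_{\alpha\beta}\mathbf e_\emptyset$, $\iota_\alpha(\mathbf e_I\wedge\mathbf e_J)=(\iota_\alpha\mathbf e_I)\wedge\mathbf e_J+(-1)^{|I|}\mathbf e_I\wedge\iota_\alpha\mathbf e_J$. Extended metric: $\hat\eta_{IJ}=0$ if $|I|\ne|J|$, and $\hat\eta_{IJ}=\det(\eta_{\alpha_i\beta_j})$ if $I=\alpha_1\cdots\alpha_k$, $J=\beta_1\cdots\beta_k$. $\Theta_I$ is the $16\times16$ matrix that commutes with all gamma matrices and satisfies $\Theta_I\mathbf e_\emptyset=\mathbf e_I$ (so $\Theta_{\alpha\beta}=-\Theta_{\beta\alpha}$);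 $\mathcal J=\Theta_{0123}$, which satisfies $\mathcal J^2=-\mathcal I$ ($\mathcal I$ the identity), and $e^{\zeta\mathcal J}=\cos\zeta\,\mathcal I+\sin\zeta\,\mathcal J$. Given four matrix-valued fields $\theta_\alpha$, put $\Omega_{\alpha\beta}=\partial_\alpha\theta_\beta-\partial_\beta\theta_\alpha+\theta_\alpha\theta_\beta-\theta_\beta\theta_\alpha$ and $$L_V=\tfrac12\,\mathrm{tr}(\Omega_{\alpha\beta}\Omega^{\alpha\beta})+c.c.$$ For a smooth field $\psi:\mathbb R^4\to\bigwedge_*\cong\mathbb C^{16}$ and a real constant $m$, put $D\psi=\gamma^\alpha(\partial_\alpha\psi+\theta_\alpha\psi)$ and $$L_K=\tfrac12\psi^\dagger\hat\eta D\psi+c.c.-m\,\psi^\dagger\hat\eta\psi ,$$ where $c.c.$ is the complex conjugate of the preceding term. "The field equation obtained by varying $L$" with respect to a field means its Euler–Lagrange equation (stationarity of $\int L\,d^4x$ under compactly supported variations of that field, with $\psi$ fixed). *)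

theory Defs
  imports "HOL-Analysis.Analysis"
begin

section \<open>Index conventions\<close>

text \<open>Spacetime indices are the elements \<open>0, 1, 2, 3\<close> of the numeral type \<^typ>\<open>4\<close>, in this
  order (\<open>4 = 0\<close> in this type). Multi-indices are lists of indices. The inverse metric has the
  same entries as \<open>eta\<close>, so \<open>eta\<close> both lowers and raises indices.\<close>

definition eta :: "4 \<Rightarrow> 4 \<Rightarrow> real" where
  "eta \<alpha> \<beta> = (if \<alpha> \<noteq> \<beta> then 0 else if \<alpha> = 0 then 1 else -1)"

definition lower :: "real^4 \<Rightarrow> real^4" where
  "lower v = (\<chi> \<alpha>. \<Sum>\<beta>\<in>UNIV. eta \<alpha> \<beta> * v $ \<beta>)"

definition epsilon :: "4 \<Rightarrow> 4 \<Rightarrow> 4 \<Rightarrow> 4 \<Rightarrow> real" where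
  "epsilon \<alpha> \<beta> \<rho> \<sigma> =
     (let p = (\<lambda>_. 0)(0 := \<alpha>, 1 := \<beta>, 2 := \<rho>, 3 := \<sigma>)
      in if p permutes UNIV then of_int (sign p) else 0)"

section \<open>The exterior algebra\<close>

text \<open>The coordinate \<open>v $ I\<close> is the coefficient of \<open>e\<^sub>\<alpha>\<^sub>1 \<and> \<dots> \<and> e\<^sub>\<alpha>\<^sub>k\<close>, where \<open>I = {\<alpha>\<^sub>1 < \<dots> < \<alpha>\<^sub>k}\<close>.\<close>

type_synonym ext = "complex^(4 set)"
type_synonym ext_op = "complex^(4 set)^(4 set)"

text \<open>The sign that sorts the concatenation of two increasing multi-indices.\<close>

definition wsign :: "4 set \<Rightarrow> 4 set \<Rightarrow> complex" where
  "wsign I J = (-1) ^ card {(i, j). i \<in> I \<and> j \<in> J \<and> j < i}"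

definition wedge :: "ext \<Rightarrow> ext \<Rightarrow> ext" (infixr "\<and>\<^sub>E" 70) where
  "u \<and>\<^sub>E v = (\<chi> K. \<Sum>I\<in>Pow K. wsign I (K - I) * u $ I * v $ (K - I))"

primrec bas :: "4 list \<Rightarrow> ext" where
  "bas [] = axis {} 1"
| "bas (\<alpha> # Is) = axis {\<alpha>} 1 \<and>\<^sub>E bas Is"

definition is_iota :: "4 \<Rightarrow> ext_op \<Rightarrow> bool" where
  "is_iota \<alpha> M \<longleftrightarrow>
     M *v bas [] = 0 \<and>
     (\<forall>\<beta>. M *v bas [\<beta>] = complex_of_real (eta \<alpha> \<beta>) *s bas []) \<and>
     (\<forall>Is Js. M *v (bas Is \<and>\<^sub>E bas Js) =
        (M *v bas Is) \<and>\<^sub>E bas Js + (-1) ^ length Is *s (bas Is \<and>\<^sub>E (M *v bas Js)))"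

definition iota :: "4 \<Rightarrow> ext_op" where
  "iota \<alpha> = (THE M. is_iota \<alpha> M)"

definition gamma :: "4 \<Rightarrow> ext_op" where
  "gamma \<alpha> = matrix (\<lambda>\<psi>. bas [\<alpha>] \<and>\<^sub>E \<psi> - iota \<alpha> *v \<psi>)"

definition gamma_up :: "4 \<Rightarrow> ext_op" where
  "gamma_up \<alpha> = (\<Sum>\<beta>\<in>UNIV. eta \<alpha> \<beta> *\<^sub>R gamma \<beta>)"

definition is_Theta :: "4 list \<Rightarrow> ext_op \<Rightarrow> bool" where
  "is_Theta Is M \<longleftrightarrow> (\<forall>\<alpha>. M ** gamma \<alpha> = gamma \<alpha> ** M) \<and> M *v bas [] = bas Is"

definition Theta :: "4 list \<Rightarrow> ext_op" where
  "Theta Is = (THE M. is_Theta Is M)"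

definition JJ :: ext_op where
  "JJ = Theta [0, 1, 2, 3]"

definition mexp :: "ext_op \<Rightarrow> ext_op" where
  "mexp A = (\<Sum>n. inverse (fact n) *\<^sub>R (((**) A) ^^ n) (mat 1))"

text \<open>For multi-indices of equal length \<open>k\<close> this is the Leibniz formula for the determinant of
  the \<open>k \<times> k\<close> matrix \<open>eta (Is ! i) (Js ! j)\<close>; the library determinant needs the size as a type.\<close>

definition eta_hat_idx :: "4 list \<Rightarrow> 4 list \<Rightarrow> real" where
  "eta_hat_idx Is Js =
     (if length Is \<noteq> length Js then 0
      else \<Sum>p | p permutes {..<length Is}.
             of_int (sign p) * (\<Prod>i<length Is. eta (Is ! i) (Js ! p i)))"

definition eta_hat :: ext_op where
  "eta_hat = (\<chi> I J. complex_of_real (eta_hat_idx (sorted_list_of_set I) (sorted_list_of_set J)))"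

text \<open>The scalar \<open>\<phi>\<^sup>\<dagger> eta_hat \<psi>\<close>.\<close>

definition herm :: "ext \<Rightarrow> ext \<Rightarrow> complex" where
  "herm \<phi> \<psi> = (\<Sum>I\<in>UNIV. cnj (\<phi> $ I) * (eta_hat *v \<psi>) $ I)"

section \<open>Fields and Lagrangians\<close>

definition pd :: "4 \<Rightarrow> (real^4 \<Rightarrow> 'b::real_normed_vector) \<Rightarrow> real^4 \<Rightarrow> 'b" where
  "pd \<alpha> f x = vector_derivative (\<lambda>t. f (x + t *\<^sub>R axis \<alpha> 1)) (at 0)"

definition pd_up :: "4 \<Rightarrow> (real^4 \<Rightarrow> 'b::real_normed_vector) \<Rightarrow> real^4 \<Rightarrow> 'b" where
  "pd_up \<alpha> f x = (\<Sum>\<beta>\<in>UNIV. eta \<alpha> \<beta> *\<^sub>R pd \<beta> f x)"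

definition smooth :: "(real^4 \<Rightarrow> 'b::real_normed_vector) \<Rightarrow> bool" where
  "smooth f \<longleftrightarrow> (\<forall>\<alpha>s. foldr pd \<alpha>s f differentiable_on UNIV)"

type_synonym gauge = "4 \<Rightarrow> real^4 \<Rightarrow> ext_op"

definition Omega :: "gauge \<Rightarrow> 4 \<Rightarrow> 4 \<Rightarrow> real^4 \<Rightarrow> ext_op" where
  "Omega \<theta> \<alpha> \<beta> x =
     pd \<alpha> (\<theta> \<beta>) x - pd \<beta> (\<theta> \<alpha>) x + \<theta> \<alpha> x ** \<theta> \<beta> x - \<theta> \<beta> x ** \<theta> \<alpha> x"

definition Omega_up :: "gauge \<Rightarrow> 4 \<Rightarrow> 4 \<Rightarrow> real^4 \<Rightarrow> ext_op" where
  "Omega_up \<theta> \<alpha> \<beta> x = (\<Sum>\<rho>\<in>UNIV. \<Sum>\<sigma>\<in>UNIV. (eta \<alpha> \<rho> * eta \<beta> \<sigma>) *\<^sub>R Omega \<theta> \<rho> \<sigma> x)"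

definition plus_cc :: "complex \<Rightarrow> complex" where
  "plus_cc z = z + cnj z"

definition L_V :: "gauge \<Rightarrow> real^4 \<Rightarrow> complex" where
  "L_V \<theta> x = plus_cc (1/2 * trace (\<Sum>\<alpha>\<in>UNIV. \<Sum>\<beta>\<in>UNIV. Omega \<theta> \<alpha> \<beta> x ** Omega_up \<theta> \<alpha> \<beta> x))"

definition Dirac :: "gauge \<Rightarrow> (real^4 \<Rightarrow> ext) \<Rightarrow> real^4 \<Rightarrow> ext" where
  "Dirac \<theta> \<psi> x = (\<Sum>\<alpha>\<in>UNIV. gamma_up \<alpha> *v (pd \<alpha> \<psi> x + \<theta> \<alpha> x *v \<psi> x))"

definition L_K :: "real \<Rightarrow> gauge \<Rightarrow> (real^4 \<Rightarrow> ext) \<Rightarrow> real^4 \<Rightarrow> complex" where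
  "L_K m \<theta> \<psi> x =
     plus_cc (1/2 * herm (\<psi> x) (Dirac \<theta> \<psi> x)) - complex_of_real m * herm (\<psi> x) (\<psi> x)"

definition F :: "real \<Rightarrow> (real^4 \<Rightarrow> real^4) \<Rightarrow> gauge" where
  "F \<zeta> B \<alpha> x = (\<Sum>\<beta>\<in>UNIV. (B x $ \<beta>) *\<^sub>R (mexp (\<zeta> *\<^sub>R JJ) ** Theta [\<alpha>, \<beta>]))"

text \<open>Stationarity of the action. The integral of \<open>L\<close> over all of spacetime need not converge, so,
  as usual, it is taken over a compact set outside which the variation \<open>h\<close> vanishes; enlarging
  that set changes the action by a term that does not depend on \<open>s\<close>.\<close>

definition stationary :: "((real^4 \<Rightarrow> real^4) \<Rightarrow> real^4 \<Rightarrow> complex) \<Rightarrow> (real^4 \<Rightarrow> real^4) \<Rightarrow> bool" where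
  "stationary L B \<longleftrightarrow>
     (\<forall>h K. smooth h \<and> compact K \<and> (\<forall>x. x \<notin> K \<longrightarrow> h x = 0) \<longrightarrow>
        ((\<lambda>s. integral K (L (\<lambda>x. B x + s *\<^sub>R h x))) has_vector_derivative 0) (at 0))"

section \<open>Existence and uniqueness of the operators \<open>iota\<close> and \<open>Theta\<close>\<close>

lemma axis_ind:
  fixes v :: ext
  assumes "\<And>I. P (axis I 1)" "\<And>u v. P u \<Longrightarrow> P v \<Longrightarrow> P (u + v)" "\<And>c v. P v \<Longrightarrow> P (c *s v)"
  shows "P v"
proof -
  have "P (\<Sum>I\<in>S. v $ I *s axis I 1)" if "finite S" for S
    using that
  proof (induction S rule: finite_induct)
    case empty
    have "P (0 *s axis {} 1)" using assms(1,3) by blast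
    then show ?case by simp
  qed (use assms in auto)
  then show ?thesis
    using basis_expansion[of v] by (metis finite_class.finite_UNIV)
qed

lemma wsign_un_left:
  assumes "I \<inter> I' = {}"
  shows "wsign (I \<union> I') J = wsign I J * wsign I' J"
proof -
  have "{(i, j). i \<in> I \<union> I' \<and> j \<in> J \<and> j < i} =
      {(i, j). i \<in> I \<and> j \<in> J \<and> j < i} \<union> {(i, j). i \<in> I' \<and> j \<in> J \<and> j < i}"
    by auto
  moreover have "{(i, j). i \<in> I \<and> j \<in> J \<and> j < i} \<inter> {(i, j). i \<in> I' \<and> j \<in> J \<and> j < i} = {}"
    using assms by auto
  ultimately show ?thesis
    unfolding wsign_def by (simp add: card_Un_disjoint power_add)
qed

lemma wsign_un_right:
  assumes "J \<inter> J' = {}"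
  shows "wsign I (J \<union> J') = wsign I J * wsign I J'"
proof -
  have "{(i, j). i \<in> I \<and> j \<in> J \<union> J' \<and> j < i} =
      {(i, j). i \<in> I \<and> j \<in> J \<and> j < i} \<union> {(i, j). i \<in> I \<and> j \<in> J' \<and> j < i}"
    by auto
  moreover have "{(i, j). i \<in> I \<and> j \<in> J \<and> j < i} \<inter> {(i, j). i \<in> I \<and> j \<in> J' \<and> j < i} = {}"
    using assms by auto
  ultimately show ?thesis
    unfolding wsign_def by (simp add: card_Un_disjoint power_add)
qed

lemma wsign_square: "wsign I J * wsign I J = 1"
  unfolding wsign_def by (simp flip: power_add mult_2)

lemma wsign_nonzero: "wsign I J \<noteq> 0"
  unfolding wsign_def by simp

lemma wsign_empty [simp]: "wsign {} J = 1" "wsign I {} = 1"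
  unfolding wsign_def by auto

lemma wsign_swap: "a \<noteq> b \<Longrightarrow> wsign {a} {b} * wsign {b} {a} = -1"
proof -
  assume "a \<noteq> b"
  have 1: "wsign {p} {q} = (if q < p then -1 else 1)" for p q
  proof (cases "q < p")
    case True
    then have "{(i, j). i \<in> {p} \<and> j \<in> {q} \<and> j < i} = {(p, q)}" by auto
    then show ?thesis using True by (simp add: wsign_def)
  next
    case False
    then have "{(i, j). i \<in> {p} \<and> j \<in> {q} \<and> j < i} = {}" by auto
    then show ?thesis using False unfolding wsign_def by (metis card.empty power_0)
  qed
  show ?thesis using \<open>a \<noteq> b\<close> by (auto simp: 1)
qed

lemma wedge_axis:
  "axis I 1 \<and>\<^sub>E axis J 1 = (if I \<inter> J = {} then wsign I J *s axis (I \<union> J) 1 else 0)"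
proof (rule vec_eq_iff[THEN iffD2], rule allI)
  fix K
  have "(axis I 1 \<and>\<^sub>E axis J 1) $ K =
      (\<Sum>I'\<in>Pow K. if I' = I then (if K - I = J then wsign I J else 0) else 0)"
    unfolding wedge_def vec_lambda_beta by (rule sum.cong) (auto simp: axis_def)
  also have "\<dots> = (if I \<subseteq> K \<and> K - I = J then wsign I J else 0)"
    by (subst sum.delta) auto
  also have "\<dots> = (if I \<inter> J = {} then wsign I J *s axis (I \<union> J) 1 else 0) $ K"
    by (auto simp: axis_def)
  finally show "(axis I 1 \<and>\<^sub>E axis J 1) $ K = \<dots>" .
qed

lemma wedge_lin:
  "(u + u') \<and>\<^sub>E v = u \<and>\<^sub>E v + u' \<and>\<^sub>E v"
  "u \<and>\<^sub>E (v + v') = u \<and>\<^sub>E v + u \<and>\<^sub>E v'"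
  "(c *s u) \<and>\<^sub>E v = c *s (u \<and>\<^sub>E v)"
  "u \<and>\<^sub>E (c *s v) = c *s (u \<and>\<^sub>E v)"
  unfolding wedge_def vec_eq_iff
  by (simp_all add: algebra_simps sum.distrib sum_distrib_left)

lemma wedge_zero [simp]: "0 \<and>\<^sub>E v = 0" "u \<and>\<^sub>E 0 = 0"
  unfolding wedge_def vec_eq_iff by simp_all

lemma wedge_neg: "u \<and>\<^sub>E (- v) = - (u \<and>\<^sub>E v)"
  unfolding wedge_def vec_eq_iff by (simp add: sum_negf)

lemma wedge_diff: "u \<and>\<^sub>E (v - v') = u \<and>\<^sub>E v - u \<and>\<^sub>E v'" "(v - v') \<and>\<^sub>E u = v \<and>\<^sub>E u - v' \<and>\<^sub>E u"
  unfolding wedge_def vec_eq_iff by (simp_all add: algebra_simps sum_subtractf)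

lemma wedge_assoc: "(u \<and>\<^sub>E v) \<and>\<^sub>E w = u \<and>\<^sub>E (v \<and>\<^sub>E w)"
proof (induction u rule: axis_ind)
  case (1 I)
  show ?case
  proof (induction v rule: axis_ind)
    case (1 J)
    show ?case
    proof (induction w rule: axis_ind)
      case (1 K)
      show ?case
        by (auto simp: wedge_axis wedge_lin wsign_un_left wsign_un_right Int_Un_distrib
            Int_Un_distrib2 Un_assoc mult_ac)
    qed (simp_all add: wedge_lin)
  qed (simp_all add: wedge_lin)
qed (simp_all add: wedge_lin)

lemma wedge_one [simp]: "axis {} 1 \<and>\<^sub>E v = v" "v \<and>\<^sub>E axis {} 1 = v"
proof -
  show "axis {} 1 \<and>\<^sub>E v = v"
    by (induction v rule: axis_ind) (simp_all add: wedge_lin wedge_axis)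
  show "v \<and>\<^sub>E axis {} 1 = v"
    by (induction v rule: axis_ind) (simp_all add: wedge_lin wedge_axis)
qed

lemma bas_single [simp]: "bas [a] = axis {a} 1"
  by simp

lemma bas_append: "bas (Is @ Js) = bas Is \<and>\<^sub>E bas Js"
  by (induction Is) (simp_all add: wedge_assoc)

lemma wedge_anticomm: "axis {a} 1 \<and>\<^sub>E axis {b} 1 = - (axis {b} 1 \<and>\<^sub>E axis {a} 1)"
proof (cases "a = b")
  case False
  then have "wsign {a} {b} = - wsign {b} {a}"
    using wsign_swap[OF False] wsign_square[of "{b}" "{a}"] wsign_nonzero[of "{b}" "{a}"]
    by (metis minus_mult_left mult_right_cancel)
  then show ?thesis using False by (auto simp: wedge_axis insert_commute vec_eq_iff)
qed (simp add: wedge_axis)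

lemma axis_insert:
  "a \<notin> I \<Longrightarrow> axis (insert a I) 1 = wsign {a} I *s (axis {a} 1 \<and>\<^sub>E axis I 1)"
  by (simp add: wedge_axis wsign_square vector_smult_assoc)

lemma bas_sorted: "sorted Is \<Longrightarrow> distinct Is \<Longrightarrow> bas Is = axis (set Is) 1"
proof (induction Is)
  case (Cons a Is)
  then have "{(i, j). i \<in> {a} \<and> j \<in> set Is \<and> j < i} = {}" by auto
  then have "wsign {a} (set Is) = 1" unfolding wsign_def by (metis card.empty power_0)
  then show ?case using Cons by (simp add: wedge_axis)
qed simp

text \<open>The basis of the exterior algebra is indexed as described.\<close>

lemma axis_bas: "axis I 1 = bas (sorted_list_of_set I)"
  by (simp add: bas_sorted)

text \<open>The explicit form of \<open>iota\<close>, and below (\<open>rho\<close>) operators that commute with all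
  \<open>gamma\<close> and, applied repeatedly to \<open>bas []\<close>, yield the basis vectors up to sign.\<close>

definition iota0 :: "4 \<Rightarrow> ext \<Rightarrow> ext" where
  "iota0 a v = (\<chi> K. if a \<in> K then 0
     else complex_of_real (eta a a) * wsign {a} K * v $ insert a K)"

lemma iota0_lin: "iota0 a (u + v) = iota0 a u + iota0 a v" "iota0 a (c *s v) = c *s iota0 a v"
  unfolding iota0_def vec_eq_iff by (simp_all add: algebra_simps)

lemma iota0_axis:
  "iota0 a (axis I 1) =
     (if a \<in> I then (complex_of_real (eta a a) * wsign {a} (I - {a})) *s axis (I - {a}) 1 else 0)"
  unfolding iota0_def vec_eq_iff by (auto simp: axis_def)

lemma iota0_gen:
  "iota0 a (axis {b} 1 \<and>\<^sub>E v) = complex_of_real (eta a b) *s v - axis {b} 1 \<and>\<^sub>E iota0 a v"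
proof (induction v rule: axis_ind)
  case (1 I)
  consider "a = b" "a \<in> I" | "a = b" "a \<notin> I" | "a \<noteq> b" "b \<in> I" | "a \<noteq> b" "b \<notin> I" "a \<notin> I"
    | "a \<noteq> b" "b \<notin> I" "a \<in> I" by blast
  then show ?case
  proof cases
    case 1
    then show ?thesis
      by (auto simp: wedge_axis wedge_lin iota0_axis iota0_lin vector_smult_assoc mult.assoc
          wsign_square insert_absorb)
         (simp add: iota0_def vec_eq_iff)
  next
    case 2
    then show ?thesis
      by (auto simp: wedge_axis wedge_lin iota0_axis iota0_lin vector_smult_assoc mult_ac
          wsign_square insert_Diff_if)
  next
    case 3
    then show ?thesis
      by (auto simp: wedge_axis wedge_lin iota0_axis iota0_lin eta_def)
         (simp add: iota0_def vec_eq_iff)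
  next
    case 4
    then show ?thesis
      by (auto simp: wedge_axis wedge_lin iota0_axis iota0_lin eta_def)
  next
    case 5
    define K where "K = I - {a}"
    have I: "I = insert a K" "a \<notin> K" "b \<notin> K" using 5 by (auto simp: K_def)
    have s1: "wsign {b} I = wsign {b} {a} * wsign {b} K"
      using wsign_un_right[of "{a}" K "{b}"] I by simp
    have s2: "wsign {a} (insert b K) = wsign {a} {b} * wsign {a} K"
      using wsign_un_right[of "{b}" K "{a}"] I by simp
    have e: "insert b I - {a} = insert b K" using I 5 by auto
    have "wsign {b} I * (complex_of_real (eta a a) * wsign {a} (insert b K)) =
      (wsign {a} {b} * wsign {b} {a}) * (complex_of_real (eta a a) * (wsign {a} K * wsign {b} K))"
      by (simp add: s1 s2 mult_ac)
    also have "\<dots> = - (complex_of_real (eta a a) * (wsign {a} K * wsign {b} K))"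
      using wsign_swap 5 by simp
    finally show ?thesis
      using 5 I(2,3)
      by (simp add: wedge_axis wedge_lin iota0_axis iota0_lin e K_def[symmetric]
          vector_smult_assoc eta_def[of a b] mult_ac)
  qed
next
  case (3 c v)
  then show ?case
    by (simp add: wedge_lin iota0_lin mult.commute)
qed (simp_all add: wedge_lin iota0_lin)

lemma iota0_leibniz:
  "iota0 a (bas Is \<and>\<^sub>E v) = iota0 a (bas Is) \<and>\<^sub>E v + (-1) ^ length Is *s (bas Is \<and>\<^sub>E iota0 a v)"
proof (induction Is)
  case Nil
  show ?case by (simp add: iota0_axis)
next
  case (Cons b Is)
  then show ?case
    by (simp add: wedge_assoc iota0_gen wedge_lin wedge_diff)
qed

lemma linear_iota0: "Vector_Spaces.linear (*s) (*s) (iota0 a)"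
  by (simp add: Vector_Spaces.linear_iff vec.vector_space_axioms iota0_lin)

lemma is_iota_iota0: "is_iota a (matrix (iota0 a))"
  unfolding is_iota_def
  by (auto simp: matrix_works[OF linear_iota0] iota0_leibniz)
     (auto simp: iota0_axis eta_def)

lemma mv_eqI:
  fixes M :: ext_op
  assumes "\<And>I. M *v axis I 1 = M' *v axis I 1"
  shows "M = M'"
proof -
  have "M *v v = M' *v v" for v
    by (induction v rule: axis_ind)
      (simp_all add: assms matrix_vector_right_distrib vector_scalar_commute)
  then show ?thesis by (simp add: matrix_eq)
qed

lemma is_iota_unique:
  assumes "is_iota a M" "is_iota a M'" shows "M = M'"
proof -
  have "M *v bas Is = M' *v bas Is" for Is
  proof (induction Is)
    case Nil
    then show ?case using assms by (simp add: is_iota_def)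
  next
    case (Cons b Is)
    have "N *v (bas [b] \<and>\<^sub>E bas Is) =
        (complex_of_real (eta a b) *s bas []) \<and>\<^sub>E bas Is - (bas [b] \<and>\<^sub>E (N *v bas Is))"
      if "is_iota a N" for N
    proof -
      have "N *v (bas [b] \<and>\<^sub>E bas Is) =
          (N *v bas [b]) \<and>\<^sub>E bas Is + (-1) ^ length [b] *s (bas [b] \<and>\<^sub>E (N *v bas Is))"
        using that unfolding is_iota_def by blast
      moreover have "N *v bas [b] = complex_of_real (eta a b) *s bas []"
        using that unfolding is_iota_def by blast
      ultimately show ?thesis by (simp only: list.size) simp
    qed
    from this[OF assms(1)] this[OF assms(2)] Cons show ?case by simp
  qed
  then show ?thesis by (metis mv_eqI axis_bas)
qed

lemma ex1_iota: "\<exists>!M. is_iota a M"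
  using is_iota_iota0 is_iota_unique by blast

lemma is_iota_iota: "is_iota a (iota a)"
  unfolding iota_def by (rule theI'[OF ex1_iota])

lemma iota_eq: "iota a *v v = iota0 a v"
  using is_iota_unique[OF is_iota_iota is_iota_iota0] matrix_works[OF linear_iota0] by metis

lemma iota0_anticomm: "iota0 a (iota0 b v) = - iota0 b (iota0 a v)"
proof -
  have lin0: "iota0 d 0 = 0" for d by (simp add: iota0_def vec_eq_iff)
  have neg: "iota0 d (u - w) = iota0 d u - iota0 d w" for d u w
    by (simp add: iota0_def vec_eq_iff algebra_simps)
  have *: "iota0 a (iota0 b (bas Is)) = - iota0 b (iota0 a (bas Is))" for Is
  proof (induction Is)
    case Nil
    show ?case by (simp add: iota0_axis lin0)
  next
    case (Cons c Is)
    then show ?case by (simp add: iota0_gen iota0_lin neg wedge_neg)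
  qed
  show ?thesis
  proof (induction v rule: axis_ind)
    case (1 I)
    show ?case using *[of "sorted_list_of_set I"] by (simp only: axis_bas)
  qed (simp_all add: iota0_lin)
qed

lemma gamma_mv: "gamma a *v v = axis {a} 1 \<and>\<^sub>E v - iota0 a v"
proof -
  have "Vector_Spaces.linear (*s) (*s) (\<lambda>\<psi>. bas [a] \<and>\<^sub>E \<psi> - iota a *v \<psi>)"
    by (simp add: Vector_Spaces.linear_iff vec.vector_space_axioms iota_eq iota0_lin wedge_lin)
  from matrix_works[OF this] show ?thesis
    unfolding gamma_def by (simp add: iota_eq)
qed

definition grade :: "ext \<Rightarrow> ext" where
  "grade v = (\<chi> I. (-1) ^ card I * v $ I)"

lemma grade_lin: "grade (u + v) = grade u + grade v" "grade (c *s v) = c *s grade v"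
  "grade (u - v) = grade u - grade v"
  unfolding grade_def vec_eq_iff by (simp_all add: algebra_simps)

lemma grade_axis: "grade (axis I 1) = (-1) ^ card I *s axis I 1"
  unfolding grade_def vec_eq_iff by (simp add: axis_def)

lemma grade_wedge: "grade (axis {a} 1 \<and>\<^sub>E v) = - (axis {a} 1 \<and>\<^sub>E grade v)"
proof (induction v rule: axis_ind)
  case (1 I)
  show ?case
  proof (cases "a \<in> I")
    case True
    then have "axis {a} 1 \<and>\<^sub>E axis I 1 = 0" by (simp only: wedge_axis) simp
    moreover have "grade 0 = 0" by (simp add: grade_def vec_eq_iff)
    ultimately show ?thesis by (simp only: grade_axis wedge_lin) simp
  next
    case False
    then have w: "axis {a} 1 \<and>\<^sub>E axis I 1 = wsign {a} I *s axis (insert a I) 1"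
      by (simp only: wedge_axis) simp
    have "(-1::complex) ^ card (insert a I) = - ((-1) ^ card I)"
      using False by simp
    then show ?thesis
      by (simp only: grade_axis grade_lin wedge_lin w vector_smult_assoc vector_smult_lneg vector_smult_rneg
          mult_minus_right mult.commute)
  qed
next
  case (2 u v)
  then show ?case by (simp only: grade_lin wedge_lin minus_add_distrib)
next
  case (3 c v)
  then show ?case by (simp only: grade_lin wedge_lin vector_smult_rneg)
qed

lemma grade_iota0: "grade (iota0 a v) = - iota0 a (grade v)"
  unfolding grade_def iota0_def vec_eq_iff by simp

definition rho :: "4 \<Rightarrow> ext \<Rightarrow> ext" where
  "rho a v = axis {a} 1 \<and>\<^sub>E grade v + iota0 a (grade v)"

lemma rho_lin: "rho a (u + v) = rho a u + rho a v" "rho a (c *s v) = c *s rho a v"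
  unfolding rho_def by (simp_all add: grade_lin wedge_lin iota0_lin)

lemma rho_gamma: "rho a (gamma b *v v) = gamma b *v rho a v"
proof -
  let ?w = "grade v" and ?a = "axis {a} 1 :: ext" and ?b = "axis {b} 1 :: ext"
  have sub: "iota0 d (u - w) = iota0 d u - iota0 d w" for d u w
    by (simp add: iota0_def vec_eq_iff algebra_simps)
  have 1: "?a \<and>\<^sub>E (?b \<and>\<^sub>E ?w) = - (?b \<and>\<^sub>E (?a \<and>\<^sub>E ?w))"
  proof -
    have "?a \<and>\<^sub>E (?b \<and>\<^sub>E ?w) = (- (?b \<and>\<^sub>E ?a)) \<and>\<^sub>E ?w"
      by (metis wedge_assoc wedge_anticomm)
    also have "\<dots> = - (?b \<and>\<^sub>E (?a \<and>\<^sub>E ?w))"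
      using wedge_lin(3)[of "-1" "?b \<and>\<^sub>E ?a" ?w] by (simp only: wedge_assoc vector_sneg_minus1)
    finally show ?thesis .
  qed
  have e: "eta a b = eta b a" by (simp add: eta_def)
  have ab: "p - - q + (- r - (s - t)) = q + t - (s - p + r)" for p q r s t :: ext
    by simp
  have g: "grade (gamma b *v v) = iota0 b ?w - ?b \<and>\<^sub>E ?w"
    by (simp only: gamma_mv grade_lin grade_wedge grade_iota0 minus_diff_minus minus_diff_eq)
  have "rho a (gamma b *v v) = ?a \<and>\<^sub>E iota0 b ?w - ?a \<and>\<^sub>E (?b \<and>\<^sub>E ?w) +
      (iota0 a (iota0 b ?w) - (complex_of_real (eta a b) *s ?w - ?b \<and>\<^sub>E iota0 a ?w))"
    by (simp only: rho_def g wedge_diff sub iota0_gen)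
  also have "\<dots> = ?b \<and>\<^sub>E (?a \<and>\<^sub>E ?w) + ?b \<and>\<^sub>E iota0 a ?w -
      (complex_of_real (eta b a) *s ?w - ?a \<and>\<^sub>E iota0 b ?w + iota0 b (iota0 a ?w))"
    unfolding 1 iota0_anticomm[of a b] e by (rule ab)
  also have "\<dots> = gamma b *v rho a v"
    by (simp only: rho_def gamma_mv wedge_lin iota0_lin iota0_gen)
  finally show ?thesis .
qed

lemma gamma_axis: "a \<notin> I \<Longrightarrow> axis (insert a I) 1 = wsign {a} I *s (gamma a *v axis I 1)"
  using axis_insert[of a I] by (simp only: gamma_mv iota0_axis if_False diff_zero simp_thms)

lemma rho_axis:
  assumes "a \<notin> I"
  shows "axis (insert a I) 1 = (wsign {a} I * (-1) ^ card I) *s rho a (axis I 1)"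
proof -
  have "iota0 a (axis I 1) = 0" using assms by (simp add: iota0_axis)
  then have "rho a (axis I 1) = (-1) ^ card I *s (axis {a} 1 \<and>\<^sub>E axis I 1)"
    by (simp only: rho_def grade_axis wedge_lin iota0_lin vector_smult_rzero add_0_right)
  moreover have one: "(-1::complex) ^ card I * (-1) ^ card I = 1"
    by (simp flip: power_add mult_2)
  moreover have "(wsign {a} I * (-1) ^ card I) * (-1) ^ card I = wsign {a} I"
    using one by (simp only: mult.assoc mult_1_right)
  ultimately show ?thesis
    using axis_insert[OF assms] by (simp only: vector_smult_assoc)
qed

lemma Theta_exists: "\<exists>M. (\<forall>\<alpha>. M ** gamma \<alpha> = gamma \<alpha> ** M) \<and> M *v axis {} 1 = v"
proof -
  define C where "C f \<longleftrightarrow> (\<forall>u v. f (u + v) = f u + f v) \<and> (\<forall>c v. f (c *s v) = c *s f v) \<and>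
    (\<forall>a v. f (gamma a *v v) = gamma a *v f v)" for f :: "ext \<Rightarrow> ext"
  have smul: "C (\<lambda>v. c *s f v)" if f: "C f" for c f
    unfolding C_def
  proof (intro conjI allI)
    show "c *s f (u + v) = c *s f u + c *s f v" for u v
      using f by (simp only: C_def vector_add_ldistrib)
    show "c *s f (d *s v) = d *s (c *s f v)" for d v
      using f by (simp only: C_def vector_smult_assoc mult.commute)
    show "c *s f (gamma a *v v) = gamma a *v (c *s f v)" for a v
      using f by (simp only: C_def vector_scalar_commute)
  qed
  have plus: "C (\<lambda>v. f v + g v)" if f: "C f" and g: "C g" for f g
    unfolding C_def
  proof (intro conjI allI)
    show "f (u + v) + g (u + v) = f u + g u + (f v + g v)" for u v
      using f g by (simp add: C_def)
    show "f (d *s v) + g (d *s v) = d *s (f v + g v)" for d v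
      using f g by (simp only: C_def vector_add_ldistrib)
    show "f (gamma a *v v) + g (gamma a *v v) = gamma a *v (f v + g v)" for a v
      using f g by (simp only: C_def matrix_vector_right_distrib)
  qed
  have rho: "C (\<lambda>v. rho a (f v))" if f: "C f" for a f
    using f by (simp only: C_def rho_lin rho_gamma) simp
  have ax: "\<exists>f. C f \<and> f (axis {} 1) = axis I 1" for I
    using finite[of I]
  proof (induction I rule: finite_induct)
    case empty
    have "C (\<lambda>v. v)" by (simp add: C_def)
    then show ?case by blast
  next
    case (insert a I)
    then obtain f where f: "C f" "f (axis {} 1) = axis I 1" by blast
    show ?case
      by (rule exI, rule conjI, rule smul[OF rho[OF f(1), of a], of "wsign {a} I * (-1) ^ card I"])
         (simp only: f(2) rho_axis[OF insert(2), symmetric])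
  qed
  have "\<exists>f. C f \<and> f (axis {} 1) = v"
  proof (induction v rule: axis_ind)
    case (1 I)
    show ?case by (rule ax)
  next
    case (2 u v)
    then obtain f g where f: "C f" "f (axis {} 1) = u" and g: "C g" "g (axis {} 1) = v" by blast
    show ?case by (rule exI, rule conjI, rule plus[OF f(1) g(1)]) (simp only: f(2) g(2))
  next
    case (3 c v)
    then obtain f where f: "C f" "f (axis {} 1) = v" by blast
    show ?case by (rule exI, rule conjI, rule smul[OF f(1), of c]) (simp only: f(2))
  qed
  then obtain f where f: "C f" "f (axis {} 1) = v" by blast
  have "Vector_Spaces.linear (*s) (*s) f"
    unfolding Vector_Spaces.linear_iff using f(1) by (simp add: C_def vec.vector_space_axioms)
  then have m: "matrix f *v u = f u" for u
    by (rule matrix_works)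
  have "matrix f ** gamma a = gamma a ** matrix f" for a
    unfolding matrix_eq using f(1) by (simp only: C_def matrix_vector_mul_assoc[symmetric] m) simp
  then show ?thesis using f(2) m by metis
qed

lemma Theta_unique:
  assumes "\<forall>\<alpha>. M ** gamma \<alpha> = gamma \<alpha> ** M" "\<forall>\<alpha>. M' ** gamma \<alpha> = gamma \<alpha> ** M'"
    and "M *v axis {} 1 = M' *v axis {} 1"
  shows "M = M'"
proof (rule mv_eqI)
  fix I :: "4 set"
  show "M *v axis I 1 = M' *v axis I 1"
    using finite[of I]
  proof (induction I rule: finite_induct)
    case empty
    show ?case by (fact assms(3))
  next
    case (insert a I)
    have g: "N *v (gamma a *v axis I 1) = gamma a *v (N *v axis I 1)"
      if "\<forall>\<alpha>. N ** gamma \<alpha> = gamma \<alpha> ** N" for N :: ext_op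
      by (simp only: matrix_vector_mul_assoc that[rule_format])
    show ?case
      by (simp only: gamma_axis[OF insert(2)] vector_scalar_commute g[OF assms(1)] g[OF assms(2)]
          insert(3))
  qed
qed

lemma ex1_Theta: "\<exists>!M. is_Theta Is M"
proof -
  obtain M where "is_Theta Is M"
    unfolding is_Theta_def bas.simps(1) using Theta_exists by blast
  moreover have "N = M" if "is_Theta Is N" for N
    using that \<open>is_Theta Is M\<close> Theta_unique[of N M] unfolding is_Theta_def bas.simps(1) by metis
  ultimately show ?thesis by blast
qed

lemma is_Theta_Theta: "is_Theta Is (Theta Is)"
  unfolding Theta_def by (rule theI'[OF ex1_Theta])

section \<open>Normalization of \<open>epsilon\<close>, and the exponential\<close>

lemma epsilon_0123: "epsilon 0 1 2 3 = 1"
proof -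
  have "(\<lambda>_. 0 :: 4)(0 := 0, 1 := 1, 2 := 2, 3 := 3) = id"
    unfolding fun_eq_iff forall_4 by simp
  then show ?thesis by (simp add: epsilon_def permutes_id)
qed

lemma mexp_complex_structure:
  assumes "A ** A = - mat 1"
  shows "mexp (\<zeta> *\<^sub>R A) = cos \<zeta> *\<^sub>R mat 1 + sin \<zeta> *\<^sub>R A"
proof -
  have mult: "(c *\<^sub>R X) ** (d *\<^sub>R Y) = (c * d) *\<^sub>R (X ** Y)" for c d and X Y :: ext_op
    by (simp add: matrix_matrix_mult_def vec_eq_iff scaleR_sum_right mult_ac)
  have t: "inverse (fact n) *\<^sub>R (((**) (\<zeta> *\<^sub>R A)) ^^ n) (mat 1) =
      (cos_coeff n * \<zeta> ^ n) *\<^sub>R mat 1 + (sin_coeff n * \<zeta> ^ n) *\<^sub>R A" (is "_ *\<^sub>R ?P n = _") for n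
  proof (induction n)
    case 0
    show ?case by simp
  next
    case (Suc n)
    have "inverse (fact (Suc n)) *\<^sub>R ?P (Suc n) =
        ((\<zeta> / real (Suc n)) *\<^sub>R A) ** (inverse (fact n) *\<^sub>R ?P n)"
      using mult[of \<zeta> A 1 "?P n"] mult[of "\<zeta> / real (Suc n)" A "inverse (fact n)" "?P n"]
      by (simp add: field_simps)
    also have "\<dots> = (cos_coeff n * \<zeta> ^ Suc n / real (Suc n)) *\<^sub>R A +
        (- (sin_coeff n) * \<zeta> ^ Suc n / real (Suc n)) *\<^sub>R mat 1"
      unfolding Suc matrix_add_ldistrib mult using assms by (simp add: mult_ac)
    also have "\<dots> = (cos_coeff (Suc n) * \<zeta> ^ Suc n) *\<^sub>R mat 1 +
        (sin_coeff (Suc n) * \<zeta> ^ Suc n) *\<^sub>R A"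
      by (simp add: cos_coeff_Suc sin_coeff_Suc)
    finally show ?case .
  qed
  have "(\<lambda>n. (cos_coeff n * \<zeta> ^ n) *\<^sub>R (mat 1 :: ext_op)) sums (cos \<zeta> *\<^sub>R mat 1)"
    using cos_converges[of \<zeta>] by (intro sums_scaleR_left) simp
  moreover have "(\<lambda>n. (sin_coeff n * \<zeta> ^ n) *\<^sub>R A) sums (sin \<zeta> *\<^sub>R A)"
    using sin_converges[of \<zeta>] by (intro sums_scaleR_left) simp
  ultimately show ?thesis
    unfolding mexp_def t by (intro sums_unique[symmetric] sums_add)
qed

end

(*
The operators commuting with the gamma matrices form a second Clifford algebra, generated by
rho_0, ..., rho_3 with rho_a rho_b + rho_b rho_a = -2 eta_ab. Here Theta_ab = - rho_a rho_b for
a <> b and J = rho_0 rho_1 rho_2 rho_3 is central in the even part with J^2 = -1, so that J can be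
treated as the imaginary unit and the span of the Theta_ab becomes C^3, with commutator -2i times
the cross product and trace form 16 Re (u . v). Put w = e^(i zeta). Then F_a = w f_a(B) with f_a
linear, Omega_ab = w (d_a f_b - d_b f_a) - 2i w^2 f_a x f_b, and L_V splits into the parts carrying
w^2, w^3 and w^4.

L_K depends on B only through a linear term whose coefficient is the self-adjoint form on the right
of the field equation. The Euler-Lagrange equation is obtained from integration by parts and from
the fundamental lemma of the calculus of variations; the epsilon term of L_V is a divergence and
drops out because second partial derivatives commute.
*)

theory Submission
  imports Defs
begin

text \<open>The parts of L_V carrying w^2, w^3 and w^4 enter only through their real parts. The
  contraction belonging to w^2 is complex, and its imaginary part is the epsilon term; this is why
  both cos 2\<zeta> and sin 2\<zeta> occur. The contractions belonging to w^3 and w^4 are real, so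
  they leave cosines only. Every constant is 16, the trace of the identity, times a coefficient of
  such a contraction: 32 = 16 * 2, 256 = 16 * 16, 384 = 16 * 24. In the field equation 128 = 4 * 32,
  768 = 3 * 256 and 1536 = 4 * 384, and division by 128 cos 2\<zeta> leaves the factors 6 and 12.

  The analytic burden is that \<open>stationary\<close> asks for a genuine derivative of the action,
  for every smooth variation and every compact set containing its support. The Lagrangian at B + s h
  is a polynomial in s with coefficients continuous in x, which permits differentiation under the
  integral with an explicit remainder. The test functions must have all iterated partial
  derivatives, so bump functions are built together with their derivatives.\<close>

lemma four_eq_zero: "(4::4) = 0"
  by simp

text \<open>The library enumerates the type as 1, 2, 3, 4; since 4 is 0 here, the terms are
  reordered to match the components 0 to 3.\<close>

lemma sum4: "sum f (UNIV::4 set) = f 0 + f 1 + f 2 + f 3"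
  using sum_4[of f] four_eq_zero by (simp add: add_ac)

lemma all4: "(\<forall>i::4. P i) \<longleftrightarrow> P 0 \<and> P 1 \<and> P 2 \<and> P 3"
  using forall_4[of P] four_eq_zero by auto

lemma eta_sum: "(\<Sum>\<beta>\<in>UNIV. eta \<alpha> \<beta> *\<^sub>R f \<beta>) = eta \<alpha> \<alpha> *\<^sub>R f \<alpha>"
  for f :: "4 \<Rightarrow> 'a::real_vector"
proof -
  have "(\<Sum>\<beta>\<in>UNIV. eta \<alpha> \<beta> *\<^sub>R f \<beta>) = (\<Sum>\<beta>\<in>UNIV. if \<beta> = \<alpha> then eta \<alpha> \<alpha> *\<^sub>R f \<alpha> else 0)"
    by (rule sum.cong) (auto simp: eta_def)
  then show ?thesis by simp
qed

section \<open>Bilinearity of matrix products and of their action on vectors\<close>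

lemma matrix_minus_left: "(- M) ** N = - (M ** N)" for M N :: ext_op
  by (simp add: matrix_matrix_mult_def vec_eq_iff sum_negf)

lemma matrix_minus_right: "M ** (- N) = - (M ** N)" for M N :: ext_op
  by (simp add: matrix_matrix_mult_def vec_eq_iff sum_negf)

lemma matrix_add_left: "(M + M') ** N = M ** N + M' ** N" for M N :: ext_op
  by (simp add: matrix_matrix_mult_def vec_eq_iff distrib_right sum.distrib)

lemma scaleR_complex: "r *\<^sub>R z = complex_of_real r * z"
  by (rule scaleR_conv_of_real)

lemma scaleR_mat1_mv: "(r *\<^sub>R mat 1 :: ext_op) *v v = complex_of_real r *s v"
proof -
  have "(r *\<^sub>R mat 1 :: ext_op) *v v = r *\<^sub>R (mat 1 *v v)"
    unfolding matrix_vector_mult_def by (simp add: vec_eq_iff scaleR_sum_right)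
  then have "((r *\<^sub>R mat 1 :: ext_op) *v v) $ i = r *\<^sub>R (v $ i)" for i by simp
  then show ?thesis by (simp add: vec_eq_iff scaleR_complex)
qed

lemma matrix_minus_mv: "(- M) *v v = - (M *v v)" for M :: ext_op
  by (simp add: matrix_vector_mult_def vec_eq_iff sum_negf)

section \<open>The operators commuting with the gamma matrices\<close>

definition rho_op :: "4 \<Rightarrow> ext_op" where
  "rho_op a = matrix (rho a)"

lemma rho_op_mv: "rho_op a *v v = rho a v"
proof -
  have "Vector_Spaces.linear (*s) (*s) (rho a)"
    by (simp add: Vector_Spaces.linear_iff vec.vector_space_axioms rho_lin)
  from matrix_works[OF this] show ?thesis by (simp add: rho_op_def)
qed

lemma grade_grade: "grade (grade v) = v"
proof -
  have "(-1::complex) ^ k * (-1) ^ k = 1" for k by (simp flip: power_add mult_2)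
  then show ?thesis by (simp add: grade_def vec_eq_iff flip: mult.assoc)
qed

text \<open>The grading anticommutes with wedge and contraction and squares to one, so the composite
  is minus the product of the ungraded operators \<open>axis {a} 1\<close> wedge plus
  \<open>iota0 a\<close>. The contraction by a is already moved past the wedge with b, which makes
  everything but the metric term antisymmetric in a and b.\<close>

lemma rho_rho:
  "rho a (rho b v) = - (axis {a} 1 \<and>\<^sub>E (axis {b} 1 \<and>\<^sub>E v)) - axis {a} 1 \<and>\<^sub>E iota0 b v
     - (complex_of_real (eta a b) *s v - axis {b} 1 \<and>\<^sub>E iota0 a v) - iota0 a (iota0 b v)"
proof -
  have neg: "iota0 d (u - w) = iota0 d u - iota0 d w" "iota0 d (- u) = - iota0 d u" for d u w
    by (simp_all add: iota0_def vec_eq_iff algebra_simps)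
  have add: "grade (u + v) = grade u + grade v" for u v by (rule grade_lin)
  have "grade (rho b v) = - (axis {b} 1 \<and>\<^sub>E v) - iota0 b v"
    by (simp only: rho_def add grade_wedge grade_iota0 grade_grade) simp
  then show ?thesis
    unfolding rho_def[of a] by (simp only: neg wedge_diff wedge_neg iota0_gen) simp
qed

text \<open>In the sum of both orders the double wedges cancel, the double contractions cancel, and
  so do the mixed terms; the two metric terms remain.\<close>

lemma rho_op_anticomm: "rho_op a ** rho_op b = - (rho_op b ** rho_op a) - (2 * eta a b) *\<^sub>R mat 1"
proof -
  have "(rho_op a ** rho_op b) *v v = (- (rho_op b ** rho_op a) - (2 * eta a b) *\<^sub>R mat 1) *v v" for v
  proof -
    have e: "eta b a = eta a b" by (simp add: eta_def)
    have "axis {a} 1 \<and>\<^sub>E (axis {b} 1 \<and>\<^sub>E v) = (- (axis {b} 1 \<and>\<^sub>E axis {a} 1)) \<and>\<^sub>E v"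
      by (metis wedge_assoc wedge_anticomm)
    also have "\<dots> = - (axis {b} 1 \<and>\<^sub>E (axis {a} 1 \<and>\<^sub>E v))"
      using wedge_lin(3)[of "-1" "axis {b} 1 \<and>\<^sub>E axis {a} 1" v]
      by (simp only: wedge_assoc vector_sneg_minus1)
    finally have w: "axis {a} 1 \<and>\<^sub>E (axis {b} 1 \<and>\<^sub>E v) = - (axis {b} 1 \<and>\<^sub>E (axis {a} 1 \<and>\<^sub>E v))" .
    have "rho a (rho b v) = - rho b (rho a v) - complex_of_real (2 * eta a b) *s v"
      unfolding rho_rho w iota0_anticomm[of a b] e by (simp add: vec_eq_iff)
    then show ?thesis
      by (simp only: matrix_vector_mult_diff_rdistrib matrix_minus_mv matrix_vector_mul_assoc[symmetric] rho_op_mv scaleR_mat1_mv)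
  qed
  then show ?thesis by (simp add: matrix_eq)
qed

lemma rho_op_square: "rho_op a ** rho_op a = (- eta a a) *\<^sub>R mat 1"
proof -
  have *: "x = (- e) *\<^sub>R y" if "x = - x - (2 * e) *\<^sub>R y" for x y :: "'a::real_vector" and e
  proof -
    have "2 *\<^sub>R x = 2 *\<^sub>R ((- e) *\<^sub>R y)" using arg_cong[OF that, of "(+) x"] by (simp add: scaleR_2)
    then show ?thesis by (metis scaleR_cancel_left zero_neq_numeral)
  qed
  show ?thesis by (rule *[OF rho_op_anticomm])
qed

lemma rho_op_swap: "a \<noteq> b \<Longrightarrow> rho_op a ** rho_op b = - (rho_op b ** rho_op a)"
  using rho_op_anticomm[of a b] by (simp add: eta_def)

lemma rho_op_gamma: "rho_op a ** gamma b = gamma b ** rho_op a"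
  by (simp add: matrix_eq matrix_vector_mul_assoc[symmetric] rho_op_mv rho_gamma)

lemma rho_op_gamma_assoc: "rho_op a ** (gamma b ** X) = gamma b ** (rho_op a ** X)" for X :: ext_op
  by (simp add: matrix_mul_assoc rho_op_gamma)

text \<open>The metric is diagonal, so contraction by an index absent from the list gives zero. Only
  the wedge is left, with the sign of the grading.\<close>

lemma rho_bas:
  assumes "a \<notin> set Is"
  shows "rho a (bas Is) = (-1) ^ length Is *s bas (a # Is)"
proof -
  have "iota0 a (bas Is) = 0"
    using assms
  proof (induction Is)
    case Nil
    then show ?case by (simp add: iota0_axis)
  next
    case (Cons b Is)
    then show ?case by (simp add: iota0_gen eta_def)
  qed
  moreover have "grade (bas Is) = (-1) ^ length Is *s bas Is"
    by (induction Is) (simp_all add: grade_axis grade_wedge wedge_lin)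
  ultimately show ?thesis
    by (simp add: rho_def wedge_lin iota0_lin)
qed

text \<open>Turns the definite description behind \<open>Theta\<close> into a test that explicit
  products of the \<open>rho_op\<close> can pass.\<close>

lemma Theta_eqI:
  assumes "\<And>a. M ** gamma a = gamma a ** M" "M *v bas [] = bas Is"
  shows "Theta Is = M"
  using assms ex1_Theta[of Is] is_Theta_Theta[of Is] unfolding is_Theta_def by blast

lemma Theta_diag: "Theta [a, a] = 0"
  by (rule Theta_eqI) (simp_all add: wedge_axis matrix_matrix_mult_def vec_eq_iff)

text \<open>The minus sign is the grading: \<open>rho b\<close> acts on degree 0 without a sign,
  then \<open>rho a\<close> acts on degree 1 with one.\<close>

lemma Theta_pair:
  assumes "a \<noteq> b"
  shows "Theta [a, b] = - (rho_op a ** rho_op b)"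
proof (rule Theta_eqI)
  show "- (rho_op a ** rho_op b) ** gamma c = gamma c ** - (rho_op a ** rho_op b)" for c
    by (simp add: matrix_minus_left matrix_minus_right rho_op_gamma rho_op_gamma_assoc
        matrix_mul_assoc[symmetric])
  show "- (rho_op a ** rho_op b) *v bas [] = bas [a, b]"
    using rho_bas[of b "[]"] rho_bas[of a "[b]"] assms
    by (simp add: matrix_minus_mv matrix_vector_mul_assoc[symmetric] rho_op_mv)
qed

text \<open>The gradings met on degrees 0, 1, 2, 3 contribute 1, -1, 1, -1, so no overall sign
  appears.\<close>

lemma JJ_Rh: "JJ = rho_op 0 ** (rho_op 1 ** (rho_op 2 ** rho_op 3))"
  unfolding JJ_def
proof (rule Theta_eqI)
  show "(rho_op 0 ** (rho_op 1 ** (rho_op 2 ** rho_op 3))) ** gamma c = gamma c ** (rho_op 0 ** (rho_op 1 ** (rho_op 2 ** rho_op 3)))" for c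
    by (simp add: rho_op_gamma rho_op_gamma_assoc matrix_mul_assoc[symmetric])
  have neg: "rho a (- v) = - rho a v" for a v using rho_lin(2)[of a "-1" v] by (simp add: vec_eq_iff)
  show "(rho_op 0 ** (rho_op 1 ** (rho_op 2 ** rho_op 3))) *v bas [] = bas [0, 1, 2, 3]"
    using rho_bas[of 3 "[]"] rho_bas[of 2 "[3]"] rho_bas[of 1 "[2,3]"] rho_bas[of 0 "[1,2,3]"]
    by (simp del: bas.simps(2) bas_single add: matrix_vector_mul_assoc[symmetric] rho_op_mv neg)
qed

text \<open>Rewriting with these rules brings every product of the \<open>rho_op a\<close> into a normal form.\<close>

lemma rho_op_sort:
  "rho_op 0 ** rho_op 0 = - mat 1" "rho_op 1 ** rho_op 1 = mat 1" "rho_op 2 ** rho_op 2 = mat 1" "rho_op 3 ** rho_op 3 = mat 1"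
  "rho_op 1 ** rho_op 0 = - (rho_op 0 ** rho_op 1)" "rho_op 2 ** rho_op 0 = - (rho_op 0 ** rho_op 2)"
  "rho_op 3 ** rho_op 0 = - (rho_op 0 ** rho_op 3)" "rho_op 2 ** rho_op 1 = - (rho_op 1 ** rho_op 2)"
  "rho_op 3 ** rho_op 1 = - (rho_op 1 ** rho_op 3)" "rho_op 3 ** rho_op 2 = - (rho_op 2 ** rho_op 3)"
  using rho_op_square[of 0] rho_op_square[of 1] rho_op_square[of 2] rho_op_square[of 3]
  by (simp_all add: eta_def) (rule rho_op_swap, simp)+

lemma rho_op_sort_assoc:
  "rho_op 0 ** (rho_op 0 ** X) = - X" "rho_op 1 ** (rho_op 1 ** X) = X" "rho_op 2 ** (rho_op 2 ** X) = X" "rho_op 3 ** (rho_op 3 ** X) = X"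
  "rho_op 1 ** (rho_op 0 ** X) = - (rho_op 0 ** (rho_op 1 ** X))" "rho_op 2 ** (rho_op 0 ** X) = - (rho_op 0 ** (rho_op 2 ** X))"
  "rho_op 3 ** (rho_op 0 ** X) = - (rho_op 0 ** (rho_op 3 ** X))" "rho_op 2 ** (rho_op 1 ** X) = - (rho_op 1 ** (rho_op 2 ** X))"
  "rho_op 3 ** (rho_op 1 ** X) = - (rho_op 1 ** (rho_op 3 ** X))" "rho_op 3 ** (rho_op 2 ** X) = - (rho_op 2 ** (rho_op 3 ** X))"
  for X :: ext_op
  by (simp_all add: matrix_mul_assoc rho_op_sort matrix_minus_left)

lemmas rho_op_norm = rho_op_sort rho_op_sort_assoc matrix_minus_left matrix_minus_right
  matrix_mul_assoc[symmetric] matrix_mul_lid matrix_mul_rid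

lemma JJ_square: "JJ ** JJ = - mat 1"
  by (simp add: JJ_Rh rho_op_norm)

section \<open>Complex scalars acting through \<open>JJ\<close>\<close>

text \<open>This differs from scaling the complex entries of a matrix: here the imaginary unit acts
  as left multiplication by \<open>JJ\<close>.\<close>

definition cscale :: "complex \<Rightarrow> ext_op \<Rightarrow> ext_op" where
  "cscale z X = Re z *\<^sub>R X + Im z *\<^sub>R (JJ ** X)"

text \<open>\<open>Sg k\<close> is \<open>Theta [0, k]\<close> for spatial k. The three operators
  behave like Pauli matrices of reversed orientation: each squares to one, and the product of the
  first two is -i times the third. The spatial \<open>Theta [j, k]\<close> are multiples of them by
  i or -i in the sense of \<open>cscale\<close>.\<close>

definition Sg :: "3 \<Rightarrow> ext_op" where
  "Sg k = - (rho_op 0 ** rho_op (if k = 1 then 1 else if k = 2 then 2 else 3))"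

lemma cscale_add: "cscale (z + w) X = cscale z X + cscale w X" "cscale z (X + Y) = cscale z X + cscale z Y"
  by (simp_all add: cscale_def algebra_simps matrix_add_ldistrib)

lemma cscale_scaleR: "cscale (r *\<^sub>R z) X = r *\<^sub>R cscale z X" "cscale z (r *\<^sub>R X) = r *\<^sub>R cscale z X"
  by (simp_all add: cscale_def algebra_simps matrix_scalar_ac scalar_matrix_assoc[symmetric])

lemma JJ_JJ: "JJ ** (JJ ** X) = - X" for X :: ext_op
  by (simp add: matrix_mul_assoc JJ_square matrix_minus_left)

lemma cscale_jc: "cscale z (cscale w X) = cscale (z * w) X"
  by (simp add: cscale_def algebra_simps matrix_add_ldistrib matrix_scalar_ac scalar_matrix_assoc[symmetric] JJ_JJ
      matrix_minus_right)

lemma cscale_simps [simp]: "cscale 1 X = X" "cscale 0 X = 0" "cscale z 0 = 0"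
  by (simp_all add: cscale_def matrix_matrix_mult_def vec_eq_iff)

lemma cscale_mult_left: "cscale z X ** Y = cscale z (X ** Y)"
  by (simp add: cscale_def matrix_add_left scalar_matrix_assoc matrix_mul_assoc)

text \<open>A single \<open>rho_op a\<close> anticommutes with \<open>JJ\<close>, so these scalars
  cannot be pulled past an arbitrary left factor; hence the hypothesis.\<close>

lemma cscale_mult_right:
  assumes "X ** JJ = JJ ** X"
  shows "X ** cscale z Y = cscale z (X ** Y)"
  using assms by (simp add: cscale_def matrix_add_ldistrib matrix_scalar_ac scalar_matrix_assoc[symmetric] matrix_mul_assoc)

lemma Sg_JJ: "Sg k ** JJ = JJ ** Sg k"
  by (simp add: Sg_def JJ_Rh rho_op_norm)

lemma Sg_mult:
  "Sg k ** Sg k = mat 1"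
  "Sg 1 ** Sg 2 = cscale (-\<i>) (Sg 3)" "Sg 2 ** Sg 1 = cscale \<i> (Sg 3)"
  "Sg 2 ** Sg 3 = cscale (-\<i>) (Sg 1)" "Sg 3 ** Sg 2 = cscale \<i> (Sg 1)"
  "Sg 3 ** Sg 1 = cscale (-\<i>) (Sg 2)" "Sg 1 ** Sg 3 = cscale \<i> (Sg 2)"
  by (simp_all add: Sg_def cscale_def JJ_Rh rho_op_norm)

text \<open>By \<open>Sg_mult\<close>, the even elements form a copy of the complexified quaternions in which \<open>JJ\<close>
  is the imaginary unit; \<open>phi\<close> parametrizes the span of the \<open>Theta [\<alpha>, \<beta>]\<close>.\<close>

definition phi :: "complex^3 \<Rightarrow> ext_op" where
  "phi u = cscale (u $ 1) (Sg 1) + cscale (u $ 2) (Sg 2) + cscale (u $ 3) (Sg 3)"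

definition ccross :: "complex^3 \<Rightarrow> complex^3 \<Rightarrow> complex^3" where
  "ccross u v = vector [u$2 * v$3 - u$3 * v$2, u$3 * v$1 - u$1 * v$3, u$1 * v$2 - u$2 * v$1]"

definition cdot :: "complex^3 \<Rightarrow> complex^3 \<Rightarrow> complex" where
  "cdot u v = u$1 * v$1 + u$2 * v$2 + u$3 * v$3"

lemma phi_lin: "phi (u + v) = phi u + phi v" "phi (u - v) = phi u - phi v" "phi (r *\<^sub>R u) = r *\<^sub>R phi u"
  "phi (- u) = - phi u"
  by (simp_all add: phi_def cscale_add cscale_scaleR algebra_simps cscale_def)

lemma cscale_phi: "cscale z (phi u) = phi (z *s u)"
  by (simp add: phi_def cscale_add cscale_jc)

text \<open>The Pauli identity: equal indices produce the bilinear product, distinct ones the cross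
  product.\<close>

lemma phi_mult: "phi u ** phi v = cscale (cdot u v) (mat 1) + phi (- \<i> *s ccross u v)"
proof -
  have 1: "cscale (a) (Sg k) ** cscale b (Sg l) = cscale (a * b) (Sg k ** Sg l)" for a b k l
    by (simp add: cscale_mult_left cscale_mult_right[OF Sg_JJ] cscale_jc)
  show ?thesis
    by (simp only: phi_def[of u] phi_def[of v] matrix_add_ldistrib matrix_add_left 1 Sg_mult cscale_jc)
       (simp add: phi_def cdot_def ccross_def vector_3 cscale_def algebra_simps)
qed

lemma phi_commutator: "phi u ** phi v - phi v ** phi u = phi ((- 2 * \<i>) *s ccross u v)"
proof -
  have "cdot v u = cdot u v" "ccross v u = - ccross u v"
    by (simp_all add: cdot_def ccross_def vec_eq_iff forall_3 vector_3)
  then show ?thesis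
    by (simp add: phi_mult phi_lin[symmetric])
       (rule arg_cong[of _ _ phi], simp add: vec_eq_iff algebra_simps)
qed

section \<open>Traces of the even operators\<close>

lemma trace_lin: "trace (M + N) = trace M + trace N" "trace (r *\<^sub>R M) = r *\<^sub>R trace M"
  "trace (- M) = - trace M" "trace (\<Sum>i\<in>A. f i) = (\<Sum>i\<in>A. trace (f i))" for M N :: ext_op
  by (simp_all add: trace_def sum.distrib scaleR_sum_right sum_negf sum.swap[of _ A])

text \<open>Cyclicity makes the trace equal to its own negative.\<close>

lemma trace_anticomm:
  fixes M N :: ext_op
  assumes "M ** N = - (N ** M)"
  shows "trace (M ** N) = 0"
  using trace_mul_sym[of M N] assms trace_lin(3)[of "N ** M"] by simp

lemma trace_JJ: "trace JJ = 0"
  unfolding JJ_Rh by (rule trace_anticomm) (simp add: rho_op_norm)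

lemma trace_Sg: "trace (Sg k) = 0"
  unfolding Sg_def trace_lin by (simp add: trace_anticomm rho_op_norm)

text \<open>In normal form the product is, up to sign, two distinct spatial \<open>rho_op\<close>,
  which anticommute.\<close>

lemma trace_JJ_Sg: "trace (JJ ** Sg k) = 0"
proof -
  consider "k = 1" | "k = 2" | "k = 3" using exhaust_3 by blast
  then show ?thesis
    by cases (simp_all add: JJ_Rh Sg_def rho_op_norm trace_lin trace_anticomm)
qed

lemma trace_phi: "trace (phi u) = 0"
  by (simp add: phi_def cscale_def trace_lin trace_Sg trace_JJ_Sg)

lemma trace_mat1: "trace (mat 1 :: ext_op) = 16"
  by (simp add: trace_def mat_def card_Pow)

text \<open>The \<open>phi\<close> part of the product and \<open>JJ\<close> are traceless, so of
  the scalar part only the real component survives, with weight 16, the dimension of the exterior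
  algebra.\<close>

lemma trace_phi_mult: "trace (phi u ** phi v) = complex_of_real (16 * Re (cdot u v))"
  by (simp add: phi_mult trace_lin trace_phi cscale_def trace_mat1 trace_JJ scaleR_complex)

lemma mexp_jc: "mexp (\<zeta> *\<^sub>R JJ) = cscale (cis \<zeta>) (mat 1)"
  by (simp add: mexp_complex_structure[OF JJ_square] cscale_def)

section \<open>Partial derivatives\<close>

text \<open>\<open>pd\<close> is total, and its value is a derivative only where the restriction to
  the coordinate line is differentiable; Frechet differentiability guarantees that.\<close>

lemma has_vector_derivative_pd:
  assumes "f differentiable at x"
  shows "((\<lambda>t. f (x + t *\<^sub>R axis \<alpha> 1)) has_vector_derivative pd \<alpha> f x) (at 0)"
proof -
  have "(f has_derivative frechet_derivative f (at x)) (at (x + 0 *\<^sub>R axis \<alpha> 1))"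
    using assms by (simp add: frechet_derivative_works)
  then have "((\<lambda>t. f (x + t *\<^sub>R axis \<alpha> 1)) has_derivative
      (\<lambda>t. frechet_derivative f (at x) (t *\<^sub>R axis \<alpha> 1))) (at 0)"
    by (rule has_derivative_compose[rotated]) (auto intro!: derivative_eq_intros)
  then have "(\<lambda>t. f (x + t *\<^sub>R axis \<alpha> 1)) differentiable at 0"
    unfolding differentiable_def by blast
  then show ?thesis
    unfolding pd_def by (simp add: vector_derivative_works)
qed

lemma pd_eqI: "((\<lambda>t. f (x + t *\<^sub>R axis \<alpha> 1)) has_vector_derivative d) (at 0) \<Longrightarrow> pd \<alpha> f x = d"
  unfolding pd_def by (rule vector_derivative_at)

lemma pd_linear:
  assumes "bounded_linear T" "f differentiable at x"
  shows "pd \<alpha> (\<lambda>y. T (f y)) x = T (pd \<alpha> f x)"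
  by (rule pd_eqI bounded_linear.has_vector_derivative has_vector_derivative_pd assms)+

lemma pd_component: "f differentiable at x \<Longrightarrow> pd \<alpha> (\<lambda>y. f y $ i) x = pd \<alpha> f x $ i"
  by (rule pd_linear[OF bounded_linear_vec_nth])

section \<open>The gauge field and its curvature\<close>

text \<open>Coordinates of the sum of b^\<beta> \<open>Theta [\<alpha>, \<beta>]\<close> with
  respect to \<open>Sg\<close>. A real entry comes from a pair containing the index 0, an imaginary
  one from a spatial pair.\<close>

definition fvec :: "4 \<Rightarrow> real^4 \<Rightarrow> complex^3" where
  "fvec \<alpha> b =
     (if \<alpha> = 0 then vector [of_real (b$1), of_real (b$2), of_real (b$3)]
      else if \<alpha> = 1 then vector [- of_real (b$0), - \<i> * of_real (b$3), \<i> * of_real (b$2)]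
      else if \<alpha> = 2 then vector [\<i> * of_real (b$3), - of_real (b$0), - \<i> * of_real (b$1)]
      else vector [- \<i> * of_real (b$2), \<i> * of_real (b$1), - of_real (b$0)])"

lemma fvec_lin: "fvec \<alpha> (b + c) = fvec \<alpha> b + fvec \<alpha> c" "fvec \<alpha> (r *\<^sub>R b) = r *\<^sub>R fvec \<alpha> b"
  by (auto simp: fvec_def vec_eq_iff forall_3 vector_3 algebra_simps scaleR_complex)

lemma Theta_fvec: "(\<Sum>\<beta>\<in>UNIV. (b $ \<beta>) *\<^sub>R Theta [\<alpha>, \<beta>]) = phi (fvec \<alpha> b)"
proof -
  have "\<forall>\<alpha>. (\<Sum>\<beta>\<in>UNIV. (b $ \<beta>) *\<^sub>R Theta [\<alpha>, \<beta>]) = phi (fvec \<alpha> b)"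
    unfolding all4 sum4
    by (simp add: Theta_diag Theta_pair phi_def fvec_def vector_3 cscale_def Sg_def JJ_Rh rho_op_norm)
  then show ?thesis by blast
qed

definition gpot :: "real \<Rightarrow> 4 \<Rightarrow> real^4 \<Rightarrow> ext_op" where
  "gpot \<zeta> \<alpha> b = phi (cis \<zeta> *s fvec \<alpha> b)"

lemma F_gpot: "F \<zeta> B \<alpha> x = gpot \<zeta> \<alpha> (B x)"
proof -
  have "F \<zeta> B \<alpha> x = cscale (cis \<zeta>) (\<Sum>\<beta>\<in>UNIV. (B x $ \<beta>) *\<^sub>R Theta [\<alpha>, \<beta>])"
    unfolding F_def sum4 mexp_jc by (simp add: cscale_mult_left cscale_add cscale_scaleR)
  then show ?thesis by (simp add: Theta_fvec cscale_phi gpot_def)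
qed

lemma linear_gpot: "linear (gpot \<zeta> \<alpha>)"
proof (rule linearI)
  show "gpot \<zeta> \<alpha> (b + c) = gpot \<zeta> \<alpha> b + gpot \<zeta> \<alpha> c" for b c
    by (simp add: gpot_def fvec_lin phi_lin[symmetric] vector_add_ldistrib)
  show "gpot \<zeta> \<alpha> (r *\<^sub>R b) = r *\<^sub>R gpot \<zeta> \<alpha> b" for r b
    unfolding gpot_def fvec_lin phi_lin[symmetric]
    by (rule arg_cong[of _ _ phi]) (simp add: vec_eq_iff)
qed

definition et :: "4 \<Rightarrow> real" where
  "et \<alpha> = eta \<alpha> \<alpha>"

lemma et_simps: "et 0 = 1" "et 1 = -1" "et 2 = -1" "et 3 = -1"
  by (simp_all add: et_def eta_def)

lemma Omega_phi:
  assumes "B differentiable at x"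
  shows "Omega (F \<zeta> B) \<alpha> \<beta> x =
    phi (cis \<zeta> *s (fvec \<beta> (pd \<alpha> B x) - fvec \<alpha> (pd \<beta> B x)) +
      (- 2 * \<i> * cis \<zeta> ^ 2) *s ccross (fvec \<alpha> (B x)) (fvec \<beta> (B x)))"
proof -
  have F: "F \<zeta> B \<alpha> = (\<lambda>y. gpot \<zeta> \<alpha> (B y))" for \<alpha> by (simp add: F_gpot fun_eq_iff)
  have "pd \<alpha> (F \<zeta> B \<beta>) x = gpot \<zeta> \<beta> (pd \<alpha> B x)" for \<alpha> \<beta>
    unfolding F by (rule pd_linear[OF _ assms]) (simp add: linear_linear linear_gpot)
  then have "Omega (F \<zeta> B) \<alpha> \<beta> x =
      gpot \<zeta> \<beta> (pd \<alpha> B x) - gpot \<zeta> \<alpha> (pd \<beta> B x) +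
      (gpot \<zeta> \<alpha> (B x) ** gpot \<zeta> \<beta> (B x) - gpot \<zeta> \<beta> (B x) ** gpot \<zeta> \<alpha> (B x))"
    by (simp add: Omega_def F_gpot)
  also have "\<dots> = phi (cis \<zeta> *s (fvec \<beta> (pd \<alpha> B x) - fvec \<alpha> (pd \<beta> B x)) +
      (- 2 * \<i> * cis \<zeta> ^ 2) *s ccross (fvec \<alpha> (B x)) (fvec \<beta> (B x)))"
    unfolding gpot_def phi_commutator phi_lin[symmetric]
    by (rule arg_cong[of _ _ phi])
       (simp add: vec_eq_iff forall_3 ccross_def vector_3 algebra_simps power2_eq_square)
  finally show ?thesis .
qed

text \<open>The trace is already real, so adding the complex conjugate cancels the factor 1/2;
  raising the two indices costs one sign each.\<close>

lemma L_V_cdot: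
  assumes "\<And>\<alpha> \<beta>. Omega \<theta> \<alpha> \<beta> x = phi (u \<alpha> \<beta>)"
  shows "L_V \<theta> x =
    complex_of_real (16 * (\<Sum>\<alpha>\<in>UNIV. \<Sum>\<beta>\<in>UNIV. et \<alpha> * et \<beta> * Re (cdot (u \<alpha> \<beta>) (u \<alpha> \<beta>))))"
proof -
  have "Omega_up \<theta> \<alpha> \<beta> x = (et \<alpha> * et \<beta>) *\<^sub>R phi (u \<alpha> \<beta>)" for \<alpha> \<beta>
  proof -
    have "Omega_up \<theta> \<alpha> \<beta> x = (\<Sum>\<rho>\<in>UNIV. eta \<alpha> \<rho> *\<^sub>R (\<Sum>\<sigma>\<in>UNIV. eta \<beta> \<sigma> *\<^sub>R Omega \<theta> \<rho> \<sigma> x))"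
      by (simp only: Omega_up_def scaleR_sum_right scaleR_scaleR)
    also have "\<dots> = eta \<alpha> \<alpha> *\<^sub>R (eta \<beta> \<beta> *\<^sub>R Omega \<theta> \<alpha> \<beta> x)"
      by (simp only: eta_sum)
    finally show ?thesis by (simp only: assms et_def scaleR_scaleR)
  qed
  then have t: "trace (Omega \<theta> \<alpha> \<beta> x ** Omega_up \<theta> \<alpha> \<beta> x) =
      complex_of_real (16 * (et \<alpha> * et \<beta> * Re (cdot (u \<alpha> \<beta>) (u \<alpha> \<beta>))))" for \<alpha> \<beta>
    by (simp add: assms matrix_scalar_ac scalar_matrix_assoc[symmetric] trace_lin(2) trace_phi_mult
        scaleR_complex)
  show ?thesis
    unfolding L_V_def trace_lin(4) t plus_cc_def
    by (simp add: sum_distrib_left mult.assoc)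
qed

text \<open>Half of \<open>epsilon\<^sub>\<alpha>\<^sub>\<beta>\<^sub>\<rho>\<^sub>\<sigma> d\<^sup>\<alpha>\<^sup>\<beta> d\<^sup>\<rho>\<^sup>\<sigma>\<close>, the Pfaffian of the antisymmetrization of \<open>d\<close>.\<close>

definition ephat :: "(4 \<Rightarrow> 4 \<Rightarrow> real) \<Rightarrow> real" where
  "ephat d = (let f = (\<lambda>a b. et a * d a b - et b * d b a) in
     f 0 1 * f 2 3 - f 0 2 * f 1 3 + f 0 3 * f 1 2)"

text \<open>The density as a polynomial in independent variables: b stands for the components of the
  field and d \<alpha> \<beta> for the derivative along \<alpha> of component \<beta>. The
  coefficient 64 is twice 32 because \<open>ephat\<close> is half of the epsilon
  contraction.\<close>

definition lagV :: "real \<Rightarrow> (4 \<Rightarrow> real) \<Rightarrow> (4 \<Rightarrow> 4 \<Rightarrow> real) \<Rightarrow> real" where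
  "lagV \<zeta> b d =
     - 384 * (\<Sum>\<alpha>\<in>UNIV. et \<alpha> * b \<alpha> * b \<alpha>)\<^sup>2 * cos (4 * \<zeta>)
     - 256 * ((\<Sum>\<alpha>\<in>UNIV. et \<alpha> * b \<alpha> * b \<alpha>) * (\<Sum>\<beta>\<in>UNIV. d \<beta> \<beta>)
         - (\<Sum>\<alpha>\<in>UNIV. \<Sum>\<beta>\<in>UNIV. b \<alpha> * (et \<beta> * b \<beta>) * d \<alpha> \<beta>)) * cos (3 * \<zeta>)
     - 32 * (2 * (\<Sum>\<alpha>\<in>UNIV. \<Sum>\<beta>\<in>UNIV. et \<alpha> * et \<beta> * d \<alpha> \<beta> * d \<alpha> \<beta>)
         + (\<Sum>\<alpha>\<in>UNIV. d \<alpha> \<alpha>)\<^sup>2) * cos (2 * \<zeta>)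
     - 64 * ephat d * sin (2 * \<zeta>)"

lemma L_V_lagV:
  assumes "B differentiable at x"
  shows "L_V (F \<zeta> B) x = complex_of_real (lagV \<zeta> (\<lambda>\<beta>. B x $ \<beta>) (\<lambda>\<alpha> \<beta>. pd \<alpha> B x $ \<beta>))"
proof -
  define b where "b = (\<lambda>\<beta>. B x $ \<beta>)"
  define d where "d = (\<lambda>\<alpha> \<beta>. pd \<alpha> B x $ \<beta>)"
  define w where "w = cis \<zeta>"
  define p where "p = (\<lambda>\<alpha> \<beta>. fvec \<beta> (pd \<alpha> B x) - fvec \<alpha> (pd \<beta> B x))"
  define q where "q = (\<lambda>\<alpha> \<beta>. ccross (fvec \<alpha> (B x)) (fvec \<beta> (B x)))"
  have w: "Re (w ^ n * (of_real r + \<i> * of_real t)) = r * cos (real n * \<zeta>) - t * sin (real n * \<zeta>)" for n r t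
    unfolding w_def Complex.DeMoivre by (simp add: mult.commute)
  have dot: "cdot (w *s y + (- 2 * \<i> * w ^ 2) *s z) (w *s y + (- 2 * \<i> * w ^ 2) *s z) =
      w ^ 2 * cdot y y + w ^ 3 * (- 4 * \<i> * cdot y z) + w ^ 4 * (- 4 * cdot z z)" for y z
    by (simp add: cdot_def algebra_simps power2_eq_square power3_eq_cube power4_eq_xxxx)
  let ?S = "\<lambda>f. \<Sum>\<alpha>\<in>UNIV. \<Sum>\<beta>\<in>UNIV. complex_of_real (et \<alpha> * et \<beta>) * f \<alpha> \<beta> :: complex"
  have ReS: "Re (?S g) = (\<Sum>\<alpha>\<in>UNIV. \<Sum>\<beta>\<in>UNIV. et \<alpha> * et \<beta> * Re (g \<alpha> \<beta>))" for g
    by simp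
  \<comment> \<open>The only contraction with an imaginary part. The factor 16 turns -2 into the
    coefficient -32 of cos 2\<zeta> and 4 into the coefficient -64 of sin 2\<zeta>.\<close>
  have P: "?S (\<lambda>\<alpha> \<beta>. cdot (p \<alpha> \<beta>) (p \<alpha> \<beta>)) = of_real
      (- 2 * (2 * (\<Sum>\<alpha>\<in>UNIV. \<Sum>\<beta>\<in>UNIV. et \<alpha> * et \<beta> * d \<alpha> \<beta> * d \<alpha> \<beta>) + (\<Sum>\<alpha>\<in>UNIV. d \<alpha> \<alpha>)\<^sup>2))
      + \<i> * of_real (4 * ephat d)"
    unfolding complex_eq_iff p_def
    by (simp add: sum4 et_simps cdot_def fvec_def vector_3 ephat_def fun_cong[OF fun_cong[OF d_def]] Let_def) 
       (simp add: algebra_simps power2_eq_square)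
  \<comment> \<open>The prefactors -4i here and -4 in \<open>R\<close> come from \<open>dot\<close>.
    Both contractions are real, so w^3 and w^4 contribute no sine.\<close>
  have Q: "?S (\<lambda>\<alpha> \<beta>. - 4 * \<i> * cdot (p \<alpha> \<beta>) (q \<alpha> \<beta>)) = of_real (- 16 *
      ((\<Sum>\<alpha>\<in>UNIV. et \<alpha> * b \<alpha> * b \<alpha>) * (\<Sum>\<beta>\<in>UNIV. d \<beta> \<beta>)
         - (\<Sum>\<alpha>\<in>UNIV. \<Sum>\<beta>\<in>UNIV. b \<alpha> * (et \<beta> * b \<beta>) * d \<alpha> \<beta>))) + \<i> * of_real 0"
    unfolding complex_eq_iff p_def q_def
    by (simp add: sum4 et_simps cdot_def fvec_def vector_3 ccross_def b_def d_def) 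
       (simp add: algebra_simps power2_eq_square)
  have R: "?S (\<lambda>\<alpha> \<beta>. - 4 * cdot (q \<alpha> \<beta>) (q \<alpha> \<beta>)) = of_real (- 24 *
      (\<Sum>\<alpha>\<in>UNIV. et \<alpha> * b \<alpha> * b \<alpha>)\<^sup>2) + \<i> * of_real 0"
    unfolding complex_eq_iff q_def
    by (simp add: sum4 et_simps cdot_def fvec_def vector_3 ccross_def b_def) 
       (simp add: algebra_simps power2_eq_square)
  have "L_V (F \<zeta> B) x = complex_of_real (16 * Re (?S (\<lambda>\<alpha> \<beta>.
      w ^ 2 * cdot (p \<alpha> \<beta>) (p \<alpha> \<beta>) + w ^ 3 * (- 4 * \<i> * cdot (p \<alpha> \<beta>) (q \<alpha> \<beta>)) +
      w ^ 4 * (- 4 * cdot (q \<alpha> \<beta>) (q \<alpha> \<beta>)))))"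
    unfolding L_V_cdot[OF Omega_phi[OF assms]] w_def[symmetric] dot ReS
    by (simp only: p_def q_def)
  also have "?S (\<lambda>\<alpha> \<beta>.
      w ^ 2 * cdot (p \<alpha> \<beta>) (p \<alpha> \<beta>) + w ^ 3 * (- 4 * \<i> * cdot (p \<alpha> \<beta>) (q \<alpha> \<beta>)) +
      w ^ 4 * (- 4 * cdot (q \<alpha> \<beta>) (q \<alpha> \<beta>))) =
      w ^ 2 * ?S (\<lambda>\<alpha> \<beta>. cdot (p \<alpha> \<beta>) (p \<alpha> \<beta>)) + w ^ 3 * ?S (\<lambda>\<alpha> \<beta>. - 4 * \<i> * cdot (p \<alpha> \<beta>) (q \<alpha> \<beta>)) +
      w ^ 4 * ?S (\<lambda>\<alpha> \<beta>. - 4 * cdot (q \<alpha> \<beta>) (q \<alpha> \<beta>))"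
    by (simp only: sum_distrib_left distrib_left sum.distrib mult.left_commute)
  finally show ?thesis
    unfolding P Q R plus_complex.sel w lagV_def b_def[symmetric] d_def[symmetric]
    by (simp add: algebra_simps)
qed

section \<open>The Levi-Civita symbol\<close>

text \<open>Exchanging neighbouring arguments composes the index map with a transposition, which
  reverses the sign of a permutation and keeps a non-permutation a non-permutation.\<close>

lemma epsilon_swap:
  "epsilon \<beta> \<alpha> \<rho> \<sigma> = - epsilon \<alpha> \<beta> \<rho> \<sigma>" "epsilon \<alpha> \<rho> \<beta> \<sigma> = - epsilon \<alpha> \<beta> \<rho> \<sigma>"
  "epsilon \<alpha> \<beta> \<sigma> \<rho> = - epsilon \<alpha> \<beta> \<rho> \<sigma>"
proof -
  let ?e = "\<lambda>p :: 4 \<Rightarrow> 4. if p permutes UNIV then of_int (sign p) else 0 :: real"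
  have *: "?e (p \<circ> Transposition.transpose i j) = - ?e p" if "i \<noteq> j" for p i j
  proof -
    have t: "Transposition.transpose i j permutes UNIV" by (rule permutes_swap_id) auto
    have "p permutes UNIV" if "(p \<circ> Transposition.transpose i j) permutes UNIV"
      using permutes_compose[OF t that] by (simp add: o_assoc[symmetric])
    moreover have "(p \<circ> Transposition.transpose i j) permutes UNIV" if "p permutes UNIV"
      using permutes_compose[OF t that] .
    moreover have "sign (p \<circ> Transposition.transpose i j) = - sign p" if "p permutes UNIV"
      using that \<open>i \<noteq> j\<close> t
      by (subst sign_compose) (auto simp: sign_swap_id permutation_permutes)
    ultimately show ?thesis by auto
  qed
  define p where "p \<alpha> \<beta> \<rho> \<sigma> = (\<lambda>_ :: 4. 0 :: 4)(0 := \<alpha>, 1 := \<beta>, 2 := \<rho>, 3 := \<sigma>)" for \<alpha> \<beta> \<rho> \<sigma>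
  have e: "epsilon \<alpha> \<beta> \<rho> \<sigma> = ?e (p \<alpha> \<beta> \<rho> \<sigma>)" for \<alpha> \<beta> \<rho> \<sigma>
    by (simp add: epsilon_def p_def Let_def)
  have pe: "p \<beta> \<alpha> \<rho> \<sigma> = p \<alpha> \<beta> \<rho> \<sigma> \<circ> Transposition.transpose 0 1"
    "p \<alpha> \<rho> \<beta> \<sigma> = p \<alpha> \<beta> \<rho> \<sigma> \<circ> Transposition.transpose 1 2"
    "p \<alpha> \<beta> \<sigma> \<rho> = p \<alpha> \<beta> \<rho> \<sigma> \<circ> Transposition.transpose 2 3"
    by (simp_all add: fun_eq_iff all4 p_def Transposition.transpose_def)
  show "epsilon \<beta> \<alpha> \<rho> \<sigma> = - epsilon \<alpha> \<beta> \<rho> \<sigma>" unfolding e pe(1) by (rule *) simp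
  show "epsilon \<alpha> \<rho> \<beta> \<sigma> = - epsilon \<alpha> \<beta> \<rho> \<sigma>" unfolding e pe(2) by (rule *) simp
  show "epsilon \<alpha> \<beta> \<sigma> \<rho> = - epsilon \<alpha> \<beta> \<rho> \<sigma>" unfolding e pe(3) by (rule *) simp
qed

lemma epsilon_repeated:
  "epsilon \<alpha> \<alpha> \<rho> \<sigma> = 0" "epsilon \<alpha> \<beta> \<beta> \<sigma> = 0" "epsilon \<alpha> \<beta> \<rho> \<rho> = 0"
  using epsilon_swap(1)[of \<alpha> \<alpha> \<rho> \<sigma>] epsilon_swap(2)[of \<alpha> \<beta> \<beta> \<sigma>] epsilon_swap(3)[of \<alpha> \<beta> \<rho> \<rho>]
  by simp_all

text \<open>Only instances that put a smaller index in front are listed, so rewriting terminates: it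
  is a bubble sort of the arguments.\<close>

lemmas epsilon_sort = epsilon_repeated epsilon_0123
  epsilon_swap(1)[of 1 0] epsilon_swap(1)[of 2 0] epsilon_swap(1)[of 3 0]
  epsilon_swap(1)[of 2 1] epsilon_swap(1)[of 3 1] epsilon_swap(1)[of 3 2]
  epsilon_swap(2)[of _ 1 0] epsilon_swap(2)[of _ 2 0] epsilon_swap(2)[of _ 3 0]
  epsilon_swap(2)[of _ 2 1] epsilon_swap(2)[of _ 3 1] epsilon_swap(2)[of _ 3 2]
  epsilon_swap(3)[of _ _ 1 0] epsilon_swap(3)[of _ _ 2 0] epsilon_swap(3)[of _ _ 3 0]
  epsilon_swap(3)[of _ _ 2 1] epsilon_swap(3)[of _ _ 3 1] epsilon_swap(3)[of _ _ 3 2]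

text \<open>Each of the three pairings of the indices arises from eight orders; the
  antisymmetrization in \<open>ephat\<close> accounts for four of them, and exchanging the two
  factors gives the 2.\<close>

lemma epsilon_sum:
  "(\<Sum>\<alpha>\<in>UNIV. \<Sum>\<beta>\<in>UNIV. \<Sum>\<rho>\<in>UNIV. \<Sum>\<sigma>\<in>UNIV.
     epsilon \<alpha> \<beta> \<rho> \<sigma> * (et \<alpha> * d \<alpha> \<beta>) * (et \<rho> * d \<rho> \<sigma>)) = 2 * ephat d"
  unfolding sum4 ephat_def Let_def
  by (simp add: epsilon_sort et_simps) (simp add: algebra_simps)

section \<open>The Hermitian form\<close>

definition eta_prod :: "4 set \<Rightarrow> complex" where
  "eta_prod I = complex_of_real (\<Prod>i\<in>I. et i)"

text \<open>As the metric is diagonal, a Leibniz term is nonzero only if the permutation matches the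
  entries of the two lists. This forces equal sets, and for equal increasing lists the identity
  permutation.\<close>

lemma eta_hat_entry: "eta_hat $ I $ J = (if I = J then eta_prod I else 0)"
proof -
  define Is where "Is = sorted_list_of_set I"
  define Js where "Js = sorted_list_of_set J"
  have s: "set Is = I" "set Js = J" "distinct Is" "distinct Js" by (simp_all add: Is_def Js_def)
  let ?f = "\<lambda>p. of_int (sign p) * (\<Prod>i<length Is. eta (Is ! i) (Js ! p i)) :: real"
  have zero: "?f p = 0" if "i < length Is" "Is ! i \<noteq> Js ! p i" for p i
  proof -
    have "(\<Prod>i<length Is. eta (Is ! i) (Js ! p i)) = 0"
      using that by (intro prod_zero bexI[of _ i]) (auto simp: eta_def)
    then show ?thesis by simp
  qed
  have "eta_hat_idx Is Js = (if I = J then (\<Prod>i\<in>I. et i) else 0)"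
  proof (cases "I = J")
    case True
    then have J: "Js = Is" by (simp add: Is_def Js_def)
    have "(\<Sum>p | p permutes {..<length Is}. ?f p) = (\<Sum>p | p permutes {..<length Is}. if p = id then ?f id else 0)"
    proof (rule sum.cong, rule refl)
      fix p assume p: "p \<in> {p. p permutes {..<length Is}}"
      show "?f p = (if p = id then ?f id else 0)"
      proof (cases "p = id")
        case False
        then obtain i where i: "p i \<noteq> i" by (metis eq_id_iff)
        then have "i < length Is" using p by (auto simp: permutes_def)
        moreover have "p i < length Is" using p calculation permutes_in_image[of p "{..<length Is}" i] by auto
        ultimately have "Is ! i \<noteq> Js ! p i" using i s(3) by (auto simp: J nth_eq_iff_index_eq)
        then show ?thesis using zero[of i p] \<open>i < length Is\<close> False by simp
      qed simp
    qed
    also have "\<dots> = ?f id" by (simp add: permutes_id finite_permutations)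
    also have "\<dots> = (\<Prod>i\<in>I. et i)"
      using prod.reindex_bij_betw[OF bij_betw_nth[OF s(3) refl s(1)[symmetric]], of et]
      by (simp add: J et_def sign_id)
    finally show ?thesis using True by (simp add: eta_hat_idx_def J)
  next
    case False
    have "?f p = 0" if p: "p permutes {..<length Is}" and l: "length Is = length Js" for p
    proof (rule ccontr)
      assume "?f p \<noteq> 0"
      then have *: "Is ! i = Js ! p i" if "i < length Is" for i using zero that by blast
      have "set Is = (!) Is ` {..<length Is}" by (auto simp: set_conv_nth)
      also have "\<dots> = (!) Js ` p ` {..<length Is}" using * by (force simp: image_image)
      also have "\<dots> = set Js" using permutes_image[OF p] l by (auto simp: set_conv_nth)
      finally show False using False s by simp
    qed
    then have "(\<Sum>p | p permutes {..<length Is}. ?f p) = 0" if "length Is = length Js"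
      using that by (intro sum.neutral) blast
    then show ?thesis using False by (simp add: eta_hat_idx_def)
  qed
  then show ?thesis by (simp add: eta_hat_def Is_def Js_def eta_prod_def)
qed

lemma herm_alt: "herm u v = (\<Sum>I\<in>UNIV. eta_prod I * cnj (u $ I) * v $ I)"
proof -
  have "(eta_hat *v v) $ I = eta_prod I * v $ I" for I
    by (simp add: matrix_vector_mult_def eta_hat_entry if_distrib[of "\<lambda>c. c * _"] cong: if_cong)
  then show ?thesis by (simp add: herm_def mult_ac)
qed

lemma herm_cnj: "cnj (herm u v) = herm v u"
  by (simp add: herm_alt eta_prod_def mult_ac)

lemma herm_lin:
  "herm u (v + w) = herm u v + herm u w" "herm (u + w) v = herm u v + herm w v"
  "herm u (v - w) = herm u v - herm u w" "herm (u - w) v = herm u v - herm w v"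
  "herm u (- v) = - herm u v" "herm (- u) v = - herm u v"
  "herm u (r *\<^sub>R v) = r *\<^sub>R herm u v" "herm (r *\<^sub>R u) v = r *\<^sub>R herm u v"
  "herm u 0 = 0" "herm 0 v = 0"
  by (simp_all add: herm_alt algebra_simps sum.distrib sum_subtractf sum_negf scaleR_sum_right)

lemma herm_sum: "herm u (\<Sum>i\<in>A. f i) = (\<Sum>i\<in>A. herm u (f i))"
  by (induction A rule: infinite_finite_induct) (simp_all add: herm_lin)

lemma wedge_axis_nth:
  "(axis {a} 1 \<and>\<^sub>E v) $ K = (if a \<in> K then wsign {a} (K - {a}) * v $ (K - {a}) else 0)"
proof -
  have "(axis {a} 1 \<and>\<^sub>E v) $ K =
      (\<Sum>I\<in>Pow K. if I = {a} then wsign {a} (K - {a}) * v $ (K - {a}) else 0)"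
    unfolding wedge_def vec_lambda_beta by (rule sum.cong) (auto simp: axis_def)
  then show ?thesis by simp
qed

lemma cnj_wsign: "cnj (wsign I J) = wsign I J"
  by (simp add: wsign_def)

text \<open>Wedge and contraction are mutually adjoint: removing a from K splits the factor
  \<open>et a\<close> off \<open>eta_prod K\<close>, which is exactly the metric factor in
  \<open>iota0 a\<close>.\<close>

lemma herm_wedge: "herm u (axis {a} 1 \<and>\<^sub>E v) = herm (iota0 a u) v"
proof -
  have "herm u (axis {a} 1 \<and>\<^sub>E v) =
      (\<Sum>K\<in>{K. a \<in> K}. eta_prod K * cnj (u $ K) * (wsign {a} (K - {a}) * v $ (K - {a})))"
    unfolding herm_alt by (rule sum.mono_neutral_cong_right) (auto simp: wedge_axis_nth)
  also have "\<dots> = (\<Sum>L\<in>{L. a \<notin> L}. eta_prod L * cnj (iota0 a u $ L) * v $ L)"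
  proof (rule sum.reindex_bij_witness[of _ "insert a" "\<lambda>K. K - {a}"])
    fix K assume "K \<in> {K. a \<in> K}"
    then have K: "insert a K = K" by auto
    have "eta_prod K = complex_of_real (et a) * eta_prod (K - {a})"
      unfolding eta_prod_def using \<open>K \<in> {K. a \<in> K}\<close> by (subst prod.remove[of _ a]) auto
    then show "eta_prod (K - {a}) * cnj (iota0 a u $ (K - {a})) * v $ (K - {a}) =
        eta_prod K * cnj (u $ K) * (wsign {a} (K - {a}) * v $ (K - {a}))"
      by (simp add: K iota0_def cnj_wsign et_def)
  qed auto
  also have "\<dots> = herm (iota0 a u) v"
    unfolding herm_alt by (rule sum.mono_neutral_cong_left) (auto simp: iota0_def)
  finally show ?thesis .
qed

lemma herm_iota0: "herm u (iota0 a v) = herm (axis {a} 1 \<and>\<^sub>E u) v"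
  using arg_cong[OF herm_wedge[of v a u], of cnj] by (simp add: herm_cnj)

lemma herm_grade: "herm u (grade v) = herm (grade u) v"
  by (simp add: herm_alt grade_def mult_ac)

text \<open>Adjointness with respect to the indefinite form \<open>herm\<close>, kept as a relation
  so that no adjoint operator has to be constructed.\<close>

definition adjoint_pair :: "ext_op \<Rightarrow> ext_op \<Rightarrow> bool" where
  "adjoint_pair M N \<longleftrightarrow> (\<forall>u v. herm u (M *v v) = herm (N *v u) v)"

lemma adjoint_pair_gamma: "adjoint_pair (gamma a) (- gamma a)"
  by (simp add: adjoint_pair_def gamma_mv matrix_minus_mv herm_lin herm_wedge herm_iota0)

text \<open>The sum of wedge and contraction is self-adjoint, and so is the grading; the sign arises
  from moving the grading back in front.\<close>

lemma adjoint_pair_Rh: "adjoint_pair (rho_op a) (- rho_op a)"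
proof -
  have "herm u (rho a v) = herm (- rho a u) v" for u v
  proof -
    have "herm u (rho a v) = herm (grade (iota0 a u + axis {a} 1 \<and>\<^sub>E u)) v"
      by (simp only: rho_def herm_lin herm_wedge herm_iota0 herm_grade grade_lin)
    also have "grade (iota0 a u + axis {a} 1 \<and>\<^sub>E u) = - rho a u"
      unfolding rho_def grade_lin(1) grade_wedge grade_iota0 by simp
    finally show ?thesis .
  qed
  then show ?thesis by (simp add: adjoint_pair_def matrix_minus_mv rho_op_mv)
qed

lemma adjoint_pair_mult: "adjoint_pair M M' \<Longrightarrow> adjoint_pair N N' \<Longrightarrow> adjoint_pair (M ** N) (N' ** M')"
  by (simp add: adjoint_pair_def matrix_vector_mul_assoc[symmetric])

lemma scaleR_mv: "(r *\<^sub>R M) *v v = r *\<^sub>R (M *v v)" for M :: ext_op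
  by (simp add: matrix_vector_mult_def vec_eq_iff scaleR_sum_right)

lemma adjoint_pair_lin: "adjoint_pair M M' \<Longrightarrow> adjoint_pair N N' \<Longrightarrow> adjoint_pair (M + N) (M' + N')" "adjoint_pair M M' \<Longrightarrow> adjoint_pair (- M) (- M')"
  "adjoint_pair M M' \<Longrightarrow> adjoint_pair (r *\<^sub>R M) (r *\<^sub>R M')" "adjoint_pair 0 0" "adjoint_pair (mat 1) (mat 1)"
  by (simp_all add: adjoint_pair_def matrix_vector_mult_add_rdistrib matrix_minus_mv scaleR_mv herm_lin)

lemma adjoint_pair_sum: "(\<And>i. i \<in> A \<Longrightarrow> adjoint_pair (f i) (f i)) \<Longrightarrow> adjoint_pair (\<Sum>i\<in>A. f i) (\<Sum>i\<in>A. f i)"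
  by (induction A rule: infinite_finite_induct) (auto intro: adjoint_pair_lin)

text \<open>The four signs cancel, and reversing four anticommuting factors takes six exchanges, an
  even number.\<close>

lemma adjoint_pair_JJ: "adjoint_pair JJ JJ"
proof -
  have "adjoint_pair (rho_op 0 ** (rho_op 1 ** (rho_op 2 ** rho_op 3))) ((((- rho_op 3) ** (- rho_op 2)) ** (- rho_op 1)) ** (- rho_op 0))"
    by (intro adjoint_pair_mult adjoint_pair_Rh)
  then show ?thesis by (simp add: JJ_Rh rho_op_norm)
qed

text \<open>The field equation equates a real number with the sesquilinear form of \<open>current\<close>, but
  stationarity only sees the real part of that form; hence \<open>current\<close> has to be self-adjoint.\<close>

definition current :: "real \<Rightarrow> 4 \<Rightarrow> ext_op" where
  "current \<zeta> \<alpha> = (\<Sum>\<beta>\<in>UNIV. gamma_up \<beta> ** mexp (\<zeta> *\<^sub>R JJ) ** Theta [\<beta>, \<alpha>])"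

text \<open>For \<beta> different from \<alpha>, \<open>gamma \<beta>\<close> and
  \<open>rho_op \<beta> ** rho_op \<alpha>\<close> are both anti-self-adjoint and the exponential is
  self-adjoint. These three commute with each other: \<open>gamma \<beta>\<close> commutes with
  every \<open>rho_op\<close>, and \<open>JJ\<close> anticommutes with each \<open>rho_op\<close>,
  hence commutes with a pair. The two signs cancel.\<close>

lemma adjoint_pair_current: "adjoint_pair (current \<zeta> \<alpha>) (current \<zeta> \<alpha>)"
  unfolding current_def
proof (rule adjoint_pair_sum)
  fix \<beta> :: 4
  let ?E = "cos \<zeta> *\<^sub>R mat 1 + sin \<zeta> *\<^sub>R JJ"
  have g: "gamma_up \<beta> = eta \<beta> \<beta> *\<^sub>R gamma \<beta>" by (simp only: gamma_up_def eta_sum)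
  show "adjoint_pair (gamma_up \<beta> ** mexp (\<zeta> *\<^sub>R JJ) ** Theta [\<beta>, \<alpha>]) (gamma_up \<beta> ** mexp (\<zeta> *\<^sub>R JJ) ** Theta [\<beta>, \<alpha>])"
  proof (cases "\<beta> = \<alpha>")
    case True
    have "X ** Theta [\<alpha>, \<alpha>] = 0" for X :: ext_op by (simp add: Theta_diag matrix_matrix_mult_def vec_eq_iff)
    then show ?thesis using True by (simp add: adjoint_pair_lin)
  next
    case False
    have JJg: "JJ ** gamma \<beta> = gamma \<beta> ** JJ"
      by (simp add: JJ_Rh rho_op_gamma rho_op_gamma_assoc matrix_mul_assoc[symmetric])
    have JJR: "rho_op a ** JJ = - (JJ ** rho_op a)" for a
    proof -
      have "\<forall>a. rho_op a ** JJ = - (JJ ** rho_op a)"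
        unfolding all4 by (simp add: JJ_Rh rho_op_norm)
      then show ?thesis by blast
    qed
    have E: "?E ** gamma \<beta> = gamma \<beta> ** ?E" "rho_op \<alpha> ** (rho_op \<beta> ** ?E) = ?E ** (rho_op \<alpha> ** rho_op \<beta>)"
    proof -
      show "?E ** gamma \<beta> = gamma \<beta> ** ?E"
        by (simp add: matrix_add_left matrix_add_ldistrib matrix_scalar_ac scalar_matrix_assoc[symmetric] JJg)
      have "rho_op \<alpha> ** (rho_op \<beta> ** JJ) = JJ ** (rho_op \<alpha> ** rho_op \<beta>)"
        by (simp only: JJR matrix_minus_right matrix_mul_assoc matrix_minus_left minus_minus)
      then show "rho_op \<alpha> ** (rho_op \<beta> ** ?E) = ?E ** (rho_op \<alpha> ** rho_op \<beta>)"
        by (simp add: matrix_add_left matrix_add_ldistrib matrix_scalar_ac scalar_matrix_assoc[symmetric])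
    qed
    have "adjoint_pair (gamma \<beta> ** ?E ** (- (rho_op \<beta> ** rho_op \<alpha>))) ((- ((- rho_op \<alpha>) ** (- rho_op \<beta>))) ** (?E ** (- gamma \<beta>)))"
      by (intro adjoint_pair_mult adjoint_pair_lin adjoint_pair_gamma adjoint_pair_Rh adjoint_pair_JJ)
    also have "(- ((- rho_op \<alpha>) ** (- rho_op \<beta>))) ** (?E ** (- gamma \<beta>)) = (rho_op \<alpha> ** (rho_op \<beta> ** ?E)) ** gamma \<beta>"
      by (simp only: matrix_minus_left matrix_minus_right minus_minus matrix_mul_assoc)
    also have "\<dots> = gamma \<beta> ** ?E ** (rho_op \<alpha> ** rho_op \<beta>)"
      unfolding E(2) using E(1) by (simp only: matrix_mul_assoc[symmetric] rho_op_gamma rho_op_gamma_assoc)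
        (simp only: matrix_mul_assoc)
    also have "rho_op \<alpha> ** rho_op \<beta> = - (rho_op \<beta> ** rho_op \<alpha>)" using False by (rule rho_op_swap[OF not_sym])
    finally show ?thesis
      using False
      by (simp only: g mexp_complex_structure[OF JJ_square] Theta_pair[OF False] scalar_matrix_assoc[symmetric])
        (rule adjoint_pair_lin(3))
  qed
qed

lemma herm_current_real:
  "herm v (current \<zeta> \<alpha> *v v) = complex_of_real (Re (herm v (current \<zeta> \<alpha> *v v)))"
proof -
  have "cnj (herm v (current \<zeta> \<alpha> *v v)) = herm v (current \<zeta> \<alpha> *v v)"
    using adjoint_pair_current[of \<zeta> \<alpha>] by (simp add: adjoint_pair_def herm_cnj)
  then show ?thesis by (simp add: complex_eq_iff)
qed

section \<open>The dependence of the spinor Lagrangian on the potential\<close>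

lemma sum_mv: "(\<Sum>i\<in>A. M i) *v v = (\<Sum>i\<in>A. M i *v v)" for M :: "'i \<Rightarrow> ext_op"
  by (induction A rule: infinite_finite_induct) (simp_all add: matrix_vector_mult_add_rdistrib)

lemma mv_sum: "M *v (\<Sum>i\<in>A. f i) = (\<Sum>i\<in>A. M *v f i)" for M :: ext_op
  by (induction A rule: infinite_finite_induct) (simp_all add: matrix_vector_right_distrib)

lemma mv_scaleR: "M *v (r *\<^sub>R v) = r *\<^sub>R (M *v v)" for M :: ext_op
  by (simp add: matrix_vector_mult_def vec_eq_iff scaleR_sum_right)

definition lagK0 :: "real \<Rightarrow> (real^4 \<Rightarrow> ext) \<Rightarrow> real^4 \<Rightarrow> real" where
  "lagK0 m \<psi> x = Re (herm (\<psi> x) (\<Sum>\<alpha>\<in>UNIV. gamma_up \<alpha> *v pd \<alpha> \<psi> x)) - m * Re (herm (\<psi> x) (\<psi> x))"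

lemma L_K_split:
  "L_K m (F \<zeta> B) \<psi> x = complex_of_real
     (lagK0 m \<psi> x + (\<Sum>\<beta>\<in>UNIV. B x $ \<beta> * Re (herm (\<psi> x) (current \<zeta> \<beta> *v \<psi> x))))"
proof -
  have "Dirac (F \<zeta> B) \<psi> x = (\<Sum>\<alpha>\<in>UNIV. gamma_up \<alpha> *v pd \<alpha> \<psi> x) +
      (\<Sum>\<alpha>\<in>UNIV. \<Sum>\<beta>\<in>UNIV. (B x $ \<beta>) *\<^sub>R ((gamma_up \<alpha> ** mexp (\<zeta> *\<^sub>R JJ) ** Theta [\<alpha>, \<beta>]) *v \<psi> x))"
    unfolding Dirac_def F_def matrix_vector_right_distrib sum.distrib sum_mv mv_sum scaleR_mv mv_scaleR
    by (simp only: matrix_vector_mul_assoc matrix_mul_assoc)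
  also have "(\<Sum>\<alpha>\<in>UNIV. \<Sum>\<beta>\<in>UNIV. (B x $ \<beta>) *\<^sub>R ((gamma_up \<alpha> ** mexp (\<zeta> *\<^sub>R JJ) ** Theta [\<alpha>, \<beta>]) *v \<psi> x)) =
      (\<Sum>\<beta>\<in>UNIV. (B x $ \<beta>) *\<^sub>R (current \<zeta> \<beta> *v \<psi> x))"
    by (subst sum.swap) (simp only: current_def sum_mv scaleR_sum_right)
  finally have D: "herm (\<psi> x) (Dirac (F \<zeta> B) \<psi> x) = herm (\<psi> x) (\<Sum>\<alpha>\<in>UNIV. gamma_up \<alpha> *v pd \<alpha> \<psi> x) +
      (\<Sum>\<beta>\<in>UNIV. (B x $ \<beta>) *\<^sub>R herm (\<psi> x) (current \<zeta> \<beta> *v \<psi> x))"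
    by (simp only: herm_lin herm_sum)
  have r: "herm v v = complex_of_real (Re (herm v v))" for v
    using herm_cnj[of v v] by (simp add: complex_eq_iff)
  show ?thesis
    unfolding L_K_def D lagK0_def plus_cc_def
    by (subst r, subst complex_eq_iff) (simp add: algebra_simps sum_negf)
qed

section \<open>Smooth fields\<close>

lemma smooth_pd: "smooth f \<Longrightarrow> smooth (pd \<alpha> f)"
  unfolding smooth_def
proof
  fix \<alpha>s assume "\<forall>\<alpha>s. foldr pd \<alpha>s f differentiable_on UNIV"
  then have "foldr pd (\<alpha>s @ [\<alpha>]) f differentiable_on UNIV" by blast
  then show "foldr pd \<alpha>s (pd \<alpha> f) differentiable_on UNIV" by simp
qed

lemma smooth_differentiable: "smooth f \<Longrightarrow> f differentiable at x"
  unfolding smooth_def differentiable_on_def by (drule spec[of _ "[]"]) simp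

lemma smooth_continuous: "smooth f \<Longrightarrow> continuous_on A f"
  by (meson differentiable_imp_continuous_within continuous_at_imp_continuous_on smooth_differentiable)

lemma smooth_linear:
  assumes "bounded_linear T" "smooth f"
  shows "smooth (\<lambda>x. T (f x))"
proof -
  have "foldr pd \<alpha>s (\<lambda>x. T (f x)) = (\<lambda>x. T (foldr pd \<alpha>s f x))" for \<alpha>s
  proof (induction \<alpha>s)
    case (Cons \<alpha> \<alpha>s)
    have "foldr pd \<alpha>s f differentiable at x" for x
      using assms(2) by (auto simp: smooth_def differentiable_on_def)
    then show ?case by (simp add: Cons fun_eq_iff pd_linear[OF assms(1)])
  qed simp
  then show ?thesis
    using assms unfolding smooth_def differentiable_on_def
    by (auto intro: differentiable_compose bounded_linear_imp_differentiable)
qed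

lemma smooth_component: "smooth f \<Longrightarrow> smooth (\<lambda>x. f x $ i)"
  by (rule smooth_linear[OF bounded_linear_vec_nth])

text \<open>The derivative at every parameter of a coordinate line and within any set, as the
  fundamental theorem of calculus and the Leibniz rule require it.\<close>

lemma has_vector_derivative_pd_line:
  assumes "f differentiable at (x + t *\<^sub>R axis \<alpha> 1)"
  shows "((\<lambda>t. f (x + t *\<^sub>R axis \<alpha> 1)) has_vector_derivative pd \<alpha> f (x + t *\<^sub>R axis \<alpha> 1)) (at t within S)"
proof -
  let ?g = "\<lambda>s. f ((x + t *\<^sub>R axis \<alpha> 1) + s *\<^sub>R axis \<alpha> 1)"
  have 1: "(?g has_vector_derivative pd \<alpha> f (x + t *\<^sub>R axis \<alpha> 1)) (at (t - t))"
    using has_vector_derivative_pd[OF assms] by simp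
  have 2: "((\<lambda>s. s - t) has_vector_derivative 1) (at t)"
    by (auto intro!: derivative_eq_intros)
  have "(?g \<circ> (\<lambda>s. s - t) has_vector_derivative 1 *\<^sub>R pd \<alpha> f (x + t *\<^sub>R axis \<alpha> 1)) (at t)"
    by (rule vector_diff_chain_at[OF 2 1])
  moreover have "?g \<circ> (\<lambda>s. s - t) = (\<lambda>t. f (x + t *\<^sub>R axis \<alpha> 1))"
    by (simp add: fun_eq_iff algebra_simps)
  ultimately show ?thesis
    by (auto intro: has_vector_derivative_at_within)
qed

lemma pd_add:
  "f differentiable at x \<Longrightarrow> g differentiable at x \<Longrightarrow> pd \<alpha> (\<lambda>y. f y + g y) x = pd \<alpha> f x + pd \<alpha> g x"
  by (rule pd_eqI, rule has_vector_derivative_add) (rule has_vector_derivative_pd, assumption)+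

lemma pd_scaleR: "f differentiable at x \<Longrightarrow> pd \<alpha> (\<lambda>y. c *\<^sub>R f y) x = c *\<^sub>R pd \<alpha> f x"
  by (rule pd_linear[OF bounded_linear_scaleR_right])

lemma pd_cmult: "f differentiable at x \<Longrightarrow> pd \<alpha> (\<lambda>y. c * f y) x = c * pd \<alpha> f x" for c :: real
  by (rule pd_linear[OF bounded_linear_mult_right])

lemma pd_mult:
  fixes f g :: "real^4 \<Rightarrow> real"
  assumes "f differentiable at x" "g differentiable at x"
  shows "pd \<alpha> (\<lambda>y. f y * g y) x = f x * pd \<alpha> g x + pd \<alpha> f x * g x"
  using has_vector_derivative_mult[OF has_vector_derivative_pd has_vector_derivative_pd, OF assms]
  by (intro pd_eqI) simp

lemma pd_sum:
  "(\<And>i. i \<in> A \<Longrightarrow> f i differentiable at x) \<Longrightarrow> pd \<alpha> (\<lambda>y. \<Sum>i\<in>A. f i y) x = (\<Sum>i\<in>A. pd \<alpha> (f i) x)"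
  by (rule pd_eqI has_vector_derivative_sum has_vector_derivative_pd | assumption)+

lemma pd_vanish:
  assumes "closed K" "\<And>x. x \<notin> K \<Longrightarrow> f x = 0" "x \<notin> K"
  shows "pd \<alpha> f x = 0"
proof (rule pd_eqI)
  have "open ((\<lambda>t. x + t *\<^sub>R axis \<alpha> 1 :: real^4) -` (- K))"
    using assms(1) by (intro continuous_open_vimage) (auto intro!: continuous_intros)
  moreover have "0 \<in> (\<lambda>t. x + t *\<^sub>R axis \<alpha> 1) -` (- K)" using assms(3) by simp
  ultimately show "((\<lambda>t. f (x + t *\<^sub>R axis \<alpha> 1)) has_vector_derivative 0) (at 0)"
    by (rule has_vector_derivative_transform_within_open[of "\<lambda>_. 0", rotated]) (auto simp: assms(2))
qed

section \<open>Integration by parts\<close>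

lemma integrable_on_compact:
  fixes f :: "'a::euclidean_space \<Rightarrow> 'b::euclidean_space"
  assumes "compact K" "continuous_on K f"
  shows "f integrable_on K"
  using set_borel_integral_eq_integral(1)[of K f] borel_integrable_compact[OF assms]
  unfolding set_integrable_def by blast

text \<open>The integral of a translate of \<open>w\<close> does not depend on the translation; differentiate it.\<close>

lemma integral_pd_eq_0:
  fixes w :: "real^4 \<Rightarrow> real"
  assumes d: "\<And>x. w differentiable at x" and c: "continuous_on UNIV (pd \<mu> w)"
    and K: "compact K" "\<And>x. x \<notin> K \<Longrightarrow> w x = 0"
  shows "integral K (pd \<mu> w) = 0"
proof -
  let ?e = "axis \<mu> 1 :: real^4"
  have cw: "continuous_on A w" for A
    using d by (meson differentiable_imp_continuous_within continuous_at_imp_continuous_on)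
  \<comment> \<open>All points from which a shift by at most 1 can reach K. One box around them
    supports every translate, so the domain of integration stays fixed as t varies.\<close>
  define K' where "K' = (\<lambda>(x, t). x - t *\<^sub>R ?e) ` (K \<times> {-1..1})"
  have "compact K'"
    unfolding K'_def by (intro compact_continuous_image compact_Times K(1) continuous_intros)
      (auto intro!: continuous_intros simp: split_beta)
  then obtain a where a: "K' \<subseteq> cbox (- a) a"
    using bounded_subset_cbox_symmetric[OF compact_imp_bounded] by blast
  have shift: "w (x + t *\<^sub>R ?e) = 0" if "\<bar>t\<bar> \<le> 1" "x \<notin> cbox (- a) a" for x t
  proof (rule K(2), rule notI)
    assume "x + t *\<^sub>R ?e \<in> K"
    then have "(x + t *\<^sub>R ?e) - t *\<^sub>R ?e \<in> K'"
      unfolding K'_def using that(1) by (intro image_eqI[of _ _ "(x + t *\<^sub>R ?e, t)"]) auto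
    then show False using that(2) a by auto
  qed
  have int: "w integrable_on K" by (rule integrable_on_compact[OF K(1) cw])
  have const: "integral (cbox (- a) a) (\<lambda>x. w (x + t *\<^sub>R ?e)) = integral K w" if t: "\<bar>t\<bar> \<le> 1" for t
  proof -
    obtain b where b: "K \<subseteq> cbox (- b) b"
      using bounded_subset_cbox_symmetric[OF compact_imp_bounded] K(1) by blast
    have "(w has_integral integral K w) (cbox (- b) b)"
      using has_integral_on_superset[OF integrable_integral[OF int]] K(2) b by blast
    from has_integral_affinity'[OF this, of 1 "t *\<^sub>R ?e"]
    have "((\<lambda>x. w (x + t *\<^sub>R ?e)) has_integral integral K w) (cbox (- b - t *\<^sub>R ?e) (b - t *\<^sub>R ?e))"
      by simp
    moreover have "w (x + t *\<^sub>R ?e) = 0" if "x \<notin> cbox (- b - t *\<^sub>R ?e) (b - t *\<^sub>R ?e)" for x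
    proof (rule K(2), rule notI)
      assume "x + t *\<^sub>R ?e \<in> K"
      then have "x + t *\<^sub>R ?e \<in> cbox (- b) b" using b by blast
      then have "x \<in> cbox (- b - t *\<^sub>R ?e) (b - t *\<^sub>R ?e)"
        unfolding mem_box by (force simp: inner_diff_left inner_add_left algebra_simps)
      then show False using that by contradiction
    qed
    ultimately have "((\<lambda>x. w (x + t *\<^sub>R ?e)) has_integral integral K w) UNIV"
      by (rule has_integral_on_superset) auto
    then have "((\<lambda>x. if x \<in> cbox (- a) a then w (x + t *\<^sub>R ?e) else 0) has_integral integral K w) UNIV"
      by (rule has_integral_eq[rotated]) (use shift[OF t] in auto)
    then show ?thesis
      unfolding has_integral_restrict_UNIV by (rule integral_unique)
  qed
  have "((\<lambda>t. integral (cbox (- a) a) (\<lambda>x. w (x + t *\<^sub>R ?e))) has_vector_derivative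
      integral (cbox (- a) a) (\<lambda>x. pd \<mu> w (x + 0 *\<^sub>R ?e))) (at 0 within {-1..1})"
  proof (rule leibniz_rule_vector_derivative)
    show "((\<lambda>t. w (x + t *\<^sub>R ?e)) has_vector_derivative pd \<mu> w (x + t *\<^sub>R ?e)) (at t within {-1..1})" for x t
      by (rule has_vector_derivative_pd_line[OF d])
    show "(\<lambda>x. w (x + t *\<^sub>R ?e)) integrable_on cbox (- a) a" for t
      by (intro integrable_continuous continuous_on_compose2[OF cw[of UNIV]] continuous_intros) auto
    show "continuous_on ({- 1..1} \<times> cbox (- a) a) (\<lambda>(t, x). pd \<mu> w (x + t *\<^sub>R ?e))"
      unfolding split_beta by (intro continuous_on_compose2[OF c] continuous_intros) auto
  qed auto
  \<comment> \<open>By \<open>const\<close> the function just differentiated is constant on [-1, 1],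
    so the two derivatives can be compared.\<close>
  moreover have "((\<lambda>t. integral (cbox (- a) a) (\<lambda>x. w (x + t *\<^sub>R ?e))) has_vector_derivative 0)
      (at 0 within {-1..1})"
    by (rule has_vector_derivative_transform[of _ _ _ "\<lambda>_. integral K w"])
      (simp_all add: const abs_le_iff)
  ultimately have "integral (cbox (- a) a) (pd \<mu> w) = 0"
    using vector_derivative_unique_within_closed_interval[of "-1" 1 0] by simp
  moreover have "K \<subseteq> cbox (- a) a"
  proof
    fix x assume "x \<in> K"
    then have "x \<in> K'" unfolding K'_def by (intro image_eqI[of _ _ "(x, 0)"]) auto
    then show "x \<in> cbox (- a) a" using a by blast
  qed
  moreover have "(pd \<mu> w has_integral integral K (pd \<mu> w)) K"
    by (intro integrable_integral integrable_on_compact K(1) continuous_on_subset[OF c]) auto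
  then have "(pd \<mu> w has_integral integral K (pd \<mu> w)) (cbox (- a) a)"
    by (rule has_integral_on_superset)
      (use pd_vanish[OF compact_imp_closed[OF K(1)] K(2)] \<open>K \<subseteq> cbox (- a) a\<close> in auto)
  ultimately show ?thesis by (metis integral_unique)
qed

text \<open>The product h P inherits its support from h, so the integral of its derivative is
  zero.\<close>

lemma integral_by_parts:
  fixes h P :: "real^4 \<Rightarrow> real"
  assumes h: "\<And>x. h differentiable at x" "continuous_on UNIV (pd \<mu> h)"
    and P: "\<And>x. P differentiable at x" "continuous_on UNIV (pd \<mu> P)"
    and K: "compact K" "\<And>x. x \<notin> K \<Longrightarrow> h x = 0"
  shows "integral K (\<lambda>x. pd \<mu> h x * P x) = - integral K (\<lambda>x. h x * pd \<mu> P x)"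
proof -
  have cont: "continuous_on UNIV h" "continuous_on UNIV P"
    using h(1) P(1) by (meson differentiable_imp_continuous_within continuous_at_imp_continuous_on)+
  have pd: "pd \<mu> (\<lambda>x. h x * P x) = (\<lambda>x. h x * pd \<mu> P x + pd \<mu> h x * P x)"
    by (simp add: fun_eq_iff pd_mult h P)
  have "integral K (pd \<mu> (\<lambda>x. h x * P x)) = 0"
  proof (rule integral_pd_eq_0)
    show "(\<lambda>x. h x * P x) differentiable at x" for x
      by (intro differentiable_mult h P)
    show "continuous_on UNIV (pd \<mu> (\<lambda>x. h x * P x))"
      unfolding pd by (intro continuous_intros cont h P)
  qed (use K in auto)
  moreover have "integral K (pd \<mu> (\<lambda>x. h x * P x)) =
      integral K (\<lambda>x. h x * pd \<mu> P x) + integral K (\<lambda>x. pd \<mu> h x * P x)"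
    unfolding pd
    by (intro integral_add integrable_on_compact K(1) continuous_intros
        cont[THEN continuous_on_subset] h(2)[THEN continuous_on_subset]
        P(2)[THEN continuous_on_subset] subset_UNIV)
  ultimately show ?thesis by simp
qed

section \<open>Symmetry of second partial derivatives\<close>

text \<open>Differentiate \<open>f (y + t b) - f y = \<integral>\<^sub>0\<^sup>t \<partial>\<^sub>\<beta> f (y + \<tau> b) d\<tau>\<close> first in \<open>y\<close> along \<open>\<alpha>\<close>, then in \<open>t\<close>
  at \<open>0\<close>.\<close>

lemma pd_commute:
  fixes f :: "real^4 \<Rightarrow> real"
  assumes f: "smooth f"
  shows "pd \<alpha> (pd \<beta> f) x = pd \<beta> (pd \<alpha> f) x"
proof -
  let ?a = "axis \<alpha> 1 :: real^4" and ?b = "axis \<beta> 1 :: real^4"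
  note sm = f smooth_pd[OF f] smooth_pd[OF smooth_pd[OF f]]
  have c: "continuous_on UNIV (pd \<beta> f)" "continuous_on UNIV (pd \<alpha> (pd \<beta> f))"
    by (rule smooth_continuous sm)+
  have ftc: "integral {0..t} (\<lambda>\<tau>. pd \<beta> f (y + \<tau> *\<^sub>R ?b)) = f (y + t *\<^sub>R ?b) - f y" if "0 \<le> t" for y t
  proof -
    have "((\<lambda>\<tau>. pd \<beta> f (y + \<tau> *\<^sub>R ?b)) has_integral f (y + t *\<^sub>R ?b) - f (y + 0 *\<^sub>R ?b)) {0..t}"
      by (rule fundamental_theorem_of_calculus[OF that])
        (rule has_vector_derivative_pd_line[OF smooth_differentiable[OF f]])
    then show ?thesis by (simp add: integral_unique)
  qed
  have int: "pd \<alpha> f (x + t *\<^sub>R ?b) - pd \<alpha> f x = integral {0..t} (\<lambda>\<tau>. pd \<alpha> (pd \<beta> f) (x + \<tau> *\<^sub>R ?b))"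
    if t: "0 \<le> t" for t
  proof -
    have "((\<lambda>s. integral (cbox 0 t) (\<lambda>\<tau>. pd \<beta> f (x + \<tau> *\<^sub>R ?b + s *\<^sub>R ?a))) has_vector_derivative
        integral (cbox 0 t) (\<lambda>\<tau>. pd \<alpha> (pd \<beta> f) (x + \<tau> *\<^sub>R ?b + 0 *\<^sub>R ?a))) (at 0 within UNIV)"
    proof (rule leibniz_rule_vector_derivative)
      show "((\<lambda>s. pd \<beta> f (x + \<tau> *\<^sub>R ?b + s *\<^sub>R ?a)) has_vector_derivative
          pd \<alpha> (pd \<beta> f) (x + \<tau> *\<^sub>R ?b + s *\<^sub>R ?a)) (at s within UNIV)" for s \<tau>
        by (rule has_vector_derivative_pd_line[OF smooth_differentiable[OF sm(2)]])
      show "(\<lambda>\<tau>. pd \<beta> f (x + \<tau> *\<^sub>R ?b + s *\<^sub>R ?a)) integrable_on cbox 0 t" for s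
        by (intro integrable_continuous continuous_on_compose2[OF c(1)] continuous_intros) auto
      show "continuous_on (UNIV \<times> cbox 0 t) (\<lambda>(s, \<tau>). pd \<alpha> (pd \<beta> f) (x + \<tau> *\<^sub>R ?b + s *\<^sub>R ?a))"
        unfolding split_beta by (intro continuous_on_compose2[OF c(2)] continuous_intros) auto
    qed auto
    moreover have "integral (cbox 0 t) (\<lambda>\<tau>. pd \<beta> f (x + \<tau> *\<^sub>R ?b + s *\<^sub>R ?a)) =
        f (x + t *\<^sub>R ?b + s *\<^sub>R ?a) - f (x + s *\<^sub>R ?a)" for s
      using ftc[OF t, of "x + s *\<^sub>R ?a"] by (simp add: ac_simps)
    moreover have "((\<lambda>s. f (x + t *\<^sub>R ?b + s *\<^sub>R ?a) - f (x + s *\<^sub>R ?a)) has_vector_derivative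
        pd \<alpha> f (x + t *\<^sub>R ?b) - pd \<alpha> f x) (at 0)"
      by (intro has_vector_derivative_diff has_vector_derivative_pd smooth_differentiable f)
    ultimately show ?thesis by (simp add: vector_derivative_unique_at)
  qed
  have "((\<lambda>t. integral {0..t} (\<lambda>\<tau>. pd \<alpha> (pd \<beta> f) (x + \<tau> *\<^sub>R ?b))) has_vector_derivative
      pd \<alpha> (pd \<beta> f) (x + 0 *\<^sub>R ?b)) (at 0 within {0..1})"
    by (rule integral_has_vector_derivative)
      (auto intro!: continuous_on_compose2[OF c(2)] continuous_intros)
  \<comment> \<open>The integral formula holds for nonnegative t only, hence one-sided derivatives
    at 0, which still are unique.\<close>
  then have D1: "((\<lambda>t. pd \<alpha> f (x + t *\<^sub>R ?b) - pd \<alpha> f x) has_vector_derivative pd \<alpha> (pd \<beta> f) x) (at 0 within {0..1})"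
    by (subst (asm) scaleR_zero_left) (rule has_vector_derivative_transform[rotated 2], auto simp: int)
  have D2: "((\<lambda>t. pd \<alpha> f (x + t *\<^sub>R ?b) - pd \<alpha> f x) has_vector_derivative pd \<beta> (pd \<alpha> f) x - 0) (at 0 within {0..1})"
    by (intro has_vector_derivative_diff has_vector_derivative_const
        has_vector_derivative_at_within[OF has_vector_derivative_pd] smooth_differentiable sm)
  show ?thesis
    using vector_derivative_unique_within_closed_interval[of 0 1 0, OF _ _ D1[folded cbox_interval] D2[folded cbox_interval]]
    by simp
qed

section \<open>Differentiating an integral with respect to a parameter\<close>

text \<open>\<open>expands G g\<close>: \<open>g\<close> is the derivative of \<open>G s\<close> at \<open>s = 0\<close>, with a remainder that is locally
  uniformly quadratic in \<open>s\<close>. The condition is stable under sums and products and allows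
  differentiation under the integral.\<close>

definition expands :: "(real \<Rightarrow> 'a::euclidean_space \<Rightarrow> real) \<Rightarrow> ('a \<Rightarrow> real) \<Rightarrow> bool" where
  "expands G g \<longleftrightarrow> continuous_on UNIV (G 0) \<and> continuous_on UNIV g \<and>
     (\<exists>r. continuous_on UNIV (\<lambda>p. r (fst p) (snd p)) \<and> (\<forall>s x. G s x = G 0 x + s * g x + s\<^sup>2 * r s x))"

lemma expandsI:
  assumes "continuous_on UNIV (G 0)" "continuous_on UNIV g" "continuous_on UNIV (\<lambda>p. r (fst p) (snd p))"
    and "\<And>s x. G s x = G 0 x + s * g x + s\<^sup>2 * r s x"
  shows "expands G g"
  using assms unfolding expands_def by blast

lemma expandsD: "expands G g \<Longrightarrow> continuous_on UNIV (G 0)" "expands G g \<Longrightarrow> continuous_on UNIV g"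
  by (simp_all add: expands_def)

lemma expands_cong: "expands G g \<Longrightarrow> (\<And>x. g x = g' x) \<Longrightarrow> expands G g'"
  unfolding expands_def by (simp cong: continuous_on_cong)

lemma expands_const: "continuous_on UNIV f \<Longrightarrow> expands (\<lambda>s x. f x) (\<lambda>x. 0)"
  unfolding expands_def by (intro conjI exI[of _ "\<lambda>s x. 0"]) simp_all

lemma expands_line: "continuous_on UNIV f \<Longrightarrow> continuous_on UNIV h \<Longrightarrow> expands (\<lambda>s x. f x + s * h x) h"
  unfolding expands_def by (intro conjI exI[of _ "\<lambda>s x. 0"]) simp_all

lemma expands_add:
  assumes "expands G g" "expands H h"
  shows "expands (\<lambda>s x. G s x + H s x) (\<lambda>x. g x + h x)"
proof -
  obtain r where r: "continuous_on UNIV (\<lambda>p. r (fst p) (snd p))"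
    and G: "\<And>s x. G s x = G 0 x + s * g x + s\<^sup>2 * r s x"
    using assms(1) unfolding expands_def by blast
  obtain q where q: "continuous_on UNIV (\<lambda>p. q (fst p) (snd p))"
    and H: "\<And>s x. H s x = H 0 x + s * h x + s\<^sup>2 * q s x"
    using assms(2) unfolding expands_def by blast
  have *: "G s x + H s x = G 0 x + H 0 x + s * (g x + h x) + s\<^sup>2 * (r s x + q s x)" for s x
    by (subst G, subst H) (simp add: algebra_simps)
  show ?thesis
    by (rule expandsI[OF _ _ _ *]) (intro continuous_intros r q expandsD[OF assms(1)] expandsD[OF assms(2)])+
qed

lemma expands_mult:
  assumes "expands G g" "expands H h"
  shows "expands (\<lambda>s x. G s x * H s x) (\<lambda>x. G 0 x * h x + g x * H 0 x)"
proof -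
  obtain r where r: "continuous_on UNIV (\<lambda>p. r (fst p) (snd p))"
    and G: "\<And>s x. G s x = G 0 x + s * g x + s\<^sup>2 * r s x"
    using assms(1) unfolding expands_def by blast
  obtain q where q: "continuous_on UNIV (\<lambda>p. q (fst p) (snd p))"
    and H: "\<And>s x. H s x = H 0 x + s * h x + s\<^sup>2 * q s x"
    using assms(2) unfolding expands_def by blast
  have c': "continuous_on UNIV (G 0)" "continuous_on UNIV g" "continuous_on UNIV (H 0)" "continuous_on UNIV h"
    using assms by (simp_all add: expands_def)
  \<comment> \<open>The coefficients of s^2, s^3 and s^4 in the product of the two expansions, after
    division by s^2.\<close>
  define t where "t s x = G 0 x * q s x + r s x * H 0 x + g x * h x + s * (g x * q s x + r s x * h x) +
    s\<^sup>2 * (r s x * q s x)" for s x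
  have t: "continuous_on UNIV (\<lambda>p. t (fst p) (snd p))"
    unfolding t_def by (intro continuous_intros r q c'[THEN continuous_on_compose2]) auto
  have *: "G s x * H s x = G 0 x * H 0 x + s * (G 0 x * h x + g x * H 0 x) + s\<^sup>2 * t s x" for s x
    by (subst G, subst H) (simp add: algebra_simps t_def power2_eq_square)
  show ?thesis
    by (rule expandsI[OF _ _ t *]) (intro continuous_intros c')+
qed

lemma expands_cmult: "expands G g \<Longrightarrow> expands (\<lambda>s x. c * G s x) (\<lambda>x. c * g x)"
  using expands_mult[OF expands_const[of "\<lambda>_. c"], of G g] by simp

lemma expands_diff: "expands G g \<Longrightarrow> expands H h \<Longrightarrow> expands (\<lambda>s x. G s x - H s x) (\<lambda>x. g x - h x)"
  using expands_add[OF _ expands_cmult[of H h "-1"], of G g] by simp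

lemma expands_sum: "(\<And>i. i \<in> A \<Longrightarrow> expands (G i) (g i)) \<Longrightarrow> expands (\<lambda>s x. \<Sum>i\<in>A. G i s x) (\<lambda>x. \<Sum>i\<in>A. g i x)"
  by (induction A rule: infinite_finite_induct) (auto intro: expands_const expands_add)

lemma expands_continuous: "expands G g \<Longrightarrow> continuous_on A (G s)"
proof -
  assume *: "expands G g"
  then obtain r where r: "continuous_on UNIV (\<lambda>p. r (fst p) (snd p))"
    and G: "\<And>x. G s x = G 0 x + s * g x + s\<^sup>2 * r s x"
    unfolding expands_def by blast
  have "continuous_on UNIV (\<lambda>x. r s x)"
    using continuous_on_compose2[OF r, of UNIV "\<lambda>x. (s, x)"] by (simp add: continuous_intros)
  then have "continuous_on UNIV (\<lambda>x. G 0 x + s * g x + s\<^sup>2 * r s x)"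
    using * by (auto simp: expands_def intro!: continuous_intros)
  then have "continuous_on UNIV (G s)" by (simp add: G[symmetric])
  then show ?thesis by (rule continuous_on_subset) simp
qed

text \<open>The remainder is continuous, hence bounded on the compact product of [-1, 1] and K, so
  the difference quotient differs from the claimed derivative by at most a constant times the size
  of s.\<close>

lemma expands_integral:
  assumes G: "expands G g" and K: "compact K"
  shows "((\<lambda>s. integral K (G s)) has_real_derivative integral K g) (at 0)"
proof -
  obtain r where r: "continuous_on UNIV (\<lambda>p. r (fst p) (snd p))"
    and e: "\<And>s x. G s x = G 0 x + s * g x + s\<^sup>2 * r s x"
    using G unfolding expands_def by blast
  have c: "continuous_on K (G 0)" "continuous_on K g"
    using G unfolding expands_def by (auto intro: continuous_on_subset)
  have rs: "continuous_on K (r s)" for s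
    by (rule continuous_on_subset[of UNIV])
      (use continuous_on_compose2[OF r, of UNIV "\<lambda>x. (s, x)"] in \<open>simp_all add: continuous_intros\<close>)
  note int = integrable_on_compact[OF K]
  have split: "integral K (G s) = integral K (G 0) + s * integral K g + s\<^sup>2 * integral K (r s)" for s
  proof -
    have "integral K (G s) = integral K (\<lambda>x. G 0 x + s * g x + s\<^sup>2 * r s x)"
      by (rule arg_cong[of _ _ "integral K"]) (rule ext, rule e)
    also have "\<dots> = integral K (G 0) + integral K (\<lambda>x. s * g x) + integral K (\<lambda>x. s\<^sup>2 * r s x)"
      by (subst integral_add; (intro int continuous_intros c rs)?)+ simp
    finally show ?thesis by simp
  qed
  have "compact ((\<lambda>p. r (fst p) (snd p)) ` ({-1..1} \<times> K))"
    by (intro compact_continuous_image compact_Times K continuous_on_subset[OF r]) auto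
  then obtain N where N: "\<And>s x. s \<in> {-1..1} \<Longrightarrow> x \<in> K \<Longrightarrow> \<bar>r s x\<bar> \<le> N"
    using compact_imp_bounded[THEN bounded_iff[THEN iffD1]] by fastforce
  define M where "M = integral K (\<lambda>x. N)"
  have M: "\<bar>integral K (r s)\<bar> \<le> M" if "s \<in> {-1..1}" for s
    unfolding M_def real_norm_def[symmetric]
    by (rule integral_norm_bound_integral) (use N[OF that] in \<open>auto intro!: int rs continuous_intros\<close>)
  have "((\<lambda>s. (integral K (G (0 + s)) - integral K (G 0)) / s - integral K g) \<longlongrightarrow> 0) (at 0)"
  proof (rule Lim_null_comparison)
    have "eventually (\<lambda>s::real. s \<in> {-1<..<1} \<and> s \<noteq> 0) (at 0)"
      by (intro eventually_conj eventually_at_in_open' eventually_neq_at_within) auto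
    then show "eventually (\<lambda>s. norm ((integral K (G (0 + s)) - integral K (G 0)) / s - integral K g) \<le> \<bar>s\<bar> * M) (at 0)"
    proof eventually_elim
      case (elim s)
      have "(integral K (G (0 + s)) - integral K (G 0)) / s - integral K g = s * integral K (r s)"
        using elim by (subst add_0_left, subst split[of s]) (simp add: field_simps power2_eq_square)
      then show ?case using M[of s] elim by (simp add: abs_mult mult_left_mono)
    qed
    show "((\<lambda>s. \<bar>s\<bar> * M) \<longlongrightarrow> 0) (at 0)"
      by (auto intro!: tendsto_eq_intros)
  qed
  then show ?thesis
    unfolding DERIV_def by (rule LIM_zero_cancel)
qed

section \<open>Bump functions\<close>

text \<open>The classical exp(-1/y), extended by zero, together with the multiples by powers of 1/y
  that its derivatives produce.\<close>

definition flat :: "nat \<Rightarrow> real \<Rightarrow> real" where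
  "flat k y = (if y > 0 then inverse y ^ k / exp (inverse y) else 0)"

lemma flat_shift: "y * flat (Suc k) y = flat k y"
  by (simp add: flat_def)

lemma flat_tendsto_0: "(flat k \<longlongrightarrow> 0) (at 0)"
proof -
  have "((\<lambda>y. inverse y ^ k / exp (inverse y)) \<longlongrightarrow> (0::real)) (at_right 0)"
    by (rule filterlim_compose[OF tendsto_power_div_exp_0 filterlim_inverse_at_top_right])
  then have "(flat k \<longlongrightarrow> 0) (at_right 0)"
    by (rule Lim_transform_eventually) (auto simp: flat_def eventually_at_filter)
  moreover have "((\<lambda>_. 0) \<longlongrightarrow> (0::real)) (at_left 0)" by simp
  then have "(flat k \<longlongrightarrow> 0) (at_left 0)"
    by (rule Lim_transform_eventually) (auto simp: flat_def eventually_at_filter)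
  ultimately show ?thesis by (simp add: filterlim_at_split)
qed

lemma flat_deriv: "(flat k has_real_derivative (1 - real k * y) * flat (k + 2) y) (at y)"
proof -
  consider "y > 0" | "y < 0" | "y = 0" by linarith
  then show ?thesis
  proof cases
    case 1
    have "((\<lambda>y. inverse y ^ k / exp (inverse y)) has_real_derivative (1 - real k * y) * flat (k + 2) y) (at y)"
    proof -
      define z where "z = inverse y"
      have yz: "y * z = 1" "y \<noteq> 0" using 1 by (simp_all add: z_def)
      have kz: "real k * z ^ (k - Suc 0) * z = real k * z ^ k" by (cases k) simp_all
      have "((\<lambda>y. inverse y ^ k / exp (inverse y)) has_real_derivative
          ((real k * z ^ (k - Suc 0) * (- (z * z))) * exp z - z ^ k * (exp z * (- (z * z)))) / (exp z * exp z)) (at y)"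
        using 1 by (auto intro!: derivative_eq_intros simp: z_def)
      also have "real k * z ^ (k - Suc 0) * (- (z * z)) = - (real k * z ^ k * z)"
        using kz by (metis mult.assoc mult_minus_right)
      also have "(- (real k * z ^ k * z) * exp z - z ^ k * (exp z * (- (z * z)))) / (exp z * exp z) =
          (z ^ k * z * z - real k * z ^ k * z) / exp z"
        by (simp add: field_simps)
      also have "z ^ k * z * z - real k * z ^ k * z = (1 - real k * y) * z ^ (k + 2)"
        using yz(1) by (simp add: algebra_simps)
      finally show ?thesis
        using 1 by (simp add: flat_def z_def)
    qed
    then show ?thesis
      by (rule has_field_derivative_transform_within_open[of _ _ _ "{0<..}"]) (use 1 in \<open>auto simp: flat_def\<close>)
  next
    case 2
    have "((\<lambda>_. 0) has_real_derivative (1 - real k * y) * flat (k + 2) y) (at y)"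
      using 2 by (simp add: flat_def)
    then show ?thesis
      by (rule has_field_derivative_transform_within_open[of _ _ _ "{..<0}"]) (use 2 in \<open>auto simp: flat_def\<close>)
  next
    case 3
    \<comment> \<open>By \<open>flat_shift\<close> the difference quotient at 0 is
      \<open>flat (Suc k)\<close>, which tends to 0.\<close>
    have "((\<lambda>h. (flat k (0 + h) - flat k 0) / h) \<longlongrightarrow> 0) (at 0)"
      by (rule Lim_transform_eventually[OF flat_tendsto_0[of "Suc k"]])
        (auto simp: eventually_at_filter flat_shift[of _ k, symmetric])
    then show ?thesis using 3 by (simp add: DERIV_def flat_def)
  qed
qed

text \<open>As \<open>flat k' y = (1 - k y) flat (k + 2) y\<close> and \<open>flat k y = y\<^sup>2 flat (k + 2) y\<close>, all derivatives
  of \<open>flat 0 (q t)\<close>, with \<open>q = (t - a) (b - t)\<close>, have the shape \<open>p t * flat (2 * n) (q t)\<close> for a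
  polynomial \<open>p\<close>.\<close>

lemma bump_1D:
  fixes a b :: real
  assumes "a < b"
  obtains g :: "nat \<Rightarrow> real \<Rightarrow> real"
  where "\<And>n t. (g n has_real_derivative g (Suc n) t) (at t)"
    and "\<And>t. a < t \<Longrightarrow> t < b \<Longrightarrow> 0 < g 0 t" and "\<And>t. \<not> (a < t \<and> t < b) \<Longrightarrow> g 0 t = 0"
proof -
  \<comment> \<open>Positive exactly between a and b, so composing with \<open>flat\<close> vanishes
    exactly outside that interval.\<close>
  define q where "q = [:- a * b, a + b, -1:]"
  have q: "poly q t = (t - a) * (b - t)" for t by (simp add: q_def algebra_simps)
  \<comment> \<open>The product and chain rules for P(t) \<open>flat (2 * n)\<close> (q t), with
    both terms brought to the common factor \<open>flat (2 * n + 2)\<close>.\<close>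
  define step where "step n P = pderiv P * q\<^sup>2 + P * pderiv q * (1 - smult (real (2 * n)) q)" for n P
  define p where "p = rec_nat [:1:] step"
  define g where "g n t = poly (p n) t * flat (2 * n) (poly q t)" for n t
  show thesis
  proof
    fix n t
    have s: "flat (2 * n) (poly q t) = (poly q t)\<^sup>2 * flat (2 * n + 2) (poly q t)"
      by (simp add: power2_eq_square flat_shift mult.assoc)
    have "(g n has_real_derivative
        poly (pderiv (p n)) t * flat (2 * n) (poly q t) +
        ((1 - real (2 * n) * poly q t) * flat (2 * n + 2) (poly q t) * poly (pderiv q) t) * poly (p n) t) (at t)"
      unfolding g_def by (intro DERIV_mult DERIV_chain2[OF flat_deriv] poly_DERIV)
    also have "poly (pderiv (p n)) t * flat (2 * n) (poly q t) +
        ((1 - real (2 * n) * poly q t) * flat (2 * n + 2) (poly q t) * poly (pderiv q) t) * poly (p n) t = g (Suc n) t"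
      unfolding s by (simp add: g_def p_def step_def algebra_simps)
    finally show "(g n has_real_derivative g (Suc n) t) (at t)" .
  next
    show "0 < g 0 t" if "a < t" "t < b" for t
      using that by (simp add: g_def p_def flat_def q)
    show "g 0 t = 0" if "\<not> (a < t \<and> t < b)" for t
      using that assms by (auto simp: g_def flat_def q zero_less_mult_iff)
  qed
qed

text \<open>The products in which factor i is differentiated n i times form a family closed under
  partial derivatives: each one raises a single n i. All members are differentiable, so every
  iterated derivative is.\<close>

lemma smooth_prod:
  fixes g :: "4 \<Rightarrow> nat \<Rightarrow> real \<Rightarrow> real"
  assumes g: "\<And>i n t. (g i n has_real_derivative g i (Suc n) t) (at t)"
  shows "smooth (\<lambda>x. \<Prod>i\<in>UNIV. g i 0 (x $ i))"
proof -
  define u where "u n x = (\<Prod>i\<in>UNIV. g i (n i) (x $ i))" for n and x :: "real^4"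
  have pd: "pd \<alpha> (u n) = u (n(\<alpha> := Suc (n \<alpha>)))" for \<alpha> n
  proof (rule ext, rule pd_eqI)
    fix x
    let ?c = "\<Prod>i\<in>UNIV - {\<alpha>}. g i (n i) (x $ i)"
    have u: "u m (x + t *\<^sub>R axis \<alpha> 1) = g \<alpha> (m \<alpha>) (x $ \<alpha> + t) * (\<Prod>i\<in>UNIV - {\<alpha>}. g i (m i) (x $ i))" for m t
    proof -
      have "(\<Prod>i\<in>UNIV - {\<alpha>}. g i (m i) ((x + t *\<^sub>R axis \<alpha> 1) $ i)) = (\<Prod>i\<in>UNIV - {\<alpha>}. g i (m i) (x $ i))"
        by (rule prod.cong) (auto simp: axis_def)
      then show ?thesis
        unfolding u_def by (subst prod.remove[of _ \<alpha>]) (auto simp: axis_def)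
    qed
    have "((\<lambda>t. g \<alpha> (n \<alpha>) (x $ \<alpha> + t)) has_real_derivative g \<alpha> (Suc (n \<alpha>)) (x $ \<alpha> + 0) * 1) (at 0)"
      by (rule DERIV_chain2[OF g]) (auto intro!: derivative_eq_intros)
    then have "((\<lambda>t. g \<alpha> (n \<alpha>) (x $ \<alpha> + t) * ?c) has_real_derivative g \<alpha> (Suc (n \<alpha>)) (x $ \<alpha>) * ?c) (at 0)"
      by (intro DERIV_cmult_right) simp
    moreover have "(\<Prod>i\<in>UNIV - {\<alpha>}. g i ((n(\<alpha> := Suc (n \<alpha>))) i) (x $ i)) = ?c"
      by (rule prod.cong) auto
    then have "u (n(\<alpha> := Suc (n \<alpha>))) x = g \<alpha> (Suc (n \<alpha>)) (x $ \<alpha>) * ?c"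
      using u[of "n(\<alpha> := Suc (n \<alpha>))" 0] by simp
    ultimately show "((\<lambda>t. u n (x + t *\<^sub>R axis \<alpha> 1)) has_vector_derivative u (n(\<alpha> := Suc (n \<alpha>))) x) (at 0)"
      by (simp add: u has_real_derivative_iff_has_vector_derivative)
  qed
  have diff: "u n differentiable at x" for n x
  proof -
    have "(\<lambda>x. \<Prod>i\<in>I. g i (n i) (x $ i)) differentiable at x" if "finite I" for I
      using that
    proof induction
      case (insert i I)
      have "(\<lambda>x. g i (n i) (x $ i)) differentiable at x"
      proof (rule differentiable_compose[of "g i (n i)"])
        show "g i (n i) differentiable at (x $ i)"
          using g real_differentiable_def by blast
        show "(\<lambda>x. x $ i) differentiable at x"
          by (rule bounded_linear_imp_differentiable[OF bounded_linear_vec_nth])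
      qed
      then show ?case using insert by (simp add: differentiable_mult)
    qed simp
    then show ?thesis unfolding u_def by simp
  qed
  have "\<exists>n. foldr pd \<alpha>s (u (\<lambda>_. 0)) = u n" for \<alpha>s
    by (induction \<alpha>s) (auto simp: pd)
  then have "smooth (u (\<lambda>_. 0))"
    unfolding smooth_def differentiable_on_def using diff by (metis differentiable_at_withinI)
  then show ?thesis unfolding u_def by simp
qed

lemma bump:
  fixes a b :: "real^4"
  assumes "\<And>i. a $ i < b $ i"
  obtains h :: "real^4 \<Rightarrow> real"
  where "smooth h" "\<And>x. x \<in> box a b \<Longrightarrow> 0 < h x" "\<And>x. x \<notin> box a b \<Longrightarrow> h x = 0"
proof -
  have "\<exists>g :: nat \<Rightarrow> real \<Rightarrow> real. (\<forall>n t. (g n has_real_derivative g (Suc n) t) (at t)) \<and>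
      (\<forall>t. a $ i < t \<and> t < b $ i \<longrightarrow> 0 < g 0 t) \<and> (\<forall>t. \<not> (a $ i < t \<and> t < b $ i) \<longrightarrow> g 0 t = 0)" for i
    using bump_1D[OF assms[of i]] by metis
  then obtain g :: "4 \<Rightarrow> nat \<Rightarrow> real \<Rightarrow> real"
    where g: "\<And>i n t. (g i n has_real_derivative g i (Suc n) t) (at t)"
      and pos: "\<And>i t. a $ i < t \<Longrightarrow> t < b $ i \<Longrightarrow> 0 < g i 0 t"
      and zero: "\<And>i t. \<not> (a $ i < t \<and> t < b $ i) \<Longrightarrow> g i 0 t = 0"
    by metis
  show thesis
  proof (rule that)
    show "smooth (\<lambda>x. \<Prod>i\<in>UNIV. g i 0 (x $ i))" by (rule smooth_prod[of g, OF g])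
    show "0 < (\<Prod>i\<in>UNIV. g i 0 (x $ i))" if "x \<in> box a b" for x
      using that pos by (intro prod_pos) (auto simp: mem_box_cart)
    show "(\<Prod>i\<in>UNIV. g i 0 (x $ i)) = 0" if x: "x \<notin> box a b" for x
    proof -
      obtain i where "\<not> (a $ i < x $ i \<and> x $ i < b $ i)" using x by (auto simp: mem_box_cart)
      then show ?thesis using zero by (intro prod_zero) auto
    qed
  qed
qed

text \<open>If c E were positive at x, it would be positive on a box around x. A bump function on
  that box then gives a nonnegative continuous integrand with integral zero, which must vanish at x.
  Taking c = E x treats both signs at once, since the square of E x cannot be positive.\<close>

lemma fundamental_lemma:
  fixes E :: "real^4 \<Rightarrow> real"
  assumes E: "continuous_on UNIV E"
    and int: "\<And>h K. smooth h \<Longrightarrow> compact K \<Longrightarrow> (\<And>x. x \<notin> K \<Longrightarrow> h x = 0) \<Longrightarrow> integral K (\<lambda>x. h x * E x) = 0"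
  shows "E x = 0"
proof -
  have "\<not> c * E x > 0" for c
  proof
    assume pos: "c * E x > 0"
    have "open {x. c * E x > 0}"
      using E by (intro open_Collect_less continuous_intros)
    then obtain a b where ab: "cbox a b \<subseteq> {x. c * E x > 0}" "x \<in> box a b"
      using open_contains_cbox pos by (metis mem_Collect_eq)
    then have lt: "a $ i < b $ i" for i using ab(2) unfolding mem_box_cart by (meson less_trans)
    obtain h :: "real^4 \<Rightarrow> real" where h: "smooth h" "\<And>x. x \<in> box a b \<Longrightarrow> 0 < h x" "\<And>x. x \<notin> box a b \<Longrightarrow> h x = 0"
      by (rule bump[OF lt]) blast
    have hc: "continuous_on (cbox a b) h"
      by (rule smooth_continuous[OF h(1)])
    have c: "continuous_on (cbox a b) (\<lambda>y. h y * (c * E y))"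
      by (rule continuous_on_mult[OF hc continuous_on_mult_left[OF continuous_on_subset[OF E subset_UNIV]]])
    have "integral (cbox a b) (\<lambda>y. h y * E y) = 0"
      by (rule int[OF h(1)]) (use h(3) box_subset_cbox in auto)
    then have "integral (cbox a b) (\<lambda>y. h y * (c * E y)) = 0"
      using integral_mult_right[of "cbox a b" c "\<lambda>y. h y * E y"] by (simp add: mult.left_commute)
    then have "((\<lambda>y. h y * (c * E y)) has_integral 0) (cbox a b)"
      using integrable_integral[OF integrable_continuous[OF c]] by simp
    then have "h x * (c * E x) = 0"
    proof (rule has_integral_0_cbox_imp_0[OF c, rotated])
      show "box a b \<noteq> {}" using ab(2) by auto
      show "x \<in> cbox a b" using ab(2) box_subset_cbox by blast
      show "0 \<le> h y * (c * E y)" if "y \<in> box a b" for y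
      proof -
        have "c * E y > 0" using ab(1) that box_subset_cbox[of a b] by blast
        then show ?thesis using mult_pos_pos[OF h(2)[OF that]] less_imp_le by blast
      qed
    qed
    then show False using h(2)[OF ab(2)] pos by auto
  qed
  from this[of "E x"] show ?thesis by (auto simp: not_less mult_le_0_iff)
qed

section \<open>The Euler-Lagrange equations\<close>

text \<open>\<open>A \<alpha>\<close> and \<open>P \<mu> \<alpha>\<close> stand for the derivatives
  of the Lagrangian with respect to B^\<alpha> and to its derivative along \<mu>. The Lagrangian
  itself enters only through the expansion of its real values \<open>G h s x\<close> in s.\<close>

lemma euler_lagrange:
  assumes L: "\<And>h s x. smooth h \<Longrightarrow> L (\<lambda>y. B y + s *\<^sub>R h y) x = complex_of_real (G h s x)"
    and G: "\<And>h. smooth h \<Longrightarrow> expands (G h) (\<lambda>x. (\<Sum>\<alpha>\<in>UNIV. h x $ \<alpha> * A \<alpha> x) +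
        (\<Sum>\<mu>\<in>UNIV. \<Sum>\<alpha>\<in>UNIV. pd \<mu> (\<lambda>y. h y $ \<alpha>) x * P \<mu> \<alpha> x))"
    and A: "\<And>\<alpha>. continuous_on UNIV (A \<alpha>)"
    and P: "\<And>\<mu> \<alpha> x. P \<mu> \<alpha> differentiable at x" "\<And>\<mu> \<alpha>. continuous_on UNIV (pd \<mu> (P \<mu> \<alpha>))"
  shows "stationary L B \<longleftrightarrow> (\<forall>x \<alpha>. A \<alpha> x = (\<Sum>\<mu>\<in>UNIV. pd \<mu> (P \<mu> \<alpha>) x))"
proof -
  define E where "E \<alpha> x = A \<alpha> x - (\<Sum>\<mu>\<in>UNIV. pd \<mu> (P \<mu> \<alpha>) x)" for \<alpha> x
  have Ec: "continuous_on S (E \<alpha>)" for \<alpha> S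
    unfolding E_def
    by (intro continuous_on_diff continuous_on_sum A[THEN continuous_on_subset]
        P(2)[THEN continuous_on_subset] subset_UNIV)
  have Pc: "continuous_on S (P \<mu> \<alpha>)" for \<mu> \<alpha> S
    using P(1) by (meson differentiable_imp_continuous_within continuous_at_imp_continuous_on)
  \<comment> \<open>The action is differentiable along every admissible variation, so by uniqueness
    of derivatives stationarity says precisely that this integral is zero.\<close>
  have D: "((\<lambda>s. integral K (L (\<lambda>x. B x + s *\<^sub>R h x))) has_vector_derivative
      complex_of_real (integral K (\<lambda>x. \<Sum>\<alpha>\<in>UNIV. h x $ \<alpha> * E \<alpha> x))) (at 0)"
    if h: "smooth h" "compact K" "\<And>x. x \<notin> K \<Longrightarrow> h x = 0" for h K
  proof -
    note hs = smooth_component[OF h(1)]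
    note int = integrable_on_compact[OF h(2)]
    have hc: "continuous_on S (\<lambda>x. h x $ \<alpha>)" "continuous_on S (pd \<mu> (\<lambda>x. h x $ \<alpha>))" for S \<mu> \<alpha>
      by (rule smooth_continuous hs smooth_pd)+
    have LG: "integral K (L (\<lambda>x. B x + s *\<^sub>R h x)) = complex_of_real (integral K (G h s))" for s
    proof -
      have "L (\<lambda>x. B x + s *\<^sub>R h x) = complex_of_real \<circ> G h s"
        by (simp add: fun_eq_iff L[OF h(1)])
      then show ?thesis
        using integral_linear[OF int[OF expands_continuous[OF G[OF h(1)]]] bounded_linear_of_real] by simp
    qed
    have parts: "integral K (\<lambda>x. pd \<mu> (\<lambda>y. h y $ \<alpha>) x * P \<mu> \<alpha> x) = - integral K (\<lambda>x. h x $ \<alpha> * pd \<mu> (P \<mu> \<alpha>) x)"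
      for \<mu> \<alpha>
      by (rule integral_by_parts) (simp_all add: smooth_differentiable[OF hs] hc P h)
    have "integral K (\<lambda>x. (\<Sum>\<alpha>\<in>UNIV. h x $ \<alpha> * A \<alpha> x) +
        (\<Sum>\<mu>\<in>UNIV. \<Sum>\<alpha>\<in>UNIV. pd \<mu> (\<lambda>y. h y $ \<alpha>) x * P \<mu> \<alpha> x)) =
        (\<Sum>\<alpha>\<in>UNIV. integral K (\<lambda>x. h x $ \<alpha> * A \<alpha> x)) +
        (\<Sum>\<mu>\<in>UNIV. \<Sum>\<alpha>\<in>UNIV. integral K (\<lambda>x. pd \<mu> (\<lambda>y. h y $ \<alpha>) x * P \<mu> \<alpha> x))"
      by (subst integral_add;
          (intro int continuous_on_sum continuous_on_mult hc Pc A[THEN continuous_on_subset] subset_UNIV)?)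
        (simp_all add: integral_sum int continuous_on_sum continuous_on_mult hc Pc A[THEN continuous_on_subset])
    also have "\<dots> = (\<Sum>\<alpha>\<in>UNIV. integral K (\<lambda>x. h x $ \<alpha> * E \<alpha> x))"
    proof -
      have "integral K (\<lambda>x. h x $ \<alpha> * E \<alpha> x) = integral K (\<lambda>x. h x $ \<alpha> * A \<alpha> x) -
          (\<Sum>\<mu>\<in>UNIV. integral K (\<lambda>x. h x $ \<alpha> * pd \<mu> (P \<mu> \<alpha>) x))" for \<alpha>
        unfolding E_def right_diff_distrib sum_distrib_left
        by (subst integral_diff;
            (intro int continuous_on_sum continuous_on_mult hc A[THEN continuous_on_subset]
             P(2)[THEN continuous_on_subset] subset_UNIV)?)
          (simp_all add: integral_sum int continuous_on_mult hc P(2)[THEN continuous_on_subset])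
      then show ?thesis
        unfolding parts by (subst sum.swap) (simp add: sum_negf sum_subtractf)
    qed
    also have "\<dots> = integral K (\<lambda>x. \<Sum>\<alpha>\<in>UNIV. h x $ \<alpha> * E \<alpha> x)"
      by (rule integral_sum[symmetric]) (auto intro!: int continuous_on_mult hc Ec)
    finally have "((\<lambda>s. integral K (G h s)) has_real_derivative integral K (\<lambda>x. \<Sum>\<alpha>\<in>UNIV. h x $ \<alpha> * E \<alpha> x)) (at 0)"
      using expands_integral[OF G[OF h(1)] h(2)] by simp
    then show ?thesis
      unfolding LG has_real_derivative_iff_has_vector_derivative
      by (rule bounded_linear.has_vector_derivative[OF bounded_linear_of_real])
  qed
  have "stationary L B \<longleftrightarrow> (\<forall>h K. smooth h \<and> compact K \<and> (\<forall>x. x \<notin> K \<longrightarrow> h x = 0) \<longrightarrow>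
      integral K (\<lambda>x. \<Sum>\<alpha>\<in>UNIV. h x $ \<alpha> * E \<alpha> x) = 0)"
    unfolding stationary_def
  proof (intro iff_allI imp_cong refl iffI)
    fix h :: "real^4 \<Rightarrow> real^4" and K assume h: "smooth h \<and> compact K \<and> (\<forall>x. x \<notin> K \<longrightarrow> h x = 0)"
    show "integral K (\<lambda>x. \<Sum>\<alpha>\<in>UNIV. h x $ \<alpha> * E \<alpha> x) = 0"
      if "((\<lambda>s. integral K (L (\<lambda>x. B x + s *\<^sub>R h x))) has_vector_derivative 0) (at 0)"
      using vector_derivative_unique_at[OF D[of h K] that] h by simp
    show "((\<lambda>s. integral K (L (\<lambda>x. B x + s *\<^sub>R h x))) has_vector_derivative 0) (at 0)"
      if "integral K (\<lambda>x. \<Sum>\<alpha>\<in>UNIV. h x $ \<alpha> * E \<alpha> x) = 0"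
      using D[of h K] h that by simp
  qed
  also have "\<dots> \<longleftrightarrow> (\<forall>x \<alpha>. E \<alpha> x = 0)"
  proof (intro iffI allI)
    fix x \<alpha>
    assume *: "\<forall>h K. smooth h \<and> compact K \<and> (\<forall>x. x \<notin> K \<longrightarrow> h x = 0) \<longrightarrow>
      integral K (\<lambda>x. \<Sum>\<alpha>\<in>UNIV. h x $ \<alpha> * E \<alpha> x) = 0"
    show "E \<alpha> x = 0"
    proof (rule fundamental_lemma[OF Ec])
      fix h :: "real^4 \<Rightarrow> real" and K
      assume h: "smooth h" "compact K" "\<And>x. x \<notin> K \<Longrightarrow> h x = 0"
      \<comment> \<open>A variation in the single direction \<alpha> isolates one component of the
        equation.\<close>
      have "(\<Sum>\<beta>\<in>UNIV. (h x *\<^sub>R axis \<alpha> 1 :: real^4) $ \<beta> * E \<beta> x) = h x * E \<alpha> x" for x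
        by (simp add: axis_def if_distrib[of "\<lambda>c. _ * c"] if_distrib[of "\<lambda>c. c * _"] cong: if_cong)
      moreover have "smooth (\<lambda>x. h x *\<^sub>R axis \<alpha> 1 :: real^4)"
        by (rule smooth_linear[OF bounded_linear_scaleR_left h(1)])
      ultimately show "integral K (\<lambda>x. h x * E \<alpha> x) = 0"
        using *[rule_format, of "\<lambda>x. h x *\<^sub>R axis \<alpha> 1" K] h(2,3) by simp
    qed
  next
    fix h :: "real^4 \<Rightarrow> real^4" and K assume "\<forall>x \<alpha>. E \<alpha> x = 0"
    then show "smooth h \<and> compact K \<and> (\<forall>x. x \<notin> K \<longrightarrow> h x = 0) \<longrightarrow> integral K (\<lambda>x. \<Sum>\<alpha>\<in>UNIV. h x $ \<alpha> * E \<alpha> x) = 0"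
      by simp
  qed
  finally show ?thesis by (simp add: E_def)
qed

section \<open>The first variation of the Lagrangian\<close>

text \<open>The partial derivatives of \<open>lagV \<zeta> b d\<close> with respect to \<open>b \<alpha>\<close> and to \<open>d \<mu> \<alpha>\<close>.\<close>

definition lagV_b :: "real \<Rightarrow> 4 \<Rightarrow> (4 \<Rightarrow> real) \<Rightarrow> (4 \<Rightarrow> 4 \<Rightarrow> real) \<Rightarrow> real" where
  "lagV_b \<zeta> \<alpha> b d =
     - 1536 * cos (4 * \<zeta>) * ((\<Sum>\<beta>\<in>UNIV. et \<beta> * b \<beta> * b \<beta>) * (et \<alpha> * b \<alpha>))
     - 256 * cos (3 * \<zeta>) * (2 * (et \<alpha> * b \<alpha>) * (\<Sum>\<beta>\<in>UNIV. d \<beta> \<beta>)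
         - (\<Sum>\<beta>\<in>UNIV. et \<beta> * b \<beta> * d \<alpha> \<beta>) - (\<Sum>\<beta>\<in>UNIV. b \<beta> * (et \<alpha> * d \<beta> \<alpha>)))"

definition lagV_d :: "real \<Rightarrow> 4 \<Rightarrow> 4 \<Rightarrow> (4 \<Rightarrow> real) \<Rightarrow> (4 \<Rightarrow> 4 \<Rightarrow> real) \<Rightarrow> real" where
  "lagV_d \<zeta> \<mu> \<alpha> b d =
     - 256 * cos (3 * \<zeta>) * ((if \<mu> = \<alpha> then 1 else 0) * (\<Sum>\<beta>\<in>UNIV. et \<beta> * b \<beta> * b \<beta>) - b \<mu> * (et \<alpha> * b \<alpha>))
     - 32 * cos (2 * \<zeta>) * (4 * et \<mu> * et \<alpha> * d \<mu> \<alpha> + (if \<mu> = \<alpha> then 2 else 0) * (\<Sum>\<beta>\<in>UNIV. d \<beta> \<beta>))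
     - 64 * sin (2 * \<zeta>) * (\<Sum>\<rho>\<in>UNIV. \<Sum>\<sigma>\<in>UNIV. epsilon \<mu> \<alpha> \<rho> \<sigma> * et \<mu> * et \<rho> * d \<rho> \<sigma>)"

text \<open>\<open>lagV\<close> is a polynomial in b and d, so the sum and product rules for
  \<open>expands\<close> compute its first variation along the lines b + s h and d + s H.\<close>

lemma expands_lagV:
  fixes b h :: "4 \<Rightarrow> 'a::euclidean_space \<Rightarrow> real" and d H :: "4 \<Rightarrow> 4 \<Rightarrow> 'a \<Rightarrow> real"
  assumes c: "\<And>\<beta>. continuous_on UNIV (b \<beta>)" "\<And>\<beta>. continuous_on UNIV (h \<beta>)"
    "\<And>\<alpha> \<beta>. continuous_on UNIV (d \<alpha> \<beta>)" "\<And>\<alpha> \<beta>. continuous_on UNIV (H \<alpha> \<beta>)"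
  shows "expands (\<lambda>s x. lagV \<zeta> (\<lambda>\<beta>. b \<beta> x + s * h \<beta> x) (\<lambda>\<alpha> \<beta>. d \<alpha> \<beta> x + s * H \<alpha> \<beta> x))
    (\<lambda>x. (\<Sum>\<alpha>\<in>UNIV. h \<alpha> x * lagV_b \<zeta> \<alpha> (\<lambda>\<beta>. b \<beta> x) (\<lambda>\<alpha> \<beta>. d \<alpha> \<beta> x)) +
      (\<Sum>\<mu>\<in>UNIV. \<Sum>\<alpha>\<in>UNIV. H \<mu> \<alpha> x * lagV_d \<zeta> \<mu> \<alpha> (\<lambda>\<beta>. b \<beta> x) (\<lambda>\<alpha> \<beta>. d \<alpha> \<beta> x)))"
proof -
  note lines = expands_line[OF c(1,2)] expands_line[OF c(3,4)]
  have q: "expands (\<lambda>s x. \<Sum>\<alpha>\<in>UNIV. et \<alpha> * (b \<alpha> x + s * h \<alpha> x) * (b \<alpha> x + s * h \<alpha> x))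
      (\<lambda>x. \<Sum>\<alpha>\<in>UNIV. 2 * et \<alpha> * b \<alpha> x * h \<alpha> x)"
    by (rule expands_cong, (rule expands_sum expands_mult expands_cmult lines)+) (simp add: algebra_simps)
  have v: "expands (\<lambda>s x. \<Sum>\<beta>\<in>UNIV. d \<beta> \<beta> x + s * H \<beta> \<beta> x) (\<lambda>x. \<Sum>\<beta>\<in>UNIV. H \<beta> \<beta> x)"
    by (rule expands_sum lines)+
  have t: "expands (\<lambda>s x. \<Sum>\<alpha>\<in>UNIV. \<Sum>\<beta>\<in>UNIV. (b \<alpha> x + s * h \<alpha> x) * (et \<beta> * (b \<beta> x + s * h \<beta> x)) * (d \<alpha> \<beta> x + s * H \<alpha> \<beta> x))
      (\<lambda>x. \<Sum>\<alpha>\<in>UNIV. \<Sum>\<beta>\<in>UNIV. b \<alpha> x * (et \<beta> * b \<beta> x) * H \<alpha> \<beta> x +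
        (b \<alpha> x * (et \<beta> * h \<beta> x) + h \<alpha> x * (et \<beta> * b \<beta> x)) * d \<alpha> \<beta> x)"
    by (rule expands_cong, (rule expands_sum expands_cmult lines expands_mult)+) simp
  have n: "expands (\<lambda>s x. \<Sum>\<alpha>\<in>UNIV. \<Sum>\<beta>\<in>UNIV. et \<alpha> * et \<beta> * (d \<alpha> \<beta> x + s * H \<alpha> \<beta> x) * (d \<alpha> \<beta> x + s * H \<alpha> \<beta> x))
      (\<lambda>x. \<Sum>\<alpha>\<in>UNIV. \<Sum>\<beta>\<in>UNIV. 2 * et \<alpha> * et \<beta> * d \<alpha> \<beta> x * H \<alpha> \<beta> x)"
    by (rule expands_cong, (rule expands_sum expands_mult expands_cmult lines)+) (simp add: algebra_simps)
  have e: "expands (\<lambda>s x. ephat (\<lambda>\<alpha> \<beta>. d \<alpha> \<beta> x + s * H \<alpha> \<beta> x))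
      (\<lambda>x. \<Sum>\<mu>\<in>UNIV. \<Sum>\<alpha>\<in>UNIV. H \<mu> \<alpha> x * (\<Sum>\<rho>\<in>UNIV. \<Sum>\<sigma>\<in>UNIV. epsilon \<mu> \<alpha> \<rho> \<sigma> * et \<mu> * et \<rho> * d \<rho> \<sigma> x))"
    unfolding ephat_def Let_def
    by (rule expands_cong, (rule expands_cmult lines expands_add expands_diff expands_mult)+)
      (simp add: sum4 epsilon_sort et_simps, simp add: algebra_simps)
  \<comment> \<open>X, Y, Z, W and V name the gradients belonging to the separate trigonometric
    coefficients. Left folded, they make the last regrouping linear in h and H.\<close>
  define X where "X \<alpha> x = (\<Sum>\<beta>\<in>UNIV. et \<beta> * b \<beta> x * b \<beta> x) * (et \<alpha> * b \<alpha> x)" for \<alpha> x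
  define Y where "Y \<alpha> x = 2 * (et \<alpha> * b \<alpha> x) * (\<Sum>\<beta>\<in>UNIV. d \<beta> \<beta> x)
      - (\<Sum>\<beta>\<in>UNIV. et \<beta> * b \<beta> x * d \<alpha> \<beta> x) - (\<Sum>\<beta>\<in>UNIV. b \<beta> x * (et \<alpha> * d \<beta> \<alpha> x))" for \<alpha> x
  define Z where "Z \<mu> \<alpha> x = (if \<mu> = \<alpha> then 1 else 0) * (\<Sum>\<beta>\<in>UNIV. et \<beta> * b \<beta> x * b \<beta> x)
      - b \<mu> x * (et \<alpha> * b \<alpha> x)" for \<mu> \<alpha> x
  define W where "W \<mu> \<alpha> x = 4 * et \<mu> * et \<alpha> * d \<mu> \<alpha> x + (if \<mu> = \<alpha> then 2 else 0) * (\<Sum>\<beta>\<in>UNIV. d \<beta> \<beta> x)" for \<mu> \<alpha> x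
  define V where "V \<mu> \<alpha> x = (\<Sum>\<rho>\<in>UNIV. \<Sum>\<sigma>\<in>UNIV. epsilon \<mu> \<alpha> \<rho> \<sigma> * et \<mu> * et \<rho> * d \<rho> \<sigma> x)" for \<mu> \<alpha> x
  have var: "expands (\<lambda>s x. lagV \<zeta> (\<lambda>\<beta>. b \<beta> x + s * h \<beta> x) (\<lambda>\<alpha> \<beta>. d \<alpha> \<beta> x + s * H \<alpha> \<beta> x))
    (\<lambda>x. - 384 * cos (4 * \<zeta>) * (4 * (\<Sum>\<alpha>\<in>UNIV. h \<alpha> x * X \<alpha> x))
      - 256 * cos (3 * \<zeta>) * ((\<Sum>\<alpha>\<in>UNIV. h \<alpha> x * Y \<alpha> x) + (\<Sum>\<mu>\<in>UNIV. \<Sum>\<alpha>\<in>UNIV. H \<mu> \<alpha> x * Z \<mu> \<alpha> x))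
      - 32 * cos (2 * \<zeta>) * (\<Sum>\<mu>\<in>UNIV. \<Sum>\<alpha>\<in>UNIV. H \<mu> \<alpha> x * W \<mu> \<alpha> x)
      - 64 * sin (2 * \<zeta>) * (\<Sum>\<mu>\<in>UNIV. \<Sum>\<alpha>\<in>UNIV. H \<mu> \<alpha> x * V \<mu> \<alpha> x))"
  proof -
    have 4: "expands (\<lambda>s x. (\<Sum>\<alpha>\<in>UNIV. et \<alpha> * (b \<alpha> x + s * h \<alpha> x) * (b \<alpha> x + s * h \<alpha> x)) *
        (\<Sum>\<alpha>\<in>UNIV. et \<alpha> * (b \<alpha> x + s * h \<alpha> x) * (b \<alpha> x + s * h \<alpha> x)))
        (\<lambda>x. 4 * (\<Sum>\<alpha>\<in>UNIV. h \<alpha> x * X \<alpha> x))"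
      by (rule expands_cong[OF expands_mult[OF q q]]) (simp add: X_def sum_distrib_left mult_ac)
    have 3: "expands (\<lambda>s x. (\<Sum>\<alpha>\<in>UNIV. et \<alpha> * (b \<alpha> x + s * h \<alpha> x) * (b \<alpha> x + s * h \<alpha> x)) *
        (\<Sum>\<beta>\<in>UNIV. d \<beta> \<beta> x + s * H \<beta> \<beta> x) -
        (\<Sum>\<alpha>\<in>UNIV. \<Sum>\<beta>\<in>UNIV. (b \<alpha> x + s * h \<alpha> x) * (et \<beta> * (b \<beta> x + s * h \<beta> x)) * (d \<alpha> \<beta> x + s * H \<alpha> \<beta> x)))
        (\<lambda>x. (\<Sum>\<alpha>\<in>UNIV. h \<alpha> x * Y \<alpha> x) + (\<Sum>\<mu>\<in>UNIV. \<Sum>\<alpha>\<in>UNIV. H \<mu> \<alpha> x * Z \<mu> \<alpha> x))"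
      by (rule expands_cong[OF expands_diff[OF expands_mult[OF q v] t]])
        (simp add: Y_def Z_def sum4, simp add: algebra_simps)
    have 2: "expands (\<lambda>s x. 2 * (\<Sum>\<alpha>\<in>UNIV. \<Sum>\<beta>\<in>UNIV. et \<alpha> * et \<beta> * (d \<alpha> \<beta> x + s * H \<alpha> \<beta> x) * (d \<alpha> \<beta> x + s * H \<alpha> \<beta> x)) +
        (\<Sum>\<beta>\<in>UNIV. d \<beta> \<beta> x + s * H \<beta> \<beta> x) * (\<Sum>\<beta>\<in>UNIV. d \<beta> \<beta> x + s * H \<beta> \<beta> x))
        (\<lambda>x. \<Sum>\<mu>\<in>UNIV. \<Sum>\<alpha>\<in>UNIV. H \<mu> \<alpha> x * W \<mu> \<alpha> x)"
      by (rule expands_cong[OF expands_add[OF expands_cmult[OF n] expands_mult[OF v v]]])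
        (simp add: W_def sum4, simp add: algebra_simps)
    show ?thesis
      unfolding lagV_def power2_eq_square
      by (rule expands_cong[OF expands_diff[OF expands_diff[OF expands_diff[OF
              expands_mult[OF expands_cmult[OF 4] expands_const] expands_mult[OF expands_cmult[OF 3] expands_const]]
              expands_mult[OF expands_cmult[OF 2] expands_const]] expands_mult[OF expands_cmult[OF e] expands_const]]])
        (auto simp: V_def)
  qed
  have lb: "lagV_b \<zeta> \<alpha> (\<lambda>\<beta>. b \<beta> x) (\<lambda>\<alpha> \<beta>. d \<alpha> \<beta> x) =
      - 1536 * cos (4 * \<zeta>) * X \<alpha> x - 256 * cos (3 * \<zeta>) * Y \<alpha> x" for \<alpha> x
    by (simp add: lagV_b_def X_def Y_def)
  have ld: "lagV_d \<zeta> \<mu> \<alpha> (\<lambda>\<beta>. b \<beta> x) (\<lambda>\<alpha> \<beta>. d \<alpha> \<beta> x) =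
      - 256 * cos (3 * \<zeta>) * Z \<mu> \<alpha> x - 32 * cos (2 * \<zeta>) * W \<mu> \<alpha> x - 64 * sin (2 * \<zeta>) * V \<mu> \<alpha> x" for \<mu> \<alpha> x
    by (simp add: lagV_d_def Z_def W_def V_def)
  show ?thesis
    by (rule expands_cong[OF var])
      (simp add: lb ld right_diff_distrib sum_subtractf sum_negf sum_distrib_left algebra_simps sum.distrib,
        simp add: sum_distrib_left sum_distrib_right mult_ac)
qed

text \<open>The derivative is written out for the field equation and also because
  \<open>euler_lagrange\<close> asks for its continuity, which this form makes visible.\<close>

lemma pd_lagV_d:
  fixes \<zeta> :: real
  assumes B: "smooth B"
  defines "b \<equiv> \<lambda>\<beta> x. B x $ \<beta>"
  defines "d \<equiv> \<lambda>\<alpha> \<beta>. pd \<alpha> (b \<beta>)"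
  defines "P \<equiv> \<lambda>\<mu> \<alpha> x. lagV_d \<zeta> \<mu> \<alpha> (\<lambda>\<beta>. b \<beta> x) (\<lambda>\<alpha> \<beta>. d \<alpha> \<beta> x)"
  shows "P \<mu> \<alpha> differentiable at x"
    and "pd \<nu> (P \<mu> \<alpha>) x =
      - 256 * cos (3 * \<zeta>) * ((if \<mu> = \<alpha> then 1 else 0) * (\<Sum>\<beta>\<in>UNIV. 2 * et \<beta> * b \<beta> x * d \<nu> \<beta> x)
          - b \<mu> x * (et \<alpha> * d \<nu> \<alpha> x) - d \<nu> \<mu> x * (et \<alpha> * b \<alpha> x))
      - 32 * cos (2 * \<zeta>) * (4 * et \<mu> * et \<alpha> * pd \<nu> (d \<mu> \<alpha>) x
          + (if \<mu> = \<alpha> then 2 else 0) * (\<Sum>\<beta>\<in>UNIV. pd \<nu> (d \<beta> \<beta>) x))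
      - 64 * sin (2 * \<zeta>) * (\<Sum>\<rho>\<in>UNIV. \<Sum>\<sigma>\<in>UNIV. epsilon \<mu> \<alpha> \<rho> \<sigma> * et \<mu> * et \<rho> * pd \<nu> (d \<rho> \<sigma>) x)"
proof -
  have bs: "smooth (b \<beta>)" for \<beta>
    unfolding b_def by (rule smooth_component[OF B])
  have ds: "smooth (d \<alpha> \<beta>)" for \<alpha> \<beta>
    unfolding d_def by (rule smooth_pd[OF bs])
  note diff = smooth_differentiable[OF bs] smooth_differentiable[OF ds]
  show "P \<mu> \<alpha> differentiable at x"
    unfolding P_def lagV_d_def sum4
    by (intro differentiable_add differentiable_diff differentiable_mult differentiable_const diff)
  have b: "((\<lambda>t. b \<beta> (x + t *\<^sub>R axis \<nu> 1)) has_real_derivative d \<nu> \<beta> x) (at 0)" for \<beta>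
    using has_vector_derivative_pd[OF diff(1)]
    by (simp add: d_def has_real_derivative_iff_has_vector_derivative)
  have d: "((\<lambda>t. d \<alpha> \<beta> (x + t *\<^sub>R axis \<nu> 1)) has_real_derivative pd \<nu> (d \<alpha> \<beta>) x) (at 0)" for \<alpha> \<beta>
    using has_vector_derivative_pd[OF diff(2)]
    by (simp add: has_real_derivative_iff_has_vector_derivative)
  show "pd \<nu> (P \<mu> \<alpha>) x =
      - 256 * cos (3 * \<zeta>) * ((if \<mu> = \<alpha> then 1 else 0) * (\<Sum>\<beta>\<in>UNIV. 2 * et \<beta> * b \<beta> x * d \<nu> \<beta> x)
          - b \<mu> x * (et \<alpha> * d \<nu> \<alpha> x) - d \<nu> \<mu> x * (et \<alpha> * b \<alpha> x))
      - 32 * cos (2 * \<zeta>) * (4 * et \<mu> * et \<alpha> * pd \<nu> (d \<mu> \<alpha>) x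
          + (if \<mu> = \<alpha> then 2 else 0) * (\<Sum>\<beta>\<in>UNIV. pd \<nu> (d \<beta> \<beta>) x))
      - 64 * sin (2 * \<zeta>) * (\<Sum>\<rho>\<in>UNIV. \<Sum>\<sigma>\<in>UNIV. epsilon \<mu> \<alpha> \<rho> \<sigma> * et \<mu> * et \<rho> * pd \<nu> (d \<rho> \<sigma>) x)"
    unfolding P_def lagV_d_def
    by (rule pd_eqI, unfold has_real_derivative_iff_has_vector_derivative[symmetric])
      (rule DERIV_cong, (rule b d DERIV_const DERIV_diff DERIV_add DERIV_sum DERIV_mult)+,
        simp add: algebra_simps sum.distrib sum_distrib_left)
qed

lemma sum_if_mult: "(\<Sum>\<mu>\<in>UNIV. (if \<mu> = \<alpha> then k else 0) * f \<mu>) = k * f \<alpha>" for f :: "4 \<Rightarrow> real"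
  by (simp add: if_distrib[of "\<lambda>c. c * _"] cong: if_cong)

text \<open>In the cubic part, b^\<beta> times the derivative of b_\<alpha> along \<beta> occurs
  equally in \<open>lagV_b\<close> and in the divergence and cancels. Each of the two remaining
  terms then has weight 2 + 1 = 3, whence 768.\<close>

lemma variational_derivative:
  assumes B: "smooth B"
  defines "b \<equiv> \<lambda>\<beta> x. B x $ \<beta>"
  defines "d \<equiv> \<lambda>\<alpha> \<beta>. pd \<alpha> (b \<beta>)"
  shows "lagV_b \<zeta> \<alpha> (\<lambda>\<beta>. b \<beta> x) (\<lambda>\<alpha> \<beta>. d \<alpha> \<beta> x) -
      (\<Sum>\<mu>\<in>UNIV. pd \<mu> (\<lambda>x. lagV_d \<zeta> \<mu> \<alpha> (\<lambda>\<beta>. b \<beta> x) (\<lambda>\<alpha> \<beta>. d \<alpha> \<beta> x)) x) =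
    128 * cos (2 * \<zeta>) * ((\<Sum>\<beta>\<in>UNIV. et \<beta> * et \<alpha> * pd \<beta> (d \<beta> \<alpha>) x) + 1/2 * (\<Sum>\<beta>\<in>UNIV. pd \<alpha> (d \<beta> \<beta>) x))
    + 768 * cos (3 * \<zeta>) * ((\<Sum>\<beta>\<in>UNIV. et \<beta> * b \<beta> x * d \<alpha> \<beta> x) - et \<alpha> * b \<alpha> x * (\<Sum>\<beta>\<in>UNIV. d \<beta> \<beta> x))
    - 1536 * cos (4 * \<zeta>) * (\<Sum>\<beta>\<in>UNIV. et \<beta> * b \<beta> x * b \<beta> x) * (et \<alpha> * b \<alpha> x)"
proof -
  have comm: "pd \<mu> (d \<nu> \<sigma>) x = pd \<nu> (d \<mu> \<sigma>) x" for \<mu> \<nu> \<sigma>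
    unfolding d_def b_def by (rule pd_commute[OF smooth_component[OF B]])
  \<comment> \<open>Oriented so that rewriting orders the two derivative indices; the epsilon terms
    then cancel in pairs.\<close>
  note sym = comm[of 1 0] comm[of 2 0] comm[of 3 0] comm[of 2 1] comm[of 3 1] comm[of 3 2]
  define q where "q = (\<Sum>\<beta>\<in>UNIV. et \<beta> * b \<beta> x * b \<beta> x)"
  have 3: "(\<Sum>\<mu>\<in>UNIV. (if \<mu> = \<alpha> then 1 else 0) * (\<Sum>\<beta>\<in>UNIV. 2 * et \<beta> * b \<beta> x * d \<mu> \<beta> x)
          - b \<mu> x * (et \<alpha> * d \<mu> \<alpha> x) - d \<mu> \<mu> x * (et \<alpha> * b \<alpha> x)) =
      2 * (\<Sum>\<beta>\<in>UNIV. et \<beta> * b \<beta> x * d \<alpha> \<beta> x) - (\<Sum>\<beta>\<in>UNIV. b \<beta> x * (et \<alpha> * d \<beta> \<alpha> x))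
      - et \<alpha> * b \<alpha> x * (\<Sum>\<beta>\<in>UNIV. d \<beta> \<beta> x)"
    unfolding sum_subtractf sum_if_mult by (simp add: sum_distrib_left mult_ac)
  have 2: "(\<Sum>\<mu>\<in>UNIV. 4 * et \<mu> * et \<alpha> * pd \<mu> (d \<mu> \<alpha>) x + (if \<mu> = \<alpha> then 2 else 0) * (\<Sum>\<beta>\<in>UNIV. pd \<mu> (d \<beta> \<beta>) x)) =
      4 * ((\<Sum>\<beta>\<in>UNIV. et \<beta> * et \<alpha> * pd \<beta> (d \<beta> \<alpha>) x) + 1/2 * (\<Sum>\<beta>\<in>UNIV. pd \<alpha> (d \<beta> \<beta>) x))"
    unfolding sum.distrib sum_if_mult by (simp add: sum_distrib_left mult_ac)
  have e: "(\<Sum>\<mu>\<in>UNIV. \<Sum>\<rho>\<in>UNIV. \<Sum>\<sigma>\<in>UNIV. epsilon \<mu> \<alpha> \<rho> \<sigma> * et \<mu> * et \<rho> * pd \<mu> (d \<rho> \<sigma>) x) = 0"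
  proof -
    have "\<forall>\<alpha>. (\<Sum>\<mu>\<in>UNIV. \<Sum>\<rho>\<in>UNIV. \<Sum>\<sigma>\<in>UNIV. epsilon \<mu> \<alpha> \<rho> \<sigma> * et \<mu> * et \<rho> * pd \<mu> (d \<rho> \<sigma>) x) = 0"
      unfolding all4 sum4 by (simp add: epsilon_sort et_simps sym)
    then show ?thesis by blast
  qed
  have "(\<Sum>\<mu>\<in>UNIV. pd \<mu> (\<lambda>x. lagV_d \<zeta> \<mu> \<alpha> (\<lambda>\<beta>. b \<beta> x) (\<lambda>\<alpha> \<beta>. d \<alpha> \<beta> x)) x) =
      - 256 * cos (3 * \<zeta>) * (2 * (\<Sum>\<beta>\<in>UNIV. et \<beta> * b \<beta> x * d \<alpha> \<beta> x) - (\<Sum>\<beta>\<in>UNIV. b \<beta> x * (et \<alpha> * d \<beta> \<alpha> x))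
        - et \<alpha> * b \<alpha> x * (\<Sum>\<beta>\<in>UNIV. d \<beta> \<beta> x))
      - 32 * cos (2 * \<zeta>) * (4 * ((\<Sum>\<beta>\<in>UNIV. et \<beta> * et \<alpha> * pd \<beta> (d \<beta> \<alpha>) x) + 1/2 * (\<Sum>\<beta>\<in>UNIV. pd \<alpha> (d \<beta> \<beta>) x)))
      - 64 * sin (2 * \<zeta>) * 0"
    unfolding d_def b_def pd_lagV_d(2)[OF B]
    unfolding 3[unfolded d_def b_def, symmetric] 2[unfolded d_def b_def, symmetric] e[unfolded d_def b_def, symmetric]
    unfolding sum_subtractf sum_distrib_left[symmetric] ..
  then show ?thesis
    by (simp add: lagV_b_def algebra_simps)
qed

section \<open>The field equation in components\<close>

lemma continuous_on_herm:
  assumes "continuous_on S f" "continuous_on S g"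
  shows "continuous_on S (\<lambda>x. herm (f x) (g x))"
  unfolding herm_alt by (intro continuous_intros assms)

lemma continuous_on_mv: "continuous_on S f \<Longrightarrow> continuous_on S (\<lambda>x. M *v f x)" for M :: ext_op
  unfolding matrix_vector_mult_def by (intro continuous_intros)

lemma lower_nth: "lower v $ \<alpha> = et \<alpha> * v $ \<alpha>"
  using eta_sum[of \<alpha> "\<lambda>\<beta>. v $ \<beta>"] by (simp add: lower_def et_def)

lemma pd_up_eq: "pd_up \<alpha> f x = et \<alpha> *\<^sub>R pd \<alpha> f x"
  by (simp add: pd_up_def eta_sum et_def)

text \<open>The field equation before division by 128 \<tau> cos 2\<zeta>, with lowered indices
  written as factors \<open>et\<close>. The real part on the left comes from adding the complex
  conjugate in \<open>L_K\<close>.\<close>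

lemma stationary_iff:
  assumes B: "smooth B" and \<psi>: "smooth \<psi>"
  shows "stationary (\<lambda>B' x. L_K m (F \<zeta> B') \<psi> x - complex_of_real \<tau> * L_V (F \<zeta> B') x) B \<longleftrightarrow>
    (\<forall>x \<alpha>. Re (herm (\<psi> x) (current \<zeta> \<alpha> *v \<psi> x)) = \<tau> *
      (128 * cos (2 * \<zeta>) * ((\<Sum>\<beta>\<in>UNIV. et \<beta> * et \<alpha> * pd \<beta> (pd \<beta> (\<lambda>y. B y $ \<alpha>)) x)
          + 1/2 * (\<Sum>\<beta>\<in>UNIV. pd \<alpha> (pd \<beta> (\<lambda>y. B y $ \<beta>)) x))
      + 768 * cos (3 * \<zeta>) * ((\<Sum>\<beta>\<in>UNIV. et \<beta> * B x $ \<beta> * pd \<alpha> (\<lambda>y. B y $ \<beta>) x)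
          - et \<alpha> * B x $ \<alpha> * (\<Sum>\<beta>\<in>UNIV. pd \<beta> (\<lambda>y. B y $ \<beta>) x))
      - 1536 * cos (4 * \<zeta>) * (\<Sum>\<beta>\<in>UNIV. et \<beta> * B x $ \<beta> * B x $ \<beta>) * (et \<alpha> * B x $ \<alpha>)))"
proof -
  define b where "b \<beta> x = B x $ \<beta>" for \<beta> x
  define d where "d \<alpha> \<beta> = pd \<alpha> (b \<beta>)" for \<alpha> \<beta>
  define S where "S \<beta> x = Re (herm (\<psi> x) (current \<zeta> \<beta> *v \<psi> x))" for \<beta> x
  define A where "A \<alpha> x = S \<alpha> x - \<tau> * lagV_b \<zeta> \<alpha> (\<lambda>\<beta>. b \<beta> x) (\<lambda>\<alpha> \<beta>. d \<alpha> \<beta> x)" for \<alpha> x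
  define P where "P \<mu> \<alpha> x = - \<tau> * lagV_d \<zeta> \<mu> \<alpha> (\<lambda>\<beta>. b \<beta> x) (\<lambda>\<alpha> \<beta>. d \<alpha> \<beta> x)" for \<mu> \<alpha> x
  \<comment> \<open>The Lagrangian at B + s h: by linearity of \<open>pd\<close> the field and its
    derivatives are affine in s. The part without B is constant in s, and
    \<open>expands_const\<close> needs only its continuity.\<close>
  define G where "G h s x = lagK0 m \<psi> x + (\<Sum>\<beta>\<in>UNIV. (b \<beta> x + s * h x $ \<beta>) * S \<beta> x) -
    \<tau> * lagV \<zeta> (\<lambda>\<beta>. b \<beta> x + s * h x $ \<beta>) (\<lambda>\<alpha> \<beta>. d \<alpha> \<beta> x + s * pd \<alpha> (\<lambda>y. h y $ \<beta>) x)" for h :: "real^4 \<Rightarrow> real^4" and s x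
  have bd: "b = (\<lambda>\<beta> x. B x $ \<beta>)" "d = (\<lambda>\<alpha> \<beta>. pd \<alpha> (\<lambda>x. B x $ \<beta>))"
    by (simp_all add: b_def d_def fun_eq_iff b_def[abs_def])
  have bs: "smooth (b \<beta>)" for \<beta>
    unfolding bd by (rule smooth_component[OF B])
  have ds: "smooth (d \<alpha> \<beta>)" for \<alpha> \<beta>
    unfolding d_def by (rule smooth_pd[OF bs])
  note cont = smooth_continuous[OF bs] smooth_continuous[OF ds] smooth_continuous[OF smooth_pd[OF ds]]
  have Sc: "continuous_on T (S \<beta>)" for T \<beta>
    unfolding S_def by (intro continuous_on_Re continuous_on_herm continuous_on_mv smooth_continuous \<psi>)
  have Kc: "continuous_on T (lagK0 m \<psi>)" for T
    unfolding lagK0_def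
    by (intro continuous_on_diff continuous_on_mult continuous_on_const continuous_on_sum continuous_on_Re
        continuous_on_herm continuous_on_mv smooth_continuous \<psi> smooth_pd)
  have pdP: "pd \<nu> (P \<mu> \<alpha>) x = - \<tau> * pd \<nu> (\<lambda>x. lagV_d \<zeta> \<mu> \<alpha> (\<lambda>\<beta>. b \<beta> x) (\<lambda>\<alpha> \<beta>. d \<alpha> \<beta> x)) x" for \<mu> \<alpha> \<nu> x
    unfolding P_def by (rule pd_cmult) (simp add: bd pd_lagV_d(1)[OF B])
  have "stationary (\<lambda>B' x. L_K m (F \<zeta> B') \<psi> x - complex_of_real \<tau> * L_V (F \<zeta> B') x) B \<longleftrightarrow>
      (\<forall>x \<alpha>. A \<alpha> x = (\<Sum>\<mu>\<in>UNIV. pd \<mu> (P \<mu> \<alpha>) x))"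
  proof (rule euler_lagrange[where G = G])
    fix h :: "real^4 \<Rightarrow> real^4" assume h: "smooth h"
    note hs = smooth_component[OF h]
    show "L_K m (F \<zeta> (\<lambda>y. B y + s *\<^sub>R h y)) \<psi> x - complex_of_real \<tau> * L_V (F \<zeta> (\<lambda>y. B y + s *\<^sub>R h y)) x =
        complex_of_real (G h s x)" for s x
    proof -
      note diff = smooth_differentiable[OF B] smooth_differentiable[OF h]
      have "(\<lambda>y. B y + s *\<^sub>R h y) differentiable at x"
        by (intro differentiable_add differentiable_scaleR differentiable_const diff)
      from L_V_lagV[OF this] have "L_V (F \<zeta> (\<lambda>y. B y + s *\<^sub>R h y)) x = complex_of_real
          (lagV \<zeta> (\<lambda>\<beta>. b \<beta> x + s * h x $ \<beta>) (\<lambda>\<alpha> \<beta>. d \<alpha> \<beta> x + s * pd \<alpha> (\<lambda>y. h y $ \<beta>) x))"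
        by (simp add: bd pd_component diff pd_add pd_scaleR differentiable_scaleR)
      then show ?thesis
        by (simp add: L_K_split G_def S_def b_def)
    qed
    show "expands (G h) (\<lambda>x. (\<Sum>\<alpha>\<in>UNIV. h x $ \<alpha> * A \<alpha> x) +
        (\<Sum>\<mu>\<in>UNIV. \<Sum>\<alpha>\<in>UNIV. pd \<mu> (\<lambda>y. h y $ \<alpha>) x * P \<mu> \<alpha> x))"
      unfolding G_def
      by (rule expands_cong[OF expands_diff[OF expands_add[OF expands_const expands_sum[OF expands_mult[OF expands_line expands_const]]]
              expands_cmult[OF expands_lagV]]])
        (intro Kc Sc cont smooth_continuous hs smooth_pd |
          simp add: A_def P_def algebra_simps sum.distrib sum_subtractf sum_distrib_left sum_negf)+
  next
    show "continuous_on UNIV (A \<alpha>)" for \<alpha>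
      unfolding A_def lagV_b_def
      by (intro continuous_on_diff continuous_on_mult continuous_on_const continuous_on_sum Sc cont)
    show "P \<mu> \<alpha> differentiable at x" for \<mu> \<alpha> x
      unfolding P_def bd by (intro differentiable_mult differentiable_const pd_lagV_d(1)[OF B])
    show "continuous_on UNIV (pd \<mu> (P \<mu> \<alpha>))" for \<mu> \<alpha>
      unfolding pdP[abs_def] bd pd_lagV_d(2)[OF B]
      by (intro continuous_on_add continuous_on_diff continuous_on_mult continuous_on_const continuous_on_sum
          cont[unfolded bd])
  qed
  also have "\<dots> \<longleftrightarrow> (\<forall>x \<alpha>. S \<alpha> x = \<tau> * (lagV_b \<zeta> \<alpha> (\<lambda>\<beta>. b \<beta> x) (\<lambda>\<alpha> \<beta>. d \<alpha> \<beta> x) -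
      (\<Sum>\<mu>\<in>UNIV. pd \<mu> (\<lambda>x. lagV_d \<zeta> \<mu> \<alpha> (\<lambda>\<beta>. b \<beta> x) (\<lambda>\<alpha> \<beta>. d \<alpha> \<beta> x)) x)))"
    unfolding A_def pdP sum_distrib_left[symmetric] by (simp add: algebra_simps)
  finally show ?thesis
    unfolding S_def bd variational_derivative[OF B] .
qed

section \<open>The density and the field equation in index notation\<close>

theorem mainTheorem6:
  fixes B :: "real^4 \<Rightarrow> real^4" and \<zeta> :: real
  assumes "smooth B"
  shows "(\<forall>x. L_V (F \<zeta> B) x = complex_of_real
        (- 384 * (\<Sum>\<alpha>\<in>UNIV. lower (B x) $ \<alpha> * B x $ \<alpha>)\<^sup>2 * cos (4 * \<zeta>)
         - 256 * ((\<Sum>\<alpha>\<in>UNIV. B x $ \<alpha> * lower (B x) $ \<alpha>) * (\<Sum>\<beta>\<in>UNIV. pd \<beta> (\<lambda>y. B y $ \<beta>) x)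
                  - (\<Sum>\<alpha>\<in>UNIV. \<Sum>\<beta>\<in>UNIV. B x $ \<alpha> * lower (B x) $ \<beta> * pd \<alpha> (\<lambda>y. B y $ \<beta>) x))
               * cos (3 * \<zeta>)
         - 32 * (2 * (\<Sum>\<alpha>\<in>UNIV. \<Sum>\<beta>\<in>UNIV. pd \<alpha> (\<lambda>y. B y $ \<beta>) x * pd_up \<alpha> (\<lambda>y. lower (B y) $ \<beta>) x)
                 + (\<Sum>\<alpha>\<in>UNIV. pd \<alpha> (\<lambda>y. B y $ \<alpha>) x)\<^sup>2) * cos (2 * \<zeta>)
         - 32 * (\<Sum>\<alpha>\<in>UNIV. \<Sum>\<beta>\<in>UNIV. \<Sum>\<rho>\<in>UNIV. \<Sum>\<sigma>\<in>UNIV.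
                   epsilon \<alpha> \<beta> \<rho> \<sigma> * pd_up \<alpha> (\<lambda>y. B y $ \<beta>) x * pd_up \<rho> (\<lambda>y. B y $ \<sigma>) x)
               * sin (2 * \<zeta>)))
    \<and> (\<forall>(\<tau>::real) (m::real) (\<psi> :: real^4 \<Rightarrow> ext).
        \<tau> \<noteq> 0 \<and> cos (2 * \<zeta>) \<noteq> 0 \<and> smooth \<psi> \<longrightarrow>
        (stationary (\<lambda>B' x. L_K m (F \<zeta> B') \<psi> x - complex_of_real \<tau> * L_V (F \<zeta> B') x) B \<longleftrightarrow>
         (\<forall>x \<alpha>.
            complex_of_real
              ((\<Sum>\<beta>\<in>UNIV. pd \<beta> (pd_up \<beta> (\<lambda>y. lower (B y) $ \<alpha>)) x)
               + 1/2 * pd \<alpha> (\<lambda>y. \<Sum>\<beta>\<in>UNIV. pd \<beta> (\<lambda>z. B z $ \<beta>) y) x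
               + 6 * cos (3 * \<zeta>) / cos (2 * \<zeta>)
                   * ((\<Sum>\<beta>\<in>UNIV. lower (B x) $ \<beta> * pd \<alpha> (\<lambda>y. B y $ \<beta>) x)
                      - lower (B x) $ \<alpha> * (\<Sum>\<beta>\<in>UNIV. pd \<beta> (\<lambda>y. B y $ \<beta>) x))
               - 12 * cos (4 * \<zeta>) / cos (2 * \<zeta>)
                   * (\<Sum>\<beta>\<in>UNIV. lower (B x) $ \<beta> * B x $ \<beta>) * lower (B x) $ \<alpha>)
            = complex_of_real (1 / (128 * \<tau> * cos (2 * \<zeta>)))
              * herm (\<psi> x)
                  ((\<Sum>\<beta>\<in>UNIV. gamma_up \<beta> ** mexp (\<zeta> *\<^sub>R JJ) ** Theta [\<beta>, \<alpha>]) *v \<psi> x))))"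
proof (intro conjI allI impI)
  have d: "pd \<alpha> (\<lambda>y. B y $ \<beta>) x = pd \<alpha> B x $ \<beta>" for \<alpha> \<beta> x
    by (rule pd_component[OF smooth_differentiable[OF assms]])
  have u: "pd_up \<alpha> (\<lambda>y. B y $ \<beta>) x = et \<alpha> * pd \<alpha> (\<lambda>y. B y $ \<beta>) x"
    "pd_up \<alpha> (\<lambda>y. lower (B y) $ \<beta>) x = et \<alpha> * (et \<beta> * pd \<alpha> (\<lambda>y. B y $ \<beta>) x)" for \<alpha> \<beta> x
    using pd_cmult[OF smooth_differentiable[OF smooth_component[OF assms]], of \<alpha> "et \<beta>" \<beta>]
    by (simp_all add: pd_up_eq lower_nth)
  fix x
  let ?d = "\<lambda>\<alpha> \<beta>. pd \<alpha> (\<lambda>y. B y $ \<beta>) x"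
  have L: "L_V (F \<zeta> B) x = complex_of_real (lagV \<zeta> (\<lambda>\<beta>. B x $ \<beta>) ?d)"
    unfolding d by (rule L_V_lagV[OF smooth_differentiable[OF assms]])
  have e: "(\<Sum>\<alpha>\<in>UNIV. \<Sum>\<beta>\<in>UNIV. \<Sum>\<rho>\<in>UNIV. \<Sum>\<sigma>\<in>UNIV.
      epsilon \<alpha> \<beta> \<rho> \<sigma> * pd_up \<alpha> (\<lambda>y. B y $ \<beta>) x * pd_up \<rho> (\<lambda>y. B y $ \<sigma>) x) = 2 * ephat ?d"
    unfolding u by (rule epsilon_sum)
  show "L_V (F \<zeta> B) x = complex_of_real
        (- 384 * (\<Sum>\<alpha>\<in>UNIV. lower (B x) $ \<alpha> * B x $ \<alpha>)\<^sup>2 * cos (4 * \<zeta>)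
         - 256 * ((\<Sum>\<alpha>\<in>UNIV. B x $ \<alpha> * lower (B x) $ \<alpha>) * (\<Sum>\<beta>\<in>UNIV. pd \<beta> (\<lambda>y. B y $ \<beta>) x)
                  - (\<Sum>\<alpha>\<in>UNIV. \<Sum>\<beta>\<in>UNIV. B x $ \<alpha> * lower (B x) $ \<beta> * pd \<alpha> (\<lambda>y. B y $ \<beta>) x))
               * cos (3 * \<zeta>)
         - 32 * (2 * (\<Sum>\<alpha>\<in>UNIV. \<Sum>\<beta>\<in>UNIV. pd \<alpha> (\<lambda>y. B y $ \<beta>) x * pd_up \<alpha> (\<lambda>y. lower (B y) $ \<beta>) x)
                 + (\<Sum>\<alpha>\<in>UNIV. pd \<alpha> (\<lambda>y. B y $ \<alpha>) x)\<^sup>2) * cos (2 * \<zeta>)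
         - 32 * (\<Sum>\<alpha>\<in>UNIV. \<Sum>\<beta>\<in>UNIV. \<Sum>\<rho>\<in>UNIV. \<Sum>\<sigma>\<in>UNIV.
                   epsilon \<alpha> \<beta> \<rho> \<sigma> * pd_up \<alpha> (\<lambda>y. B y $ \<beta>) x * pd_up \<rho> (\<lambda>y. B y $ \<sigma>) x)
               * sin (2 * \<zeta>))"
    unfolding L e unfolding u unfolding lagV_def lower_nth
    by (rule arg_cong[of _ _ complex_of_real]) (simp add: mult_ac)
next
  fix \<tau> m :: real and \<psi> :: "real^4 \<Rightarrow> ext"
  assume *: "\<tau> \<noteq> 0 \<and> cos (2 * \<zeta>) \<noteq> 0 \<and> smooth \<psi>"
  have up: "pd \<beta> (pd_up \<beta> (\<lambda>y. lower (B y) $ \<alpha>)) x = et \<beta> * et \<alpha> * pd \<beta> (pd \<beta> (\<lambda>y. B y $ \<alpha>)) x" for \<alpha> \<beta> x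
  proof -
    note s = smooth_component[OF assms]
    have "pd_up \<beta> (\<lambda>y. lower (B y) $ \<alpha>) = (\<lambda>x. (et \<beta> * et \<alpha>) * pd \<beta> (\<lambda>y. B y $ \<alpha>) x)"
      by (simp add: fun_eq_iff pd_up_eq lower_nth pd_cmult[OF smooth_differentiable[OF s]])
    then show ?thesis by (simp only: pd_cmult[OF smooth_differentiable[OF smooth_pd[OF s]]])
  qed
  have ps: "pd \<alpha> (\<lambda>y. \<Sum>\<beta>\<in>UNIV. pd \<beta> (\<lambda>z. B z $ \<beta>) y) x = (\<Sum>\<beta>\<in>UNIV. pd \<alpha> (pd \<beta> (\<lambda>z. B z $ \<beta>)) x)" for \<alpha> x
    by (rule pd_sum) (rule smooth_differentiable[OF smooth_pd[OF smooth_component[OF assms]]])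
  \<comment> \<open>Reduces the complex equation to a real one: z is the self-adjoint current form,
    c = 1 / (128 \<tau> cos 2\<zeta>), and k is \<tau> times the variational derivative.\<close>
  have real: "complex_of_real r = complex_of_real c * z \<longleftrightarrow> Re z = k" if "z = complex_of_real (Re z)" "r = c * k" "c \<noteq> 0"
    for r c k z
    using that by (metis mult_cancel_left of_real_eq_iff of_real_mult)
  show "stationary (\<lambda>B' x. L_K m (F \<zeta> B') \<psi> x - complex_of_real \<tau> * L_V (F \<zeta> B') x) B \<longleftrightarrow>
         (\<forall>x \<alpha>.
            complex_of_real
              ((\<Sum>\<beta>\<in>UNIV. pd \<beta> (pd_up \<beta> (\<lambda>y. lower (B y) $ \<alpha>)) x)
               + 1/2 * pd \<alpha> (\<lambda>y. \<Sum>\<beta>\<in>UNIV. pd \<beta> (\<lambda>z. B z $ \<beta>) y) x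
               + 6 * cos (3 * \<zeta>) / cos (2 * \<zeta>)
                   * ((\<Sum>\<beta>\<in>UNIV. lower (B x) $ \<beta> * pd \<alpha> (\<lambda>y. B y $ \<beta>) x)
                      - lower (B x) $ \<alpha> * (\<Sum>\<beta>\<in>UNIV. pd \<beta> (\<lambda>y. B y $ \<beta>) x))
               - 12 * cos (4 * \<zeta>) / cos (2 * \<zeta>)
                   * (\<Sum>\<beta>\<in>UNIV. lower (B x) $ \<beta> * B x $ \<beta>) * lower (B x) $ \<alpha>)
            = complex_of_real (1 / (128 * \<tau> * cos (2 * \<zeta>)))
              * herm (\<psi> x)
                  ((\<Sum>\<beta>\<in>UNIV. gamma_up \<beta> ** mexp (\<zeta> *\<^sub>R JJ) ** Theta [\<beta>, \<alpha>]) *v \<psi> x))"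
    unfolding stationary_iff[OF assms conjunct2[OF conjunct2[OF *]]] current_def[symmetric] up ps
    by (intro all_cong1 real[symmetric] herm_current_real)
      (use * in \<open>simp_all add: lower_nth field_simps\<close>)
qed

end
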